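(* There are equivalences of 2-categories $$\mathbf{CxlCat}\simeq\mathbf{CompCat}^{\mathrm{str1}}_{\mathrm{disc},\mathrm{cxl}}\simeq\mathbf{CompCat}^{\mathrm{str2}}_{\mathrm{disc},\mathrm{cxl}}\simeq\mathbf{CompCat}^{\mathrm{ps}}_{\mathrm{disc},\mathrm{cxl}},$$ where $\mathbf{CxlCat}$ is the 1-category of contextual categories and homomorphisms, and the others are respectively the 1-category of discrete contextual comprehension categories and strict maps, the 2-category of these with strict maps and transformations, and the 2-category of these with pseudo maps and transformations (1-categories being viewed as locally discrete 2-categories).
   Context: **Contextual categories.** A contextual category consists of (1) a category $\mathcal C$ with a distinguished terminal object $1$; (2) a (rooted, finite-height) tree structure on $\mathrm{ob}\,\mathcal C$ with root $1$; (3) for each non-root object $A$, a projection map $p_A$ from $A$ to its parent; and (4) chosen pullbacks of projections along arbitrary maps, which are again projections, $f^*p_A=p_{f^*A}$ (so for $f:\Delta\to\Gamma$ with $\Gamma$ the parent of $A$, $f^*A$ has parent $\Delta$), strictly functorial in that $\mathrm{id}^*A=A$, $(fg)^*A=g^*f^*A$ (and likewise for the chosen top maps $f^*A\to A$ of the pullback squares). A homomorphism is a functor commuting on the nose with all the given structure. **Comprehension categories.** A comprehension category $(\mathcal C,\mathcal T,p,\chi)$ is a category $\mathcal C$, a fibration $p:\mathcal T\to\mathcal C$, and a functor $\chi:\mathcal T\to\mathcal C^{\to}$ to the arrow category with $\mathrm{cod}\circ\chi=p$ strictly, sending $p$-cartesian maps to pullback squares. For $A\in\mathcal T_\Gamma=p^{-1}(\Gamma)$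 the domain of $\chi(A)$ is written $\Gamma.A$. A *pseudo map* $(F,\bar F,\varphi)$ is a functor $F:\mathcal C\to\mathcal C'$, a functor $\bar F:\mathcal T\to\mathcal T'$ strictly over $F$ preserving cartesian maps, and a natural isomorphism $\varphi:\chi'\bar F\cong F^{\to}\chi$ lying strictly over the identity of $F$; it is *strict* if $\chi'\bar F=F^{\to}\chi$ and $\varphi$ is the identity. A *transformation* $(F,\bar F,\varphi)\Rightarrow(G,\bar G,\gamma)$ is a natural transformation $\alpha:F\Rightarrow G$ and another $\bar\alpha:\bar F\Rightarrow\bar G$ strictly over $\alpha$, with $\gamma_A\circ\chi'(\bar\alpha_A)=\alpha_{\Gamma.A}\circ\varphi_A$ for all $A\in\mathcal T_\Gamma$. It is *discrete* if $p$ is a discrete fibration. A comprehension category is *contextual* if equipped with a distinguished terminal object $1$ such that every object is uniquely expressible as an iterated context extension $1.A_0\ldots A_{n-1}$, $n\ge0$, with each $A_k\in\mathcal T_{1.A_0\ldots A_{k-1}}$. Pseudo maps of contextual comprehension categories are required to preserve $1$ up to specified isomorphism; strict maps are required to preserve $1$ on the nose; transformations are required to commute at $1$ with the given isomorphisms. **Conventions.** 2-categories are strict; an equivalence of 2-categories is a 2-functor inducing equivalences on hom-categories and surjective on objects up to internal equivalence. *)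

theory Defs
  imports "HOL-Library.FuncSet" "HOL-Library.Infinite_Typeclass"
begin

section \<open>Categories\<close>

text \<open>
  Structures are records with explicit carriers, and their operations are unconstrained outside the
  carriers.  Functors and transformations, in contrast, are extensional (\<open>undefined\<close> outside
  the carriers), so that equality of 1-cells and of 2-cells is the intended one.  Two structures
  that differ outside their carriers only are distinct, but isomorphic through identity maps.
\<close>

record ('o, 'a) cat =
  obs :: "'o set"
  arrs :: "'a set"
  src :: "'a \<Rightarrow> 'o"
  trg :: "'a \<Rightarrow> 'o"
  idn :: "'o \<Rightarrow> 'a"
  cmp :: "'a \<Rightarrow> 'a \<Rightarrow> 'a"  \<comment> \<open>\<open>cmp C g f\<close> is "g after f"\<close>

definition hom :: "('o, 'a) cat \<Rightarrow> 'o \<Rightarrow> 'o \<Rightarrow> 'a set" where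
  "hom C x y = {f \<in> arrs C. src C f = x \<and> trg C f = y}"

locale category =
  fixes C :: "('o, 'a) cat"
  assumes src_in: "f \<in> arrs C \<Longrightarrow> src C f \<in> obs C"
    and trg_in: "f \<in> arrs C \<Longrightarrow> trg C f \<in> obs C"
    and idn_in: "x \<in> obs C \<Longrightarrow> idn C x \<in> hom C x x"
    and cmp_in: "f \<in> hom C x y \<Longrightarrow> g \<in> hom C y z \<Longrightarrow> cmp C g f \<in> hom C x z"
    and cmp_assoc: "f \<in> hom C w x \<Longrightarrow> g \<in> hom C x y \<Longrightarrow> h \<in> hom C y z \<Longrightarrow>
      cmp C h (cmp C g f) = cmp C (cmp C h g) f"
    and cmp_idn_left: "f \<in> hom C x y \<Longrightarrow> cmp C (idn C y) f = f"
    and cmp_idn_right: "f \<in> hom C x y \<Longrightarrow> cmp C f (idn C x) = f"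

definition iso :: "('o, 'a) cat \<Rightarrow> 'a \<Rightarrow> bool" where
  "iso C f \<longleftrightarrow> f \<in> arrs C \<and>
    (\<exists>g \<in> hom C (trg C f) (src C f).
      cmp C g f = idn C (src C f) \<and> cmp C f g = idn C (trg C f))"

definition isomorphic :: "('o, 'a) cat \<Rightarrow> 'o \<Rightarrow> 'o \<Rightarrow> bool" where
  "isomorphic C x y \<longleftrightarrow> (\<exists>f \<in> hom C x y. iso C f)"

definition terminal :: "('o, 'a) cat \<Rightarrow> 'o \<Rightarrow> bool" where
  "terminal C t \<longleftrightarrow> t \<in> obs C \<and> (\<forall>x \<in> obs C. \<exists>!f. f \<in> hom C x t)"

definition prod_cat :: "('o, 'a) cat \<Rightarrow> ('p, 'b) cat \<Rightarrow> ('o \<times> 'p, 'a \<times> 'b) cat" where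
  "prod_cat C D = \<lparr>
    obs = obs C \<times> obs D,
    arrs = arrs C \<times> arrs D,
    src = (\<lambda>(f, g). (src C f, src D g)),
    trg = (\<lambda>(f, g). (trg C f, trg D g)),
    idn = (\<lambda>(x, y). (idn C x, idn D y)),
    cmp = (\<lambda>(f', g') (f, g). (cmp C f' f, cmp D g' g))\<rparr>"

definition discrete_cat :: "'o set \<Rightarrow> ('o, 'o) cat" where
  "discrete_cat S =
    \<lparr>obs = S, arrs = S, src = (\<lambda>x. x), trg = (\<lambda>x. x), idn = (\<lambda>x. x), cmp = (\<lambda>y x. x)\<rparr>"


section \<open>Functors and natural transformations\<close>

record ('o, 'a, 'p, 'b) fctr =
  fob :: "'o \<Rightarrow> 'p"
  far :: "'a \<Rightarrow> 'b"

locale cat_functor = source: category C + target: category D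
  for C :: "('o, 'a) cat" and D :: "('p, 'b) cat" +
  fixes F :: "('o, 'a, 'p, 'b) fctr"
  assumes fob_in: "fob F \<in> obs C \<rightarrow>\<^sub>E obs D"
    and far_in: "far F \<in> arrs C \<rightarrow>\<^sub>E arrs D"
    and far_src: "f \<in> arrs C \<Longrightarrow> src D (far F f) = fob F (src C f)"
    and far_trg: "f \<in> arrs C \<Longrightarrow> trg D (far F f) = fob F (trg C f)"
    and far_idn: "x \<in> obs C \<Longrightarrow> far F (idn C x) = idn D (fob F x)"
    and far_cmp: "f \<in> hom C x y \<Longrightarrow> g \<in> hom C y z \<Longrightarrow>
      far F (cmp C g f) = cmp D (far F g) (far F f)"

definition id_functor :: "('o, 'a) cat \<Rightarrow> ('o, 'a, 'o, 'a) fctr" where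
  "id_functor C = \<lparr>fob = (\<lambda>x \<in> obs C. x), far = (\<lambda>f \<in> arrs C. f)\<rparr>"

definition comp_functor ::
  "('o, 'a) cat \<Rightarrow> ('p, 'b, 'q, 'c) fctr \<Rightarrow> ('o, 'a, 'p, 'b) fctr \<Rightarrow> ('o, 'a, 'q, 'c) fctr" where
  "comp_functor C G F =
    \<lparr>fob = compose (obs C) (fob G) (fob F), far = compose (arrs C) (far G) (far F)\<rparr>"

locale nat_trans = F: cat_functor C D F + G: cat_functor C D G
  for C :: "('o, 'a) cat" and D :: "('p, 'b) cat" and F G +
  fixes \<tau> :: "'o \<Rightarrow> 'b"
  assumes component_ext: "\<tau> \<in> extensional (obs C)"
    and component_in: "x \<in> obs C \<Longrightarrow> \<tau> x \<in> hom D (fob F x) (fob G x)"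
    and naturality: "f \<in> hom C x y \<Longrightarrow> cmp D (\<tau> y) (far F f) = cmp D (far G f) (\<tau> x)"

locale nat_iso = nat_trans +
  assumes component_iso: "x \<in> obs C \<Longrightarrow> iso D (\<tau> x)"

locale cat_equivalence = cat_functor C D F
  for C :: "('o, 'a) cat" and D :: "('p, 'b) cat" and F +
  assumes quasi_inverse:
    "\<exists>G \<eta> \<epsilon>. cat_functor D C G \<and>
      nat_iso C C (id_functor C) (comp_functor C G F) \<eta> \<and>
      nat_iso D D (comp_functor D F G) (id_functor D) \<epsilon>"


section \<open>Arrow categories, pullbacks and fibrations\<close>

text \<open>
  \<open>Sq f u v g\<close> is the morphism \<open>f \<rightarrow> g\<close> of the arrow category given by \<open>u\<close> on domains and
  \<open>v\<close> on codomains.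
\<close>

datatype 'a square = Sq (s_src: 'a) (s_top: 'a) (s_bot: 'a) (s_trg: 'a)

definition arrow_cat :: "('o, 'a) cat \<Rightarrow> ('a, 'a square) cat" where
  "arrow_cat C = \<lparr>
    obs = arrs C,
    arrs = {Sq f u v g | f u v g.
      f \<in> arrs C \<and> g \<in> arrs C \<and>
      u \<in> hom C (src C f) (src C g) \<and> v \<in> hom C (trg C f) (trg C g) \<and>
      cmp C g u = cmp C v f},
    src = s_src,
    trg = s_trg,
    idn = (\<lambda>f. Sq f (idn C (src C f)) (idn C (trg C f)) f),
    cmp = (\<lambda>t s. Sq (s_src s) (cmp C (s_top t) (s_top s)) (cmp C (s_bot t) (s_bot s)) (s_trg t))\<rparr>"

definition cod_functor :: "('o, 'a) cat \<Rightarrow> ('a, 'a square, 'o, 'a) fctr" where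
  "cod_functor C =
    \<lparr>fob = (\<lambda>f \<in> arrs C. trg C f), far = (\<lambda>s \<in> arrs (arrow_cat C). s_bot s)\<rparr>"

definition arrow_functor ::
  "('o, 'a) cat \<Rightarrow> ('o, 'a, 'p, 'b) fctr \<Rightarrow> ('a, 'a square, 'b, 'b square) fctr" where
  "arrow_functor C F =
    \<lparr>fob = (\<lambda>f \<in> arrs C. far F f), far = (\<lambda>s \<in> arrs (arrow_cat C). map_square (far F) s)\<rparr>"

definition pullback_square :: "('o, 'a) cat \<Rightarrow> 'a square \<Rightarrow> bool" where
  "pullback_square C s \<longleftrightarrow> s \<in> arrs (arrow_cat C) \<and>
    (\<forall>z \<in> obs C. \<forall>x \<in> hom C z (src C (s_trg s)). \<forall>y \<in> hom C z (trg C (s_src s)).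
      cmp C (s_trg s) x = cmp C (s_bot s) y \<longrightarrow>
      (\<exists>!k. k \<in> hom C z (src C (s_src s)) \<and> cmp C (s_top s) k = x \<and> cmp C (s_src s) k = y))"

definition cartesian ::
  "('t, 'm) cat \<Rightarrow> ('o, 'a) cat \<Rightarrow> ('t, 'm, 'o, 'a) fctr \<Rightarrow> 'm \<Rightarrow> bool" where
  "cartesian T C p h \<longleftrightarrow> h \<in> arrs T \<and>
    (\<forall>g \<in> arrs T. \<forall>w \<in> hom C (fob p (src T g)) (fob p (src T h)).
      trg T g = trg T h \<and> cmp C (far p h) w = far p g \<longrightarrow>
      (\<exists>!k. k \<in> hom T (src T g) (src T h) \<and> far p k = w \<and> cmp T h k = g))"

locale fibration = cat_functor T C p
  for T :: "('t, 'm) cat" and C :: "('o, 'a) cat" and p +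
  assumes cartesian_lift: "A \<in> obs T \<Longrightarrow> f \<in> arrs C \<Longrightarrow> trg C f = fob p A \<Longrightarrow>
    \<exists>h. cartesian T C p h \<and> trg T h = A \<and> far p h = f"

locale discrete_fibration = cat_functor T C p
  for T :: "('t, 'm) cat" and C :: "('o, 'a) cat" and p +
  assumes unique_lift: "A \<in> obs T \<Longrightarrow> f \<in> arrs C \<Longrightarrow> trg C f = fob p A \<Longrightarrow>
    \<exists>!h. h \<in> arrs T \<and> trg T h = A \<and> far p h = f"


section \<open>Strict 2-categories\<close>

text \<open>
  A strict 2-category is given by its hom-categories, whose objects are the 1-cells and whose
  arrows are the 2-cells, together with unit 1-cells and composition functors.
\<close>

record ('x, 'f, 'c) twocat =
  objs :: "'x set"
  homc :: "'x \<Rightarrow> 'x \<Rightarrow> ('f, 'c) cat"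
  id1 :: "'x \<Rightarrow> 'f"
  hcomp :: "'x \<Rightarrow> 'x \<Rightarrow> 'x \<Rightarrow> ('f \<times> 'f, 'c \<times> 'c, 'f, 'c) fctr"

locale two_category =
  fixes K :: "('x, 'f, 'c) twocat"
  assumes homc_category: "X \<in> objs K \<Longrightarrow> Y \<in> objs K \<Longrightarrow> category (homc K X Y)"
    and id1_in: "X \<in> objs K \<Longrightarrow> id1 K X \<in> obs (homc K X X)"
    and hcomp_functor: "X \<in> objs K \<Longrightarrow> Y \<in> objs K \<Longrightarrow> Z \<in> objs K \<Longrightarrow>
      cat_functor (prod_cat (homc K Y Z) (homc K X Y)) (homc K X Z) (hcomp K X Y Z)"
    and hcomp_assoc1: "W \<in> objs K \<Longrightarrow> X \<in> objs K \<Longrightarrow> Y \<in> objs K \<Longrightarrow> Z \<in> objs K \<Longrightarrow>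
      f \<in> obs (homc K W X) \<Longrightarrow> g \<in> obs (homc K X Y) \<Longrightarrow> h \<in> obs (homc K Y Z) \<Longrightarrow>
      fob (hcomp K W Y Z) (h, fob (hcomp K W X Y) (g, f)) =
      fob (hcomp K W X Z) (fob (hcomp K X Y Z) (h, g), f)"
    and hcomp_assoc2: "W \<in> objs K \<Longrightarrow> X \<in> objs K \<Longrightarrow> Y \<in> objs K \<Longrightarrow> Z \<in> objs K \<Longrightarrow>
      \<alpha> \<in> arrs (homc K W X) \<Longrightarrow> \<beta> \<in> arrs (homc K X Y) \<Longrightarrow> \<gamma> \<in> arrs (homc K Y Z) \<Longrightarrow>
      far (hcomp K W Y Z) (\<gamma>, far (hcomp K W X Y) (\<beta>, \<alpha>)) =
      far (hcomp K W X Z) (far (hcomp K X Y Z) (\<gamma>, \<beta>), \<alpha>)"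
    and hcomp_unit_left1: "X \<in> objs K \<Longrightarrow> Y \<in> objs K \<Longrightarrow> f \<in> obs (homc K X Y) \<Longrightarrow>
      fob (hcomp K X Y Y) (id1 K Y, f) = f"
    and hcomp_unit_left2: "X \<in> objs K \<Longrightarrow> Y \<in> objs K \<Longrightarrow> \<alpha> \<in> arrs (homc K X Y) \<Longrightarrow>
      far (hcomp K X Y Y) (idn (homc K Y Y) (id1 K Y), \<alpha>) = \<alpha>"
    and hcomp_unit_right1: "X \<in> objs K \<Longrightarrow> Y \<in> objs K \<Longrightarrow> f \<in> obs (homc K X Y) \<Longrightarrow>
      fob (hcomp K X X Y) (f, id1 K X) = f"
    and hcomp_unit_right2: "X \<in> objs K \<Longrightarrow> Y \<in> objs K \<Longrightarrow> \<alpha> \<in> arrs (homc K X Y) \<Longrightarrow>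
      far (hcomp K X X Y) (\<alpha>, idn (homc K X X) (id1 K X)) = \<alpha>"

record ('x, 'f, 'c, 'y, 'g, 'd) two_fctr =
  f_ob :: "'x \<Rightarrow> 'y"
  f_hom :: "'x \<Rightarrow> 'x \<Rightarrow> ('f, 'c, 'g, 'd) fctr"

locale two_functor = source: two_category K + target: two_category L
  for K :: "('x, 'f, 'c) twocat" and L :: "('y, 'g, 'd) twocat" +
  fixes \<Phi> :: "('x, 'f, 'c, 'y, 'g, 'd) two_fctr"
  assumes f_ob_in: "X \<in> objs K \<Longrightarrow> f_ob \<Phi> X \<in> objs L"
    and f_hom_functor: "X \<in> objs K \<Longrightarrow> Y \<in> objs K \<Longrightarrow>
      cat_functor (homc K X Y) (homc L (f_ob \<Phi> X) (f_ob \<Phi> Y)) (f_hom \<Phi> X Y)"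
    and f_hom_id1: "X \<in> objs K \<Longrightarrow> fob (f_hom \<Phi> X X) (id1 K X) = id1 L (f_ob \<Phi> X)"
    and f_hom_hcomp1: "X \<in> objs K \<Longrightarrow> Y \<in> objs K \<Longrightarrow> Z \<in> objs K \<Longrightarrow>
      f \<in> obs (homc K X Y) \<Longrightarrow> g \<in> obs (homc K Y Z) \<Longrightarrow>
      fob (f_hom \<Phi> X Z) (fob (hcomp K X Y Z) (g, f)) =
      fob (hcomp L (f_ob \<Phi> X) (f_ob \<Phi> Y) (f_ob \<Phi> Z)) (fob (f_hom \<Phi> Y Z) g, fob (f_hom \<Phi> X Y) f)"
    and f_hom_hcomp2: "X \<in> objs K \<Longrightarrow> Y \<in> objs K \<Longrightarrow> Z \<in> objs K \<Longrightarrow>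
      \<alpha> \<in> arrs (homc K X Y) \<Longrightarrow> \<beta> \<in> arrs (homc K Y Z) \<Longrightarrow>
      far (f_hom \<Phi> X Z) (far (hcomp K X Y Z) (\<beta>, \<alpha>)) =
      far (hcomp L (f_ob \<Phi> X) (f_ob \<Phi> Y) (f_ob \<Phi> Z)) (far (f_hom \<Phi> Y Z) \<beta>, far (f_hom \<Phi> X Y) \<alpha>)"

definition internally_equivalent :: "('x, 'f, 'c) twocat \<Rightarrow> 'x \<Rightarrow> 'x \<Rightarrow> bool" where
  "internally_equivalent K X Y \<longleftrightarrow>
    (\<exists>f \<in> obs (homc K X Y). \<exists>g \<in> obs (homc K Y X).
      isomorphic (homc K X X) (id1 K X) (fob (hcomp K X Y X) (g, f)) \<and>
      isomorphic (homc K Y Y) (fob (hcomp K Y X Y) (f, g)) (id1 K Y))"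

locale two_equivalence = two_functor K L \<Phi>
  for K :: "('x, 'f, 'c) twocat" and L :: "('y, 'g, 'd) twocat" and \<Phi> +
  assumes hom_equivalence: "X \<in> objs K \<Longrightarrow> Y \<in> objs K \<Longrightarrow>
      cat_equivalence (homc K X Y) (homc L (f_ob \<Phi> X) (f_ob \<Phi> Y)) (f_hom \<Phi> X Y)"
    and surjective_up_to_equivalence: "V \<in> objs L \<Longrightarrow>
      \<exists>X \<in> objs K. internally_equivalent L (f_ob \<Phi> X) V"

definition two_equivalent :: "('x, 'f, 'c) twocat \<Rightarrow> ('y, 'g, 'd) twocat \<Rightarrow> bool"
    (infix "\<simeq>\<^sub>2" 50) where
  "K \<simeq>\<^sub>2 L \<longleftrightarrow> (\<exists>\<Phi>. two_equivalence K L \<Phi>)"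

definition locally_discrete :: "('x, 'f) cat \<Rightarrow> ('x, 'f, 'f) twocat" where
  "locally_discrete C = \<lparr>
    objs = obs C,
    homc = (\<lambda>X Y. discrete_cat (hom C X Y)),
    id1 = idn C,
    hcomp = (\<lambda>X Y Z. \<lparr>
      fob = (\<lambda>(g, f) \<in> hom C Y Z \<times> hom C X Y. cmp C g f),
      far = (\<lambda>(g, f) \<in> hom C Y Z \<times> hom C X Y. cmp C g f)\<rparr>)\<rparr>"


section \<open>Contextual categories\<close>

record ('o, 'a) cxl_cat =
  und :: "('o, 'a) cat"
  root :: 'o
  parent :: "'o \<Rightarrow> 'o"                  \<comment> \<open>relevant at non-root objects only\<close>
  pr :: "'o \<Rightarrow> 'a"
  pb :: "'a \<Rightarrow> 'o \<Rightarrow> 'o"               \<comment> \<open>\<open>f\<^sup>*A\<close>\<close>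
  pb_top :: "'a \<Rightarrow> 'o \<Rightarrow> 'a"           \<comment> \<open>the top map \<open>f\<^sup>*A \<rightarrow> A\<close>\<close>

text \<open>Every object has finite height, but heights need not be bounded.\<close>

locale contextual_category = category "und X" for X :: "('o, 'a) cxl_cat" +
  assumes root_terminal: "terminal (und X) (root X)"
    and parent_in: "A \<in> obs (und X) - {root X} \<Longrightarrow> parent X A \<in> obs (und X)"
    and finite_height: "A \<in> obs (und X) \<Longrightarrow> \<exists>n. (parent X ^^ n) A = root X"
    and pr_in: "A \<in> obs (und X) - {root X} \<Longrightarrow> pr X A \<in> hom (und X) A (parent X A)"
    and pb_in: "A \<in> obs (und X) - {root X} \<Longrightarrow> f \<in> hom (und X) \<Delta> (parent X A) \<Longrightarrow>
      pb X f A \<in> obs (und X) - {root X}"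
    and parent_pb: "A \<in> obs (und X) - {root X} \<Longrightarrow> f \<in> hom (und X) \<Delta> (parent X A) \<Longrightarrow>
      parent X (pb X f A) = \<Delta>"
    and pb_pullback: "A \<in> obs (und X) - {root X} \<Longrightarrow> f \<in> hom (und X) \<Delta> (parent X A) \<Longrightarrow>
      pullback_square (und X) (Sq (pr X (pb X f A)) (pb_top X f A) f (pr X A))"
    and pb_idn: "A \<in> obs (und X) - {root X} \<Longrightarrow> pb X (idn (und X) (parent X A)) A = A"
    and pb_top_idn: "A \<in> obs (und X) - {root X} \<Longrightarrow>
      pb_top X (idn (und X) (parent X A)) A = idn (und X) A"
    and pb_cmp: "A \<in> obs (und X) - {root X} \<Longrightarrow> f \<in> hom (und X) \<Delta> (parent X A) \<Longrightarrow>
      g \<in> hom (und X) \<Theta> \<Delta> \<Longrightarrow> pb X (cmp (und X) f g) A = pb X g (pb X f A)"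
    and pb_top_cmp: "A \<in> obs (und X) - {root X} \<Longrightarrow> f \<in> hom (und X) \<Delta> (parent X A) \<Longrightarrow>
      g \<in> hom (und X) \<Theta> \<Delta> \<Longrightarrow>
      pb_top X (cmp (und X) f g) A = cmp (und X) (pb_top X f A) (pb_top X g (pb X f A))"

locale cxl_hom = source: contextual_category X + target: contextual_category Y +
    cat_functor "und X" "und Y" F
  for X :: "('o, 'a) cxl_cat" and Y :: "('p, 'b) cxl_cat" and F +
  assumes preserves_root: "fob F (root X) = root Y"
    and preserves_nonroot: "A \<in> obs (und X) - {root X} \<Longrightarrow> fob F A \<noteq> root Y"
    and preserves_parent: "A \<in> obs (und X) - {root X} \<Longrightarrow>
      fob F (parent X A) = parent Y (fob F A)"
    and preserves_pr: "A \<in> obs (und X) - {root X} \<Longrightarrow> far F (pr X A) = pr Y (fob F A)"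
    and preserves_pb: "A \<in> obs (und X) - {root X} \<Longrightarrow> f \<in> hom (und X) \<Delta> (parent X A) \<Longrightarrow>
      fob F (pb X f A) = pb Y (far F f) (fob F A)"
    and preserves_pb_top: "A \<in> obs (und X) - {root X} \<Longrightarrow> f \<in> hom (und X) \<Delta> (parent X A) \<Longrightarrow>
      far F (pb_top X f A) = pb_top Y (far F f) (fob F A)"


section \<open>Comprehension categories\<close>

record ('o, 'a, 't, 'm) comp_cat =
  ctx :: "('o, 'a) cat"
  ty :: "('t, 'm) cat"
  proj :: "('t, 'm, 'o, 'a) fctr"
  compr :: "('t, 'm, 'a, 'a square) fctr"

locale comprehension_category =
  fibration "ty X" "ctx X" "proj X" +
  compr: cat_functor "ty X" "arrow_cat (ctx X)" "compr X"
  for X :: "('o, 'a, 't, 'm, 'z) comp_cat_scheme" +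
  assumes cod_compr: "comp_functor (ty X) (cod_functor (ctx X)) (compr X) = proj X"
    and compr_cartesian: "cartesian (ty X) (ctx X) (proj X) h \<Longrightarrow>
      pullback_square (ctx X) (far (compr X) h)"

text \<open>The extended context \<open>\<Gamma>.A\<close>, where \<open>A\<close> lies over \<open>\<Gamma>\<close>.\<close>

definition ext :: "('o, 'a, 't, 'm, 'z) comp_cat_scheme \<Rightarrow> 't \<Rightarrow> 'o" where
  "ext X A = src (ctx X) (fob (compr X) A)"

record ('o, 'a, 't, 'm) cxl_comp_cat = "('o, 'a, 't, 'm) comp_cat" +
  emp :: 'o

text \<open>\<open>iterated_ext X [A\<^sub>0, \<dots>, A\<^sub>n\<^sub>-\<^sub>1] \<Gamma>\<close> holds if \<open>1.A\<^sub>0\<dots>A\<^sub>n\<^sub>-\<^sub>1\<close> is well-formed and equal to \<open>\<Gamma>\<close>.\<close>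

inductive iterated_ext :: "('o, 'a, 't, 'm) cxl_comp_cat \<Rightarrow> 't list \<Rightarrow> 'o \<Rightarrow> bool"
  for X where
  empty: "iterated_ext X [] (emp X)"
| extend: "iterated_ext X As \<Gamma> \<Longrightarrow> A \<in> obs (ty X) \<Longrightarrow> fob (proj X) A = \<Gamma> \<Longrightarrow>
    iterated_ext X (As @ [A]) (ext X A)"

locale contextual_comp_cat = comprehension_category X
  for X :: "('o, 'a, 't, 'm) cxl_comp_cat" +
  assumes emp_terminal: "terminal (ctx X) (emp X)"
    and unique_iterated_ext: "\<Gamma> \<in> obs (ctx X) \<Longrightarrow> \<exists>!As. iterated_ext X As \<Gamma>"

locale discrete_contextual_comp_cat = contextual_comp_cat X +
  discrete_fibration "ty X" "ctx X" "proj X"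
  for X :: "('o, 'a, 't, 'm) cxl_comp_cat"

record ('o, 'a, 't, 'm, 'p, 'b, 's, 'n) cc_map =
  m_ctx :: "('o, 'a, 'p, 'b) fctr"
  m_ty :: "('t, 'm, 's, 'n) fctr"
  m_iso :: "'t \<Rightarrow> 'b square"

locale pseudo_map = source: comprehension_category X + target: comprehension_category Y +
    m_ctx: cat_functor "ctx X" "ctx Y" "m_ctx M" +
    m_ty: cat_functor "ty X" "ty Y" "m_ty M" +
    m_iso: nat_iso "ty X" "arrow_cat (ctx Y)"
      "comp_functor (ty X) (compr Y) (m_ty M)"
      "comp_functor (ty X) (arrow_functor (ctx X) (m_ctx M)) (compr X)"
      "m_iso M"
  for X :: "('o, 'a, 't, 'm, 'z) comp_cat_scheme"
    and Y :: "('p, 'b, 's, 'n, 'y) comp_cat_scheme"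
    and M :: "('o, 'a, 't, 'm, 'p, 'b, 's, 'n, 'w) cc_map_scheme" +
  assumes m_ty_over: "comp_functor (ty X) (proj Y) (m_ty M) =
      comp_functor (ty X) (m_ctx M) (proj X)"
    and m_ty_cartesian: "cartesian (ty X) (ctx X) (proj X) h \<Longrightarrow>
      cartesian (ty Y) (ctx Y) (proj Y) (far (m_ty M) h)"
    and m_iso_over: "A \<in> obs (ty X) \<Longrightarrow>
      s_bot (m_iso M A) = idn (ctx Y) (fob (m_ctx M) (fob (proj X) A))"

record ('o, 'a, 't, 'm, 'p, 'b, 's, 'n) cxl_map =
  "('o, 'a, 't, 'm, 'p, 'b, 's, 'n) cc_map" +
  m_emp :: 'b                              \<comment> \<open>the isomorphism \<open>F 1 \<rightarrow> 1\<close>\<close>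

locale cxl_pseudo_map = source: contextual_comp_cat X + target: contextual_comp_cat Y +
    pseudo_map X Y M
  for X :: "('o, 'a, 't, 'm) cxl_comp_cat"
    and Y :: "('p, 'b, 's, 'n) cxl_comp_cat"
    and M :: "('o, 'a, 't, 'm, 'p, 'b, 's, 'n) cxl_map" +
  assumes m_emp_in: "m_emp M \<in> hom (ctx Y) (fob (m_ctx M) (emp X)) (emp Y)"
    and m_emp_iso: "iso (ctx Y) (m_emp M)"

locale cxl_strict_map = cxl_pseudo_map X Y M
  for X :: "('o, 'a, 't, 'm) cxl_comp_cat"
    and Y :: "('p, 'b, 's, 'n) cxl_comp_cat"
    and M :: "('o, 'a, 't, 'm, 'p, 'b, 's, 'n) cxl_map" +
  assumes compr_strict: "comp_functor (ty X) (compr Y) (m_ty M) =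
      comp_functor (ty X) (arrow_functor (ctx X) (m_ctx M)) (compr X)"
    and m_iso_strict: "A \<in> obs (ty X) \<Longrightarrow>
      m_iso M A = idn (arrow_cat (ctx Y)) (fob (compr Y) (fob (m_ty M) A))"
    and emp_strict: "fob (m_ctx M) (emp X) = emp Y"
    and m_emp_strict: "m_emp M = idn (ctx Y) (emp Y)"

definition id_map ::
  "('o, 'a, 't, 'm) cxl_comp_cat \<Rightarrow> ('o, 'a, 't, 'm, 'o, 'a, 't, 'm) cxl_map" where
  "id_map X = \<lparr>
    m_ctx = id_functor (ctx X),
    m_ty = id_functor (ty X),
    m_iso = (\<lambda>A \<in> obs (ty X). idn (arrow_cat (ctx X)) (fob (compr X) A)),
    m_emp = idn (ctx X) (emp X)\<rparr>"

definition comp_map ::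
  "('o, 'a, 't, 'm) cxl_comp_cat \<Rightarrow> ('p, 'b, 's, 'n) cxl_comp_cat \<Rightarrow>
   ('q, 'c, 'r, 'l) cxl_comp_cat \<Rightarrow>
   ('p, 'b, 's, 'n, 'q, 'c, 'r, 'l) cxl_map \<Rightarrow> ('o, 'a, 't, 'm, 'p, 'b, 's, 'n) cxl_map \<Rightarrow>
   ('o, 'a, 't, 'm, 'q, 'c, 'r, 'l) cxl_map" where
  "comp_map X Y Z N M = \<lparr>
    m_ctx = comp_functor (ctx X) (m_ctx N) (m_ctx M),
    m_ty = comp_functor (ty X) (m_ty N) (m_ty M),
    m_iso = (\<lambda>A \<in> obs (ty X). cmp (arrow_cat (ctx Z))
      (far (arrow_functor (ctx Y) (m_ctx N)) (m_iso M A)) (m_iso N (fob (m_ty M) A))),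
    m_emp = cmp (ctx Z) (m_emp N) (far (m_ctx N) (m_emp M))\<rparr>"

text \<open>
  A transformation records the maps between which it goes, so that transformations between
  varying maps can be collected into a category.
\<close>

record ('o, 'a, 't, 'm, 'p, 'b, 's, 'n) cell =
  c_src :: "('o, 'a, 't, 'm, 'p, 'b, 's, 'n) cxl_map"
  c_trg :: "('o, 'a, 't, 'm, 'p, 'b, 's, 'n) cxl_map"
  c_ctx :: "'o \<Rightarrow> 'b"
  c_ty :: "'t \<Rightarrow> 'n"

locale transformation =
  source: cxl_pseudo_map X Y "c_src \<alpha>" + target: cxl_pseudo_map X Y "c_trg \<alpha>" +
  c_ctx: nat_trans "ctx X" "ctx Y" "m_ctx (c_src \<alpha>)" "m_ctx (c_trg \<alpha>)" "c_ctx \<alpha>" +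
  c_ty: nat_trans "ty X" "ty Y" "m_ty (c_src \<alpha>)" "m_ty (c_trg \<alpha>)" "c_ty \<alpha>"
  for X :: "('o, 'a, 't, 'm) cxl_comp_cat"
    and Y :: "('p, 'b, 's, 'n) cxl_comp_cat"
    and \<alpha> :: "('o, 'a, 't, 'm, 'p, 'b, 's, 'n) cell" +
  assumes c_ty_over: "A \<in> obs (ty X) \<Longrightarrow>
      far (proj Y) (c_ty \<alpha> A) = c_ctx \<alpha> (fob (proj X) A)"
    and c_compr: "A \<in> obs (ty X) \<Longrightarrow>
      cmp (ctx Y) (s_top (m_iso (c_trg \<alpha>) A)) (s_top (far (compr Y) (c_ty \<alpha> A))) =
      cmp (ctx Y) (c_ctx \<alpha> (ext X A)) (s_top (m_iso (c_src \<alpha>) A))"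
    and c_emp: "cmp (ctx Y) (m_emp (c_trg \<alpha>)) (c_ctx \<alpha> (emp X)) = m_emp (c_src \<alpha>)"

definition id_cell ::
  "('o, 'a, 't, 'm) cxl_comp_cat \<Rightarrow> ('p, 'b, 's, 'n) cxl_comp_cat \<Rightarrow>
   ('o, 'a, 't, 'm, 'p, 'b, 's, 'n) cxl_map \<Rightarrow> ('o, 'a, 't, 'm, 'p, 'b, 's, 'n) cell" where
  "id_cell X Y M = \<lparr>
    c_src = M,
    c_trg = M,
    c_ctx = (\<lambda>\<Gamma> \<in> obs (ctx X). idn (ctx Y) (fob (m_ctx M) \<Gamma>)),
    c_ty = (\<lambda>A \<in> obs (ty X). idn (ty Y) (fob (m_ty M) A))\<rparr>"

definition vcomp_cell ::
  "('o, 'a, 't, 'm) cxl_comp_cat \<Rightarrow> ('p, 'b, 's, 'n) cxl_comp_cat \<Rightarrow>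
   ('o, 'a, 't, 'm, 'p, 'b, 's, 'n) cell \<Rightarrow> ('o, 'a, 't, 'm, 'p, 'b, 's, 'n) cell \<Rightarrow>
   ('o, 'a, 't, 'm, 'p, 'b, 's, 'n) cell" where
  "vcomp_cell X Y \<beta> \<alpha> = \<lparr>
    c_src = c_src \<alpha>,
    c_trg = c_trg \<beta>,
    c_ctx = (\<lambda>\<Gamma> \<in> obs (ctx X). cmp (ctx Y) (c_ctx \<beta> \<Gamma>) (c_ctx \<alpha> \<Gamma>)),
    c_ty = (\<lambda>A \<in> obs (ty X). cmp (ty Y) (c_ty \<beta> A) (c_ty \<alpha> A))\<rparr>"

definition hcomp_cell ::
  "('o, 'a, 't, 'm) cxl_comp_cat \<Rightarrow> ('p, 'b, 's, 'n) cxl_comp_cat \<Rightarrow>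
   ('q, 'c, 'r, 'l) cxl_comp_cat \<Rightarrow>
   ('p, 'b, 's, 'n, 'q, 'c, 'r, 'l) cell \<Rightarrow> ('o, 'a, 't, 'm, 'p, 'b, 's, 'n) cell \<Rightarrow>
   ('o, 'a, 't, 'm, 'q, 'c, 'r, 'l) cell" where
  "hcomp_cell X Y Z \<beta> \<alpha> = \<lparr>
    c_src = comp_map X Y Z (c_src \<beta>) (c_src \<alpha>),
    c_trg = comp_map X Y Z (c_trg \<beta>) (c_trg \<alpha>),
    c_ctx = (\<lambda>\<Gamma> \<in> obs (ctx X). cmp (ctx Z)
      (c_ctx \<beta> (fob (m_ctx (c_trg \<alpha>)) \<Gamma>)) (far (m_ctx (c_src \<beta>)) (c_ctx \<alpha> \<Gamma>))),
    c_ty = (\<lambda>A \<in> obs (ty X). cmp (ty Z)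
      (c_ty \<beta> (fob (m_ty (c_trg \<alpha>)) A)) (far (m_ty (c_src \<beta>)) (c_ty \<alpha> A)))\<rparr>"


section \<open>The four 2-categories\<close>

text \<open>
  Smallness: a small structure is one whose carriers are subsets of a fixed type \<open>'u\<close>, which plays
  the role of the universe of sets.  An arrow of a 1-category of structures is a map together with
  its source and its target.
\<close>

type_synonym 'u Cxl = "('u, 'u) cxl_cat"
type_synonym 'u Cxl_arr = "'u Cxl \<times> ('u, 'u, 'u, 'u) fctr \<times> 'u Cxl"
type_synonym 'u CC = "('u, 'u, 'u, 'u) cxl_comp_cat"
type_synonym 'u CC_map = "('u, 'u, 'u, 'u, 'u, 'u, 'u, 'u) cxl_map"
type_synonym 'u CC_arr = "'u CC \<times> 'u CC_map \<times> 'u CC"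
type_synonym 'u CC_cell = "('u, 'u, 'u, 'u, 'u, 'u, 'u, 'u) cell"

definition CxlCat :: "('u Cxl, 'u Cxl_arr) cat" where
  "CxlCat = \<lparr>
    obs = {X. contextual_category X},
    arrs = {(X, F, Y). cxl_hom X Y F},
    src = (\<lambda>(X, F, Y). X),
    trg = (\<lambda>(X, F, Y). Y),
    idn = (\<lambda>X. (X, id_functor (und X), X)),
    cmp = (\<lambda>(_, G, Z) (X, F, _). (X, comp_functor (und X) G F, Z))\<rparr>"

definition CompCat_str1 :: "('u CC, 'u CC_arr) cat" where
  "CompCat_str1 = \<lparr>
    obs = {X. discrete_contextual_comp_cat X},
    arrs = {(X, M, Y). discrete_contextual_comp_cat X \<and> discrete_contextual_comp_cat Y \<and>
      cxl_strict_map X Y M},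
    src = (\<lambda>(X, M, Y). X),
    trg = (\<lambda>(X, M, Y). Y),
    idn = (\<lambda>X. (X, id_map X, X)),
    cmp = (\<lambda>(Y, N, Z) (X, M, _). (X, comp_map X Y Z N M, Z))\<rparr>"

text \<open>
  The 2-category of discrete contextual comprehension categories, those pseudo maps that satisfy
  \<open>P\<close>, and all transformations between these.
\<close>

definition map_cat :: "('u CC \<Rightarrow> 'u CC \<Rightarrow> 'u CC_map \<Rightarrow> bool) \<Rightarrow> 'u CC \<Rightarrow> 'u CC \<Rightarrow>
    ('u CC_map, 'u CC_cell) cat" where
  "map_cat P X Y = \<lparr>
    obs = {M. P X Y M},
    arrs = {\<alpha>. transformation X Y \<alpha> \<and> P X Y (c_src \<alpha>) \<and> P X Y (c_trg \<alpha>)},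
    src = c_src,
    trg = c_trg,
    idn = id_cell X Y,
    cmp = vcomp_cell X Y\<rparr>"

definition CompCat :: "('u CC \<Rightarrow> 'u CC \<Rightarrow> 'u CC_map \<Rightarrow> bool) \<Rightarrow>
    ('u CC, 'u CC_map, 'u CC_cell) twocat" where
  "CompCat P = \<lparr>
    objs = {X. discrete_contextual_comp_cat X},
    homc = map_cat P,
    id1 = id_map,
    hcomp = (\<lambda>X Y Z. \<lparr>
      fob = (\<lambda>(N, M) \<in> obs (map_cat P Y Z) \<times> obs (map_cat P X Y). comp_map X Y Z N M),
      far = (\<lambda>(\<beta>, \<alpha>) \<in> arrs (map_cat P Y Z) \<times> arrs (map_cat P X Y). hcomp_cell X Y Z \<beta> \<alpha>)\<rparr>)\<rparr>"

definition CompCat_str2 :: "('u CC, 'u CC_map, 'u CC_cell) twocat" where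
  "CompCat_str2 = CompCat cxl_strict_map"

definition CompCat_ps :: "('u CC, 'u CC_map, 'u CC_cell) twocat" where
  "CompCat_ps = CompCat cxl_pseudo_map"

end

theory Submission
  imports Defs
begin

text \<open>
  In a discrete contextual comprehension category context extension is a bijection from types to
  contexts other than \<open>1\<close>, so a type is the same thing as a non-root object of a contextual
  category, and a morphism of types over \<open>f\<close> with target \<open>A\<close>, being the unique lift of \<open>f\<close> to
  \<open>A\<close>, is the same thing as a chosen pullback square of \<open>A\<close> along \<open>f\<close>.  This gives the first
  equivalence.

  By induction along context extensions, starting from the terminal context, a transformation is
  determined by the maps between which it goes: \<open>\<alpha>\<^sub>1\<close> is forced by the compatibility at \<open>1\<close>, the
  component at a type \<open>A\<close> over \<open>\<Gamma>\<close> is the unique lift of \<open>\<alpha>\<^sub>\<Gamma>\<close>, and it determines \<open>\<alpha>\<close> at \<open>\<Gamma>.A\<close>.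
  Hence all equations between 2-cells hold automatically, and between strict maps there are only
  identities, which gives the second equivalence.  The third one amounts to replacing a pseudo map
  by an isomorphic strict one, which is again constructed along context extensions.
\<close>

section \<open>Categories, functors and natural transformations\<close>

text \<open>The passage between the two kinds of structure is carried by the relation
  \<open>presentation\<close>, not by a pair of inverse constructions. Type names are arbitrary and
  operations are unconstrained outside the carriers, so one contextual category is presented by many
  comprehension categories, and conversely. What is canonical is the context functor: between
  presenting comprehension categories, the strict maps correspond bijectively to the homomorphisms
  through \<open>m_ctx\<close>. Hence any choice of presentations extends to a functor, and two
  comprehension categories presenting the same contextual category are isomorphic through maps that
  are the identity on contexts. The sort \<open>infinite\<close> serves the construction of a
  presentation: a morphism of types is named by a pair, which has to be coded in the universe
  itself. For the last equivalence, both hom-categories have the same cells between strict maps, so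
  the inclusion is full and faithful by definition and essential surjectivity is the only content.
  The strict replacement is obtained by conjugating both functors of a pseudo map with isomorphisms
  chosen so that comprehension commutes on the nose.\<close>

lemma hom_iff: "f \<in> hom C x y \<longleftrightarrow> f \<in> arrs C \<and> src C f = x \<and>
    trg C f = y"
  by (simp add: hom_def)

context category
begin

lemma arr_hom: "f \<in> arrs C \<Longrightarrow> f \<in> hom C (src C f) (trg C f)"
  by (simp add: hom_iff)

lemma hom_obs: "f \<in> hom C x y \<Longrightarrow> x \<in> obs C \<and> y \<in> obs C"
  using src_in trg_in by (auto simp: hom_iff)

lemma isoI:
  assumes "f \<in> hom C x y" "g \<in> hom C y x" "cmp C g f = idn C x" "cmp C f g = idn C y"
  shows "iso C f"
  using assms by (auto simp: iso_def hom_iff)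

lemma iso_inverse:
  assumes "f \<in> hom C x y" "iso C f"
  obtains g where "g \<in> hom C y x" "cmp C g f = idn C x" "cmp C f g = idn C y" "iso C g"
proof -
  from assms obtain g where g: "g \<in> hom C y x" "cmp C g f = idn C x" "cmp C f g = idn C y"
    by (auto simp: iso_def hom_iff)
  then show thesis
    using that isoI[OF g(1) assms(1) g(3,2)] by simp
qed

lemma iso_idn: "x \<in> obs C \<Longrightarrow> iso C (idn C x)"
  using isoI[OF idn_in idn_in] cmp_idn_left[OF idn_in] by blast

lemma iso_cmp:
  assumes "f \<in> hom C x y" "g \<in> hom C y z" "iso C f" "iso C g"
  shows "iso C (cmp C g f)"
proof -
  obtain f' where f': "f' \<in> hom C y x" "cmp C f' f = idn C x" "cmp C f f' = idn C y"
    using iso_inverse assms(1,3) by blast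
  obtain g' where g': "g' \<in> hom C z y" "cmp C g' g = idn C y" "cmp C g g' = idn C z"
    using iso_inverse assms(2,4) by blast
  have gf: "cmp C g f \<in> hom C x z" and fg: "cmp C f' g' \<in> hom C z x"
    using cmp_in assms(1,2) f'(1) g'(1) by blast+
  have "cmp C (cmp C f' g') (cmp C g f) = cmp C f' (cmp C (cmp C g' g) f)"
    using cmp_assoc[OF gf g'(1) f'(1)] cmp_assoc[OF assms(1,2) g'(1)] by simp
  moreover have "cmp C (cmp C g f) (cmp C f' g') = cmp C g (cmp C (cmp C f f') g')"
    using cmp_assoc[OF fg assms(1,2)] cmp_assoc[OF g'(1) f'(1) assms(1)] by simp
  ultimately show ?thesis
    using isoI[OF gf fg] f' g' cmp_idn_left[OF assms(1)] cmp_idn_left[OF g'(1)] by simp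
qed

lemma iso_cancel_left:
  assumes "f \<in> hom C x y" "f' \<in> hom C x y" "g \<in> hom C y z" "iso C g" "cmp C g f = cmp C
      g f'"
  shows "f = f'"
proof -
  obtain g' where g': "g' \<in> hom C z y" "cmp C g' g = idn C y"
    using iso_inverse assms(3,4) by blast
  then show ?thesis
    using cmp_assoc[OF assms(1,3) g'(1)] cmp_assoc[OF assms(2,3) g'(1)] assms(5)
      cmp_idn_left[OF assms(1)] cmp_idn_left[OF assms(2)] by metis
qed

lemma iso_cancel_right:
  assumes "f \<in> hom C y z" "f' \<in> hom C y z" "g \<in> hom C x y" "iso C g" "cmp C f g = cmp C
      f' g"
  shows "f = f'"
proof -
  obtain g' where g': "g' \<in> hom C y x" "cmp C g g' = idn C y"
    using iso_inverse assms(3,4) by blast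
  then show ?thesis
    using cmp_assoc[OF g'(1) assms(3,1)] cmp_assoc[OF g'(1) assms(3,2)] assms(5)
      cmp_idn_right[OF assms(1)] cmp_idn_right[OF assms(2)] by metis
qed

text \<open>Composing with the isomorphism \<open>u\<close> on the right reduces the claim to the
  given square, and \<open>u\<close> cancels. It reverses the isomorphisms of a commuting square,
  which is how inverses of natural transformations and of transformations are seen to be
  compatible.\<close>

lemma iso_commute:
  assumes "u \<in> hom C a b" "iso C u" "v \<in> hom C c d" "iso C v"
    and "f \<in> hom C a c" "g \<in> hom C b d" "cmp C v f = cmp C g u"
    and "u' \<in> hom C b a" "cmp C u' u = idn C a" "cmp C u u' = idn C b"
    and "v' \<in> hom C d c" "cmp C v' v = idn C c" "cmp C v v' = idn C d"
  shows "cmp C v' g = cmp C f u'"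
proof (rule iso_cancel_right[OF _ _ assms(1,2)])
  show "cmp C v' g \<in> hom C b c" "cmp C f u' \<in> hom C b c"
    using assms cmp_in by blast+
  have "cmp C (cmp C v' g) u = cmp C v' (cmp C v f)"
    using cmp_assoc[OF assms(1,6,11)] assms(7) by simp
  also have "\<dots> = f"
    using cmp_assoc[OF assms(5,3,11)] assms(12) cmp_idn_left[OF assms(5)] by simp
  also have "\<dots> = cmp C (cmp C f u') u"
    using cmp_assoc[OF assms(1,8,5)] assms(9) cmp_idn_right[OF assms(5)] by simp
  finally show "cmp C (cmp C v' g) u = cmp C (cmp C f u') u" .
qed

lemma terminal_unique:
  "terminal C t \<Longrightarrow> f \<in> hom C x t \<Longrightarrow> g \<in> hom C x t
      \<Longrightarrow> f = g"
  using hom_obs unfolding terminal_def by blast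

end

lemma isomorphic_refl: "category C \<Longrightarrow> x \<in> obs C \<Longrightarrow> isomorphic C x
    x"
  unfolding isomorphic_def by (meson category.iso_idn category.idn_in)

context cat_functor
begin

lemma fob_obs: "x \<in> obs C \<Longrightarrow> fob F x \<in> obs D"
  using fob_in by blast

lemma far_arr: "f \<in> arrs C \<Longrightarrow> far F f \<in> arrs D"
  using far_in by blast

lemma far_hom: "f \<in> hom C x y \<Longrightarrow> far F f \<in> hom D (fob F x) (fob F y)"
  using far_arr far_src far_trg by (simp add: hom_iff)

lemma far_iso:
  assumes "f \<in> hom C x y" "iso C f"
  shows "iso D (far F f)"
proof -
  obtain g where g: "g \<in> hom C y x" "cmp C g f = idn C x" "cmp C f g = idn C y"
    using source.iso_inverse assms by blast
  then show ?thesis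
    using target.isoI[OF far_hom[OF assms(1)] far_hom[OF g(1)]]
      far_cmp[OF assms(1) g(1)] far_cmp[OF g(1) assms(1)] far_idn source.hom_obs[OF g(1)] by simp
qed

end

text \<open>Both components of a functor are extensional, so agreement on the carriers gives
  equality of the records.\<close>

lemma functor_eqI:
  assumes "cat_functor C D F" "cat_functor C D G"
    and "\<And>x. x \<in> obs C \<Longrightarrow> fob F x = fob G x" "\<And>f. f \<in> arrs C
        \<Longrightarrow> far F f = far G f"
  shows "F = G"
proof -
  have "fob F = fob G" "far F = far G"
    using assms cat_functor.fob_in cat_functor.far_in by (meson PiE_ext)+
  then show ?thesis by simp
qed

lemma functor_id:
  assumes "category C"
  shows "cat_functor C C (id_functor C)"
proof -
  interpret category C by fact
  have [simp]: "idn C x \<in> arrs C" if "x \<in> obs C" for x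
    using idn_in[OF that] by (simp add: hom_iff)
  have [simp]: "f \<in> arrs C" "g \<in> arrs C" "cmp C g f \<in> arrs C"
    if "f \<in> hom C x y" "g \<in> hom C y z" for f g x y z
    using that cmp_in[OF that] by (simp_all add: hom_iff)
  show ?thesis
    by unfold_locales (auto simp: id_functor_def src_in trg_in)
qed

lemma fob_id [simp]: "x \<in> obs C \<Longrightarrow> fob (id_functor C) x = x"
  and far_id [simp]: "f \<in> arrs C \<Longrightarrow> far (id_functor C) f = f"
  by (simp_all add: id_functor_def)

lemma fob_comp [simp]: "x \<in> obs C \<Longrightarrow> fob (comp_functor C G F) x = fob G (fob F
    x)"
  and far_comp [simp]: "f \<in> arrs C \<Longrightarrow> far (comp_functor C G F) f = far G (far F
      f)"
  by (simp_all add: comp_functor_def compose_def)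

lemma functor_comp:
  assumes "cat_functor C D F" "cat_functor D E G"
  shows "cat_functor C E (comp_functor C G F)"
proof -
  interpret F: cat_functor C D F by fact
  interpret G: cat_functor D E G by fact
  show ?thesis
  proof
    show "fob (comp_functor C G F) \<in> obs C \<rightarrow>\<^sub>E obs E" "far (comp_functor C G
        F) \<in> arrs C \<rightarrow>\<^sub>E arrs E"
      using F.fob_obs G.fob_obs F.far_arr G.far_arr
      by (auto simp: comp_functor_def compose_def)
    fix f x y g z
    show "far (comp_functor C G F) (idn C x) = idn E (fob (comp_functor C G F) x)" if "x \<in> obs
        C"
      using that F.source.idn_in[OF that] F.far_idn G.far_idn F.fob_obs by (simp add: hom_iff)
    show "far (comp_functor C G F) (cmp C g f) =
        cmp E (far (comp_functor C G F) g) (far (comp_functor C G F) f)"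
      if "f \<in> hom C x y" "g \<in> hom C y z"
      using that F.source.cmp_in[OF that] F.far_cmp[OF that] G.far_cmp F.far_hom
      by (simp add: hom_iff)
  qed (auto simp: F.far_arr F.far_src F.far_trg G.far_src G.far_trg F.source.src_in F.source.trg_in)
qed

lemma comp_functor_assoc:
  assumes "cat_functor C D F"
  shows "comp_functor C H (comp_functor C G F) = comp_functor C (comp_functor D H G) F"
  using cat_functor.fob_obs[OF assms] cat_functor.far_arr[OF assms]
  by (auto simp: comp_functor_def compose_def fun_eq_iff)

lemma comp_functor_id_left:
  assumes "cat_functor C D F"
  shows "comp_functor C (id_functor D) F = F"
  by (rule functor_eqI[OF functor_comp[OF assms functor_id[OF cat_functor.axioms(2)[OF assms]]]
      assms])
    (simp_all add: cat_functor.fob_obs[OF assms] cat_functor.far_arr[OF assms])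

lemma comp_functor_id_right:
  assumes "cat_functor C D F"
  shows "comp_functor C F (id_functor C) = F"
  by (rule functor_eqI[OF functor_comp[OF functor_id[OF cat_functor.axioms(1)[OF assms]] assms]
      assms])
    simp_all

text \<open>Transport of \<open>F\<close> along isomorphisms \<open>b x\<close> from a prescribed
  object \<open>k x\<close> to \<open>F x\<close>: the arrow part is forced to be the conjugate of
  \<open>F f\<close> by \<open>b\<close>. Functoriality is checked after composing with
  \<open>b\<close>, which cancels. It yields the quasi-inverse of an equivalence and both functors
  of a strictified map.\<close>

lemma functor_conjugate:
  assumes "cat_functor C D F"
    and b_in: "\<And>x. x \<in> obs C \<Longrightarrow> b x \<in> hom D (k x) (fob F x)"
    and b_iso: "\<And>x. x \<in> obs C \<Longrightarrow> iso D (b x)"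
  shows "\<exists>G. cat_functor C D G \<and> (\<forall>x \<in> obs C. fob G x = k x) \<and>
    (\<forall>x y. \<forall>f \<in> hom C x y. cmp D (b y) (far G f) = cmp D (far F f) (b x))"
proof -
  interpret F: cat_functor C D F by fact
  have "\<exists>h. h \<in> hom D (k (src C f)) (k (trg C f)) \<and>
      cmp D (b (trg C f)) h = cmp D (far F f) (b (src C f))" if "f \<in> arrs C" for f
  proof -
    have s: "src C f \<in> obs C" and t: "trg C f \<in> obs C"
      using that F.source.src_in F.source.trg_in by auto
    obtain b' where b': "b' \<in> hom D (fob F (trg C f)) (k (trg C f))"
        "cmp D (b (trg C f)) b' = idn D (fob F (trg C f))"
      using F.target.iso_inverse[OF b_in[OF t] b_iso[OF t]] by blast
    have fb: "cmp D (far F f) (b (src C f)) \<in> hom D (k (src C f)) (fob F (trg C f))"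
      using F.target.cmp_in[OF b_in[OF s]] F.far_hom[OF F.source.arr_hom[OF that]] by blast
    show ?thesis
      using F.target.cmp_in[OF fb b'(1)] F.target.cmp_assoc[OF fb b'(1) b_in[OF t]] b'(2)
        F.target.cmp_idn_left[OF fb] by (metis (full_types))
  qed
  then obtain h where h: "\<And>f. f \<in> arrs C \<Longrightarrow> h f \<in> hom D (k (src C f))
      (k (trg C f))"
      "\<And>f. f \<in> arrs C \<Longrightarrow> cmp D (b (trg C f)) (h f) = cmp D (far F f) (b
          (src C f))"
    by metis
  define G where "G = \<lparr>fob = (\<lambda>x \<in> obs C. k x), far = (\<lambda>f \<in> arrs C.
      h f)\<rparr>"
  have Go: "fob G x = k x" if "x \<in> obs C" for x
    using that by (simp add: G_def)
  have Ga: "far G f \<in> hom D (k x) (k y)" "cmp D (b y) (far G f) = cmp D (far F f) (b x)"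
    if "f \<in> hom C x y" for f x y
    using that h[of f] by (auto simp: G_def hom_iff)
  have "cat_functor C D G"
  proof
    show "fob G \<in> obs C \<rightarrow>\<^sub>E obs D" "far G \<in> arrs C \<rightarrow>\<^sub>E
        arrs D"
      using F.target.hom_obs[OF b_in] h(1) by (auto simp: G_def hom_iff)
    show "src D (far G f) = fob G (src C f)" "trg D (far G f) = fob G (trg C f)"
      if "f \<in> arrs C" for f
      using Ga(1)[OF F.source.arr_hom[OF that]] Go F.source.src_in F.source.trg_in that
      by (auto simp: hom_iff)
    fix x y z f g
    show "far G (idn C x) = idn D (fob G x)" if x: "x \<in> obs C"
    proof (rule F.target.iso_cancel_left[OF _ _ b_in[OF x] b_iso[OF x]])
      show "far G (idn C x) \<in> hom D (k x) (k x)" "idn D (fob G x) \<in> hom D (k x) (k x)"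
        using Ga(1)[OF F.source.idn_in[OF x]] F.target.idn_in F.target.hom_obs[OF b_in[OF x]] Go[OF
            x]
        by auto
      show "cmp D (b x) (far G (idn C x)) = cmp D (b x) (idn D (fob G x))"
        using Ga(2)[OF F.source.idn_in[OF x]] F.far_idn[OF x] F.target.cmp_idn_left[OF b_in[OF x]]
          F.target.cmp_idn_right[OF b_in[OF x]] Go[OF x] by simp
    qed
    show "far G (cmp C g f) = cmp D (far G g) (far G f)"
      if f: "f \<in> hom C x y" and g: "g \<in> hom C y z"
    proof -
      have x: "x \<in> obs C" and y: "y \<in> obs C" and z: "z \<in> obs C"
        using F.source.hom_obs f g by auto
      have gf: "cmp C g f \<in> hom C x z"
        using F.source.cmp_in[OF f g] .
      show ?thesis
      proof (rule F.target.iso_cancel_left[OF _ _ b_in[OF z] b_iso[OF z]])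
        show "far G (cmp C g f) \<in> hom D (k x) (k z)" "cmp D (far G g) (far G f) \<in> hom D (k
            x) (k z)"
          using Ga(1) F.target.cmp_in f g gf by blast+
        have "cmp D (b z) (far G (cmp C g f)) = cmp D (cmp D (far F g) (far F f)) (b x)"
          using Ga(2)[OF gf] F.far_cmp[OF f g] by simp
        also have "\<dots> = cmp D (cmp D (far F g) (b y)) (far G f)"
          using F.target.cmp_assoc[OF b_in[OF x] F.far_hom[OF f] F.far_hom[OF g]]
            F.target.cmp_assoc[OF Ga(1)[OF f] b_in[OF y] F.far_hom[OF g]] Ga(2)[OF f] by simp
        also have "\<dots> = cmp D (b z) (cmp D (far G g) (far G f))"
          using F.target.cmp_assoc[OF Ga(1)[OF f] Ga(1)[OF g] b_in[OF z]] Ga(2)[OF g] by simp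
        finally show "cmp D (b z) (far G (cmp C g f)) = cmp D (b z) (cmp D (far G g) (far G f))" .
      qed
    qed
  qed
  then show ?thesis
    using Go Ga(2) by blast
qed

text \<open>Essential surjectivity chooses objects \<open>s z\<close> with isomorphisms
  \<open>b z\<close> from \<open>F (s z)\<close> to \<open>z\<close>. Fullness and faithfulness then
  lift a functor on \<open>D\<close> with objects \<open>F (s z)\<close> through \<open>F\<close>,
  and the lift is the quasi-inverse.\<close>

lemma full_faithful_ess_surj_equivalence:
  assumes "cat_functor C D F"
    and full: "\<And>x y g. x \<in> obs C \<Longrightarrow> y \<in> obs C \<Longrightarrow> g \<in>
        hom D (fob F x) (fob F y) \<Longrightarrow>
      \<exists>f \<in> hom C x y. far F f = g"
    and faithful: "\<And>x y f f'. f \<in> hom C x y \<Longrightarrow> f' \<in> hom C x y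
        \<Longrightarrow> far F f = far F f' \<Longrightarrow> f = f'"
    and ess_surj: "\<And>z. z \<in> obs D \<Longrightarrow> \<exists>x \<in> obs C. isomorphic D
        (fob F x) z"
  shows "cat_equivalence C D F"
proof -
  interpret F: cat_functor C D F by fact
  from ess_surj obtain s b where s: "\<And>z. z \<in> obs D \<Longrightarrow> s z \<in> obs C"
    and b: "\<And>z. z \<in> obs D \<Longrightarrow> b z \<in> hom D (fob F (s z)) z" "\<And>z. z
        \<in> obs D \<Longrightarrow> iso D (b z)"
    unfolding isomorphic_def by metis
  \<comment> \<open>\<open>H\<close> is the identity functor of \<open>D\<close> conjugated by
    \<open>b\<close>; it is what the composite of \<open>F\<close> with the quasi-inverse has to
    be.\<close>
  obtain H where H: "cat_functor D D H" "\<And>z. z \<in> obs D \<Longrightarrow> fob H z = fob F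
      (s z)"
    "\<And>g x y. g \<in> hom D x y \<Longrightarrow> cmp D (b y) (far H g) = cmp D (far
        (id_functor D) g) (b x)"
    using functor_conjugate[OF functor_id[OF F.target.category_axioms], of b "\<lambda>z. fob F (s
        z)"] b
    by (metis fob_id)
  interpret H: cat_functor D D H by fact
  have Hhom: "far H g \<in> hom D (fob F (s x)) (fob F (s y))" if "g \<in> hom D x y" for g x y
    using H.far_hom[OF that] H(2) F.target.hom_obs[OF that] by simp
  have "\<exists>f \<in> hom C (s (src D g)) (s (trg D g)). far F f = far H g" if "g \<in> arrs D"
      for g
    using full[OF s s Hhom[OF F.target.arr_hom[OF that]]] that F.target.src_in F.target.trg_in by
        blast
  then obtain r where r: "\<And>g. g \<in> arrs D \<Longrightarrow> r g \<in> hom C (s (src D g))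
      (s (trg D g))"
    "\<And>g. g \<in> arrs D \<Longrightarrow> far F (r g) = far H g"
    by metis
  define G where "G = \<lparr>fob = (\<lambda>z \<in> obs D. s z), far = (\<lambda>g \<in> arrs D.
      r g)\<rparr>"
  have Go: "fob G z = s z" if "z \<in> obs D" for z
    using that by (simp add: G_def)
  have Ga: "far G g \<in> hom C (s x) (s y)" "far F (far G g) = far H g" if "g \<in> hom D x y" for
      g x y
    using that r[of g] by (auto simp: G_def hom_iff)
  have G: "cat_functor D C G"
  proof
    show "fob G \<in> obs D \<rightarrow>\<^sub>E obs C" "far G \<in> arrs D \<rightarrow>\<^sub>E
        arrs C"
      using s r(1) by (auto simp: G_def hom_iff)
    show "src C (far G g) = fob G (src D g)" "trg C (far G g) = fob G (trg D g)"
      if "g \<in> arrs D" for g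
      using Ga(1)[OF F.target.arr_hom[OF that]] Go F.target.src_in F.target.trg_in that
      by (auto simp: hom_iff)
    fix x y z f g
    show "far G (idn D x) = idn C (fob G x)" if x: "x \<in> obs D"
      using faithful[OF Ga(1)[OF F.target.idn_in[OF x]] F.source.idn_in[OF s[OF x]]]
        Ga(2)[OF F.target.idn_in[OF x]] H.far_idn[OF x] F.far_idn[OF s[OF x]] H(2)[OF x] Go[OF x]
            by simp
    show "far G (cmp D g f) = cmp C (far G g) (far G f)"
      if f: "f \<in> hom D x y" and g: "g \<in> hom D y z"
      using faithful[OF Ga(1)[OF F.target.cmp_in[OF f g]] F.source.cmp_in[OF Ga(1)[OF f] Ga(1)[OF
          g]]]
        Ga(2) f g F.target.cmp_in[OF f g] H.far_cmp[OF f g] F.far_cmp[OF Ga(1)[OF f] Ga(1)[OF g]]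
      by simp
  qed
  interpret G: cat_functor D C G by fact
  have e: "nat_iso D D (comp_functor D F G) (id_functor D) (\<lambda>z \<in> obs D. b z)"
  proof (intro nat_iso.intro nat_trans.intro nat_trans_axioms.intro nat_iso_axioms.intro
      functor_comp[OF G F.cat_functor_axioms] functor_id F.target.category_axioms)
    show "cmp D ((\<lambda>z\<in>obs D. b z) y) (far (comp_functor D F G) g) =
        cmp D (far (id_functor D) g) ((\<lambda>z\<in>obs D. b z) x)" if g: "g \<in> hom D x y" for
            x y g
      using H(3)[OF g] Ga(2)[OF g] g F.target.hom_obs[OF g] by (simp add: hom_iff)
  qed (use b Go in auto)
  \<comment> \<open>The unit at \<open>x\<close> lifts the inverse of \<open>b\<close> at
    \<open>F x\<close>. It is invertible because \<open>b\<close> at \<open>F x\<close> lifts as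
    well, and faithfulness reflects the two inverse laws.\<close>
  have "\<exists>c \<in> hom C x (s (fob F x)). iso C c \<and> cmp D (b (fob F x)) (far F c) = idn
      D (fob F x)"
    if x: "x \<in> obs C" for x
  proof -
    let ?z = "fob F x"
    have z: "?z \<in> obs D" using F.fob_obs[OF x] .
    obtain b' where b': "b' \<in> hom D ?z (fob F (s ?z))" "cmp D (b ?z) b' = idn D ?z"
        "cmp D b' (b ?z) = idn D (fob F (s ?z))"
      using F.target.iso_inverse[OF b(1)[OF z] b(2)[OF z]] by metis
    obtain c where c: "c \<in> hom C x (s ?z)" "far F c = b'"
      using full[OF x s[OF z] b'(1)] by blast
    obtain d where d: "d \<in> hom C (s ?z) x" "far F d = b ?z"
      using full[OF s[OF z] x b(1)[OF z]] by blast
    have "cmp C d c = idn C x" "cmp C c d = idn C (s ?z)"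
      using faithful[OF F.source.cmp_in[OF c(1) d(1)] F.source.idn_in[OF x]]
        faithful[OF F.source.cmp_in[OF d(1) c(1)] F.source.idn_in[OF s[OF z]]]
        F.far_cmp[OF c(1) d(1)] F.far_cmp[OF d(1) c(1)] b' c(2) d(2) F.far_idn x s[OF z] by auto
    then show ?thesis
      using F.source.isoI[OF c(1) d(1)] c b' by blast
  qed
  then obtain c where c: "\<And>x. x \<in> obs C \<Longrightarrow> c x \<in> hom C x (s (fob F x))"
      "\<And>x. x \<in> obs C \<Longrightarrow> iso C (c x)"
      "\<And>x. x \<in> obs C \<Longrightarrow> cmp D (b (fob F x)) (far F (c x)) = idn D (fob F x)"
    by metis
  have n: "nat_iso C C (id_functor C) (comp_functor C G F) (\<lambda>x \<in> obs C. c x)"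
  proof (intro nat_iso.intro nat_trans.intro nat_trans_axioms.intro nat_iso_axioms.intro
      functor_comp[OF F.cat_functor_axioms G] functor_id F.source.category_axioms)
    fix x y f assume f: "f \<in> hom C x y"
    have x: "x \<in> obs C" and y: "y \<in> obs C" using F.source.hom_obs[OF f] by auto
    have Ff: "far F f \<in> hom D (fob F x) (fob F y)" using F.far_hom[OF f] .
    have Fx: "fob F x \<in> obs D" and Fy: "fob F y \<in> obs D" using F.fob_obs x y by auto
    have l: "cmp C (c y) f \<in> hom C x (s (fob F y))"
      using F.source.cmp_in[OF f c(1)[OF y]] .
    have r: "cmp C (far G (far F f)) (c x) \<in> hom C x (s (fob F y))"
      using F.source.cmp_in[OF c(1)[OF x] Ga(1)[OF Ff]] .
    \<comment> \<open>Naturality of the unit is tested in \<open>D\<close>: after \<open>F\<close>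
      and after the invertible \<open>b\<close> at \<open>F y\<close>, both sides become
      \<open>F f\<close>.\<close>
    have "cmp D (b (fob F y)) (far F (cmp C (c y) f)) = far F f"
      using F.far_cmp[OF f c(1)[OF y]]
        F.target.cmp_assoc[OF Ff F.far_hom[OF c(1)[OF y]] b(1)[OF Fy]]
        c(3)[OF y] F.target.cmp_idn_left[OF Ff] by simp
    moreover have "cmp D (b (fob F y)) (far F (cmp C (far G (far F f)) (c x))) =
        cmp D (cmp D (b (fob F y)) (far H (far F f))) (far F (c x))"
      using F.far_cmp[OF c(1)[OF x] Ga(1)[OF Ff]] Ga(2)[OF Ff]
        F.target.cmp_assoc[OF F.far_hom[OF c(1)[OF x]] Hhom[OF Ff] b(1)[OF Fy]] by simp
    moreover have "\<dots> = far F f"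
      using H(3)[OF Ff] Ff F.target.cmp_assoc[OF F.far_hom[OF c(1)[OF x]] b(1)[OF Fx] Ff]
        c(3)[OF x] F.target.cmp_idn_right[OF Ff] by (simp add: hom_iff)
    ultimately have "far F (cmp C (c y) f) = far F (cmp C (far G (far F f)) (c x))"
      using F.target.iso_cancel_left[OF F.far_hom[OF l] F.far_hom[OF r] b(1)[OF Fy] b(2)[OF Fy]] by
          simp
    then show "cmp C ((\<lambda>x\<in>obs C. c x) y) (far (id_functor C) f) =
        cmp C (far (comp_functor C G F) f) ((\<lambda>x\<in>obs C. c x) x)"
      using faithful[OF l r] f x y by (simp add: hom_iff)
  qed (use c Go F.fob_obs in auto)
  show ?thesis
    using F.cat_functor_axioms G n e
    by (auto intro!: cat_equivalence.intro cat_equivalence_axioms.intro)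
qed

section \<open>Composition, whiskering and inversion of natural transformations\<close>

lemma nat_trans_vcomp:
  assumes "nat_trans C D F G \<sigma>" "nat_trans C D G H \<tau>"
  shows "nat_trans C D F H (\<lambda>x \<in> obs C. cmp D (\<tau> x) (\<sigma> x))"
proof -
  interpret s: nat_trans C D F G \<sigma> by fact
  interpret t: nat_trans C D G H \<tau> by fact
  show ?thesis
  proof
    fix x y f
    show "(\<lambda>x\<in>obs C. cmp D (\<tau> x) (\<sigma> x)) x \<in> hom D (fob F x) (fob H x)"
        if "x \<in> obs C"
      using that s.F.target.cmp_in[OF s.component_in t.component_in] by simp
    assume f: "f \<in> hom C x y"
    have x: "x \<in> obs C" and y: "y \<in> obs C" using s.F.source.hom_obs[OF f] by auto
    have "cmp D (cmp D (\<tau> y) (\<sigma> y)) (far F f) = cmp D (\<tau> y) (cmp D (far G f)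
        (\<sigma> x))"
      using s.F.target.cmp_assoc[OF s.F.far_hom[OF f] s.component_in[OF y] t.component_in[OF y]]
        s.naturality[OF f] by simp
    also have "\<dots> = cmp D (cmp D (far H f) (\<tau> x)) (\<sigma> x)"
      using s.F.target.cmp_assoc[OF s.component_in[OF x] s.G.far_hom[OF f] t.component_in[OF y]]
        t.naturality[OF f] by simp
    also have "\<dots> = cmp D (far H f) (cmp D (\<tau> x) (\<sigma> x))"
      using s.F.target.cmp_assoc[OF s.component_in[OF x] t.component_in[OF x] t.G.far_hom[OF f]] by
          simp
    finally show "cmp D ((\<lambda>x\<in>obs C. cmp D (\<tau> x) (\<sigma> x)) y) (far F f) =
        cmp D (far H f) ((\<lambda>x\<in>obs C. cmp D (\<tau> x) (\<sigma> x)) x)"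
      using x y by simp
  qed auto
qed

lemma nat_trans_whisker_left:
  assumes "nat_trans C D F G \<tau>" "cat_functor D E H"
  shows "nat_trans C E (comp_functor C H F) (comp_functor C H G) (\<lambda>x \<in> obs C. far H
      (\<tau> x))"
proof -
  interpret t: nat_trans C D F G \<tau> by fact
  interpret H: cat_functor D E H by fact
  interpret HF: cat_functor C E "comp_functor C H F"
    using functor_comp[OF t.F.cat_functor_axioms assms(2)] .
  interpret HG: cat_functor C E "comp_functor C H G"
    using functor_comp[OF t.G.cat_functor_axioms assms(2)] .
  show ?thesis
  proof
    fix x y f
    show "(\<lambda>x\<in>obs C. far H (\<tau> x)) x \<in> hom E (fob (comp_functor C H F) x) (fob
        (comp_functor C H G) x)"
      if "x \<in> obs C"
      using that H.far_hom[OF t.component_in] by simp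
    assume f: "f \<in> hom C x y"
    have x: "x \<in> obs C" and y: "y \<in> obs C" using t.F.source.hom_obs[OF f] by auto
    show "cmp E ((\<lambda>x\<in>obs C. far H (\<tau> x)) y) (far (comp_functor C H F) f) =
        cmp E (far (comp_functor C H G) f) ((\<lambda>x\<in>obs C. far H (\<tau> x)) x)"
      using H.far_cmp[OF t.F.far_hom[OF f] t.component_in[OF y]]
        H.far_cmp[OF t.component_in[OF x] t.G.far_hom[OF f]] t.naturality[OF f] x y f
      by (simp add: hom_iff)
  qed auto
qed

lemma nat_trans_whisker_right:
  assumes "nat_trans D E G H \<tau>" "cat_functor C D F"
  shows "nat_trans C E (comp_functor C G F) (comp_functor C H F) (\<lambda>x \<in> obs C. \<tau>
      (fob F x))"
proof -
  interpret t: nat_trans D E G H \<tau> by fact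
  interpret F: cat_functor C D F by fact
  interpret GF: cat_functor C E "comp_functor C G F"
    using functor_comp[OF assms(2) t.F.cat_functor_axioms] .
  interpret HF: cat_functor C E "comp_functor C H F"
    using functor_comp[OF assms(2) t.G.cat_functor_axioms] .
  show ?thesis
  proof
    fix x y f
    show "(\<lambda>x\<in>obs C. \<tau> (fob F x)) x \<in> hom E (fob (comp_functor C G F) x) (fob
        (comp_functor C H F) x)"
      if "x \<in> obs C"
      using that t.component_in[OF F.fob_obs] by simp
    assume f: "f \<in> hom C x y"
    have x: "x \<in> obs C" and y: "y \<in> obs C" using F.source.hom_obs[OF f] by auto
    show "cmp E ((\<lambda>x\<in>obs C. \<tau> (fob F x)) y) (far (comp_functor C G F) f) =
        cmp E (far (comp_functor C H F) f) ((\<lambda>x\<in>obs C. \<tau> (fob F x)) x)"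
      using t.naturality[OF F.far_hom[OF f]] x y f by (simp add: hom_iff)
  qed auto
qed

lemma nat_iso_iff:
  "nat_iso C D F G \<tau> \<longleftrightarrow> nat_trans C D F G \<tau> \<and> (\<forall>x \<in>
      obs C. iso D (\<tau> x))"
  by (auto simp: nat_iso_def nat_iso_axioms_def)

lemma nat_iso_vcomp:
  assumes "nat_iso C D F G \<sigma>" "nat_iso C D G H \<tau>"
  shows "nat_iso C D F H (\<lambda>x \<in> obs C. cmp D (\<tau> x) (\<sigma> x))"
proof -
  interpret s: nat_iso C D F G \<sigma> by fact
  interpret t: nat_iso C D G H \<tau> by fact
  show ?thesis
    unfolding nat_iso_iff
    using nat_trans_vcomp[OF s.nat_trans_axioms t.nat_trans_axioms]
      s.F.target.iso_cmp[OF s.component_in t.component_in s.component_iso t.component_iso] by simp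
qed

lemma nat_iso_whisker_left:
  assumes "nat_iso C D F G \<tau>" "cat_functor D E H"
  shows "nat_iso C E (comp_functor C H F) (comp_functor C H G) (\<lambda>x \<in> obs C. far H
      (\<tau> x))"
proof -
  interpret t: nat_iso C D F G \<tau> by fact
  show ?thesis
    unfolding nat_iso_iff
    using nat_trans_whisker_left[OF t.nat_trans_axioms assms(2)]
      cat_functor.far_iso[OF assms(2) t.component_in t.component_iso] by simp
qed

lemma nat_iso_whisker_right:
  assumes "nat_iso D E G H \<tau>" "cat_functor C D F"
  shows "nat_iso C E (comp_functor C G F) (comp_functor C H F) (\<lambda>x \<in> obs C. \<tau> (fob
      F x))"
proof -
  interpret t: nat_iso D E G H \<tau> by fact
  show ?thesis
    unfolding nat_iso_iff
    using nat_trans_whisker_right[OF t.nat_trans_axioms assms(2)]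
      t.component_iso[OF cat_functor.fob_obs[OF assms(2)]] by simp
qed

lemma nat_iso_id:
  assumes "cat_functor C D F"
  shows "nat_iso C D F F (\<lambda>x \<in> obs C. idn D (fob F x))"
proof -
  interpret cat_functor C D F by fact
  show ?thesis
  proof
    fix x y f
    show "(\<lambda>x\<in>obs C. idn D (fob F x)) x \<in> hom D (fob F x) (fob F x)"
      "iso D ((\<lambda>x\<in>obs C. idn D (fob F x)) x)" if "x \<in> obs C"
      using that target.idn_in[OF fob_obs] target.iso_idn[OF fob_obs] by simp_all
    assume f: "f \<in> hom C x y"
    show "cmp D ((\<lambda>x\<in>obs C. idn D (fob F x)) y) (far F f) =
        cmp D (far F f) ((\<lambda>x\<in>obs C. idn D (fob F x)) x)"
      using source.hom_obs[OF f] target.cmp_idn_left[OF far_hom[OF f]]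
        target.cmp_idn_right[OF far_hom[OF f]] by simp
  qed auto
qed

lemma nat_trans_inverse:
  assumes "nat_trans C D F G \<tau>" "\<sigma> \<in> extensional (obs C)"
    and \<sigma>: "\<And>x. x \<in> obs C \<Longrightarrow> \<sigma> x \<in> hom D (fob G x) (fob F
        x)"
    and l: "\<And>x. x \<in> obs C \<Longrightarrow> cmp D (\<sigma> x) (\<tau> x) = idn D (fob F
        x)"
    and r: "\<And>x. x \<in> obs C \<Longrightarrow> cmp D (\<tau> x) (\<sigma> x) = idn D (fob G
        x)"
  shows "nat_trans C D G F \<sigma>"
proof -
  interpret t: nat_trans C D F G \<tau> by fact
  have i: "iso D (\<tau> x)" if "x \<in> obs C" for x
    using t.F.target.isoI[OF t.component_in[OF that] \<sigma>[OF that] l[OF that] r[OF that]] .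
  show ?thesis
  proof
    fix x y f assume f: "f \<in> hom C x y"
    have x: "x \<in> obs C" and y: "y \<in> obs C" using t.F.source.hom_obs[OF f] by auto
    show "cmp D (\<sigma> y) (far G f) = cmp D (far F f) (\<sigma> x)"
      using t.F.target.iso_commute[OF t.component_in[OF x] i[OF x] t.component_in[OF y] i[OF y]
          t.F.far_hom[OF f] t.G.far_hom[OF f] t.naturality[OF f]
          \<sigma>[OF x] l[OF x] r[OF x] \<sigma>[OF y] l[OF y] r[OF y]] .
  qed (use assms in auto)
qed


section \<open>Arrow categories\<close>

lemma arrow_hom_iff:
  "s \<in> hom (arrow_cat C) f g \<longleftrightarrow> s_src s = f \<and> s_trg s = g \<and> f
      \<in> arrs C \<and> g \<in> arrs C \<and>
    s_top s \<in> hom C (src C f) (src C g) \<and> s_bot s \<in> hom C (trg C f) (trg C g) \<and>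
    cmp C g (s_top s) = cmp C (s_bot s) f"
  unfolding hom_iff[of s "arrow_cat C" f g] by (cases s) (auto simp: arrow_cat_def)

lemma obs_arrow_cat [simp]: "obs (arrow_cat C) = arrs C"
  and src_arrow_cat [simp]: "src (arrow_cat C) = s_src"
  and trg_arrow_cat [simp]: "trg (arrow_cat C) = s_trg"
  and idn_arrow_cat [simp]: "idn (arrow_cat C) f = Sq f (idn C (src C f)) (idn C (trg C f)) f"
  and cmp_arrow_cat [simp]: "cmp (arrow_cat C) t s =
    Sq (s_src s) (cmp C (s_top t) (s_top s)) (cmp C (s_bot t) (s_bot s)) (s_trg t)"
  by (simp_all add: arrow_cat_def)

lemma category_arrow_cat:
  assumes "category C"
  shows "category (arrow_cat C)"
proof -
  interpret category C by fact
  have arr: "s \<in> hom (arrow_cat C) (s_src s) (s_trg s)" if "s \<in> arrs (arrow_cat C)" for s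
    using that by (simp add: hom_def)
  show ?thesis
  proof
    fix s t r e f g h
    show "src (arrow_cat C) s \<in> obs (arrow_cat C)" "trg (arrow_cat C) s \<in> obs (arrow_cat C)"
      if "s \<in> arrs (arrow_cat C)"
      using arr[OF that] by (simp_all add: arrow_hom_iff)
    show "idn (arrow_cat C) f \<in> hom (arrow_cat C) f f" if "f \<in> obs (arrow_cat C)"
      using that idn_in src_in trg_in cmp_idn_left[OF arr_hom] cmp_idn_right[OF arr_hom]
      by (simp add: arrow_hom_iff)
    assume s: "s \<in> hom (arrow_cat C) f g"
    show "cmp (arrow_cat C) (idn (arrow_cat C) g) s = s" "cmp (arrow_cat C) s (idn (arrow_cat C) f)
        = s"
      using s by (cases s; auto simp: arrow_hom_iff intro: cmp_idn_left cmp_idn_right)+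
    assume t: "t \<in> hom (arrow_cat C) g h"
    show "cmp (arrow_cat C) t s \<in> hom (arrow_cat C) f h"
    proof -
      have st: "s_top s \<in> hom C (src C f) (src C g)" "s_top t \<in> hom C (src C g) (src C h)"
        and sb: "s_bot s \<in> hom C (trg C f) (trg C g)" "s_bot t \<in> hom C (trg C g) (trg C h)"
        and a: "f \<in> hom C (src C f) (trg C f)" "g \<in> hom C (src C g) (trg C g)"
          "h \<in> hom C (src C h) (trg C h)"
        and e: "cmp C g (s_top s) = cmp C (s_bot s) f" "cmp C h (s_top t) = cmp C (s_bot t) g"
        using s t arr_hom by (auto simp: arrow_hom_iff)
      have "cmp C h (cmp C (s_top t) (s_top s)) = cmp C (s_bot t) (cmp C g (s_top s))"
        using cmp_assoc[OF st a(3)] cmp_assoc[OF st(1) a(2) sb(2)] e(2) by simp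
      also have "\<dots> = cmp C (cmp C (s_bot t) (s_bot s)) f"
        using cmp_assoc[OF a(1) sb] e(1) by simp
      finally show ?thesis
        using s t cmp_in[OF st] cmp_in[OF sb] by (simp add: arrow_hom_iff)
    qed
    assume r: "r \<in> hom (arrow_cat C) e f"
    show "cmp (arrow_cat C) t (cmp (arrow_cat C) s r) = cmp (arrow_cat C) (cmp (arrow_cat C) t s) r"
      using r s t cmp_assoc by (simp add: arrow_hom_iff) blast
  qed
qed

text \<open>Squares compose side by side, so the top of an inverse square inverts the top. This
  turns the comparison \<open>m_iso\<close> of a pseudo map into isomorphisms of contexts.\<close>

lemma iso_arrow_top:
  assumes "iso (arrow_cat C) s" "s \<in> hom (arrow_cat C) f g"
  shows "iso C (s_top s)"
proof -
  from assms(1) obtain t where t: "t \<in> hom (arrow_cat C) (s_trg s) (s_src s)"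
    and e: "cmp (arrow_cat C) t s = idn (arrow_cat C) (s_src s)"
      "cmp (arrow_cat C) s t = idn (arrow_cat C) (s_trg s)"
    by (auto simp: iso_def)
  have "s_top s \<in> hom C (src C f) (src C g)" "s_top t \<in> hom C (src C g) (src C f)"
    using assms(2) t by (auto simp: arrow_hom_iff)
  then show ?thesis
    using e assms(2) by (auto simp: iso_def arrow_hom_iff hom_iff[of _ C])
qed

lemma fob_arrow_functor [simp]: "f \<in> arrs C \<Longrightarrow> fob (arrow_functor C F) f = far F
    f"
  and far_arrow_functor [simp]: "s \<in> arrs (arrow_cat C) \<Longrightarrow> far (arrow_functor C
      F) s = map_square (far F) s"
  by (simp_all add: arrow_functor_def)

lemma arrow_functor:
  assumes "cat_functor C D F"
  shows "cat_functor (arrow_cat C) (arrow_cat D) (arrow_functor C F)"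
proof -
  interpret F: cat_functor C D F by fact
  interpret AC: category "arrow_cat C" using category_arrow_cat[OF F.source.category_axioms] .
  interpret AD: category "arrow_cat D" using category_arrow_cat[OF F.target.category_axioms] .
  have map: "map_square (far F) s \<in> hom (arrow_cat D) (far F f) (far F g)"
    if s: "s \<in> hom (arrow_cat C) f g" for s f g
  proof -
    have a: "f \<in> hom C (src C f) (trg C f)" "g \<in> hom C (src C g) (trg C g)"
      "s_top s \<in> hom C (src C f) (src C g)" "s_bot s \<in> hom C (trg C f) (trg C g)"
      "cmp C g (s_top s) = cmp C (s_bot s) f" "s_src s = f" "s_trg s = g" "f \<in> arrs C" "g \<in>
          arrs C"
      using s F.source.arr_hom by (auto simp: arrow_hom_iff)
    then show ?thesis
      using F.far_cmp[OF a(3,2)] F.far_cmp[OF a(1,4)] F.far_hom[OF a(3)] F.far_hom[OF a(4)]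
      by (cases s) (simp add: arrow_hom_iff F.far_arr F.far_src F.far_trg)
  qed
  have arr: "map_square (far F) s \<in> arrs (arrow_cat D)" if "s \<in> arrs (arrow_cat C)" for s
    using map[of s "s_src s" "s_trg s"] that by (simp add: hom_def)
  show ?thesis
  proof
    show "fob (arrow_functor C F) \<in> obs (arrow_cat C) \<rightarrow>\<^sub>E obs (arrow_cat D)"
      "far (arrow_functor C F) \<in> arrs (arrow_cat C) \<rightarrow>\<^sub>E arrs (arrow_cat D)"
      using arr F.far_arr by (auto simp: arrow_functor_def)
    fix s t f g h
    show "src (arrow_cat D) (far (arrow_functor C F) s) =
        fob (arrow_functor C F) (src (arrow_cat C) s)"
      "trg (arrow_cat D) (far (arrow_functor C F) s) =
        fob (arrow_functor C F) (trg (arrow_cat C) s)" if "s \<in> arrs (arrow_cat C)"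
      using that AC.src_in[OF that] AC.trg_in[OF that] by (cases s; simp)+
    show "far (arrow_functor C F) (idn (arrow_cat C) f) =
        idn (arrow_cat D) (fob (arrow_functor C F) f)" if "f \<in> obs (arrow_cat C)"
      using AC.idn_in[OF that] that F.far_idn F.far_src F.far_trg F.source.src_in F.source.trg_in
      by (simp add: hom_iff[of _ "arrow_cat C"])
    assume s: "s \<in> hom (arrow_cat C) f g" and t: "t \<in> hom (arrow_cat C) g h"
    have "s \<in> arrs (arrow_cat C)" "t \<in> arrs (arrow_cat C)" "cmp (arrow_cat C) t s \<in>
        arrs (arrow_cat C)"
      using s t AC.cmp_in[OF s t] by (simp_all add: hom_iff[of _ "arrow_cat C"])
    then show "far (arrow_functor C F) (cmp (arrow_cat C) t s) =
        cmp (arrow_cat D) (far (arrow_functor C F) t) (far (arrow_functor C F) s)"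
      using s t F.far_cmp by (cases s; cases t) (auto simp: arrow_hom_iff)
  qed
qed

lemma arrow_functor_comp:
  assumes "cat_functor C D F" "cat_functor D E G"
  shows "arrow_functor C (comp_functor C G F) =
    comp_functor (arrow_cat C) (arrow_functor D G) (arrow_functor C F)"
proof (rule functor_eqI[OF arrow_functor[OF functor_comp[OF assms]]
      functor_comp[OF arrow_functor[OF assms(1)] arrow_functor[OF assms(2)]]])
  interpret F: cat_functor C D F by fact
  fix s assume s: "s \<in> arrs (arrow_cat C)"
  then have "s_src s \<in> arrs C" "s_trg s \<in> arrs C" "s_top s \<in> arrs C" "s_bot s \<in>
      arrs C"
    by (auto simp: arrow_cat_def hom_iff)
  moreover have "map_square (far F) s \<in> arrs (arrow_cat D)"
    using cat_functor.far_arr[OF arrow_functor[OF assms(1)] s] s by simp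
  ultimately show "far (arrow_functor C (comp_functor C G F)) s =
      far (comp_functor (arrow_cat C) (arrow_functor D G) (arrow_functor C F)) s"
    using s by (cases s) simp
qed (use cat_functor.far_arr[OF assms(1)] in simp)

lemma arrow_functor_id:
  assumes "category C"
  shows "arrow_functor C (id_functor C) = id_functor (arrow_cat C)"
proof (rule functor_eqI[OF arrow_functor[OF functor_id[OF assms]]
      functor_id[OF category_arrow_cat[OF assms]]])
  fix s assume s: "s \<in> arrs (arrow_cat C)"
  then have "s_src s \<in> arrs C" "s_trg s \<in> arrs C" "s_top s \<in> arrs C" "s_bot s \<in>
      arrs C"
    by (auto simp: arrow_cat_def hom_iff)
  then show "far (arrow_functor C (id_functor C)) s = far (id_functor (arrow_cat C)) s"
    using s by (cases s) simp
qed simp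

section \<open>Pseudo maps and transformations\<close>

context comprehension_category
begin

lemma compr_hom:
  assumes "A \<in> obs (ty X)"
  shows "fob (compr X) A \<in> hom (ctx X) (ext X A) (fob (proj X) A)"
proof -
  have a: "fob (compr X) A \<in> arrs (ctx X)"
    using compr.fob_obs[OF assms] by simp
  have "fob (comp_functor (ty X) (cod_functor (ctx X)) (compr X)) A = fob (proj X) A"
    using cod_compr by simp
  then show ?thesis
    using a assms by (simp add: hom_iff ext_def cod_functor_def)
qed

lemma ext_obs: "A \<in> obs (ty X) \<Longrightarrow> ext X A \<in> obs (ctx X)"
  using target.hom_obs[OF compr_hom] by blast

lemma compr_square:
  assumes "h \<in> hom (ty X) A B"
  shows "far (compr X) h \<in> hom (arrow_cat (ctx X)) (fob (compr X) A) (fob (compr X) B)"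
  using compr.far_hom[OF assms] .

lemma compr_bot:
  assumes "h \<in> arrs (ty X)"
  shows "s_bot (far (compr X) h) = far (proj X) h"
proof -
  have "far (comp_functor (ty X) (cod_functor (ctx X)) (compr X)) h = far (proj X) h"
    using cod_compr by simp
  then show ?thesis
    using assms compr.far_arr[OF assms] by (simp add: cod_functor_def)
qed

text \<open>Three sides of a comprehension square are known from \<open>compr\<close> on objects and
  from \<open>proj\<close>, so only the top map has to be compared when functors into the arrow
  category are shown equal.\<close>

lemma compr_eq_Sq:
  assumes "h \<in> hom (ty X) A B"
  shows "far (compr X) h =
    Sq (fob (compr X) A) (s_top (far (compr X) h)) (far (proj X) h) (fob (compr X) B)"
  using compr_square[OF assms] compr_bot[of h] assms
  by (cases "far (compr X) h") (auto simp: arrow_hom_iff hom_iff[of h])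

lemma compr_top:
  assumes "h \<in> hom (ty X) A B"
  shows "s_top (far (compr X) h) \<in> hom (ctx X) (ext X A) (ext X B)"
  using compr_square[OF assms] by (auto simp: arrow_hom_iff ext_def)

lemma compr_commute:
  assumes "h \<in> hom (ty X) A B"
  shows "cmp (ctx X) (fob (compr X) B) (s_top (far (compr X) h)) =
    cmp (ctx X) (far (proj X) h) (fob (compr X) A)"
  using compr_square[OF assms] compr_bot assms by (auto simp: arrow_hom_iff hom_iff[of h])

lemma compr_top_cmp:
  assumes "f \<in> hom (ty X) A B" "g \<in> hom (ty X) B D"
  shows "s_top (far (compr X) (cmp (ty X) g f)) =
    cmp (ctx X) (s_top (far (compr X) g)) (s_top (far (compr X) f))"
  using compr.far_cmp[OF assms] by simp

lemma compr_top_idn: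
  "A \<in> obs (ty X) \<Longrightarrow> s_top (far (compr X) (idn (ty X) A)) = idn (ctx X) (ext X
      A)"
  using compr.far_idn by (simp add: ext_def)

end

context pseudo_map
begin

lemma m_iso_hom:
  assumes "A \<in> obs (ty X)"
  shows "m_iso M A \<in> hom (arrow_cat (ctx Y))
    (fob (compr Y) (fob (m_ty M) A)) (far (m_ctx M) (fob (compr X) A))"
  using m_iso.component_in[OF assms] assms source.compr.fob_obs[OF assms] by simp

lemma m_iso_top:
  assumes "A \<in> obs (ty X)"
  shows "s_top (m_iso M A) \<in> hom (ctx Y) (ext Y (fob (m_ty M) A)) (fob (m_ctx M) (ext X A))"
  using m_iso_hom[OF assms] m_ctx.far_src source.compr_hom[OF assms]
  by (simp add: arrow_hom_iff ext_def hom_iff[of "fob (compr X) A"])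

lemma m_iso_top_iso: "A \<in> obs (ty X) \<Longrightarrow> iso (ctx Y) (s_top (m_iso M A))"
  using iso_arrow_top[OF m_iso.component_iso m_iso_hom] .

lemma proj_m_ty:
  "A \<in> obs (ty X) \<Longrightarrow> fob (proj Y) (fob (m_ty M) A) = fob (m_ctx M) (fob (proj X)
      A)"
  using arg_cong[OF m_ty_over, of "\<lambda>F. fob F A"] by simp

lemma proj_m_ty_far:
  "h \<in> arrs (ty X) \<Longrightarrow> far (proj Y) (far (m_ty M) h) = far (m_ctx M) (far (proj
      X) h)"
  using arg_cong[OF m_ty_over, of "\<lambda>F. far F h"] by simp

text \<open>The bottom side of \<open>m_iso\<close> is an identity, so the comparison square
  collapses to a triangle over the base context.\<close>

lemma m_iso_commute:
  assumes A: "A \<in> obs (ty X)"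
  shows "cmp (ctx Y) (far (m_ctx M) (fob (compr X) A)) (s_top (m_iso M A)) =
    fob (compr Y) (fob (m_ty M) A)"
  using m_iso_hom[OF A] m_iso_over[OF A] source.target.cmp_idn_left
    target.target.cmp_idn_left[OF target.compr_hom[OF m_ty.fob_obs[OF A]]] proj_m_ty[OF A]
  by (simp add: arrow_hom_iff)

lemma m_iso_natural:
  assumes h: "h \<in> hom (ty X) A B"
  shows "cmp (ctx Y) (s_top (m_iso M B)) (s_top (far (compr Y) (far (m_ty M) h))) =
    cmp (ctx Y) (far (m_ctx M) (s_top (far (compr X) h))) (s_top (m_iso M A))"
proof -
  have "h \<in> arrs (ty X)" "far (compr X) h \<in> arrs (arrow_cat (ctx X))"
    using h source.compr.far_arr by (auto simp: hom_iff[of h])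
  then show ?thesis
    using arg_cong[OF m_iso.naturality[OF h], of s_top]
    by (cases "far (compr X) h") simp
qed

end

text \<open>Once \<open>compr\<close> identifies the two composites into the arrow category, the
  comparison is the identity transformation of one functor. A strict map is therefore given by its
  two functors alone.\<close>

lemma strict_mapI:
  assumes "contextual_comp_cat X" "contextual_comp_cat Y"
    and F: "cat_functor (ctx X) (ctx Y) F" and G: "cat_functor (ty X) (ty Y) G"
    and over: "comp_functor (ty X) (proj Y) G = comp_functor (ty X) F (proj X)"
    and cart: "\<And>h. cartesian (ty X) (ctx X) (proj X) h \<Longrightarrow>
      cartesian (ty Y) (ctx Y) (proj Y) (far G h)"
    and compr: "comp_functor (ty X) (compr Y) G = comp_functor (ty X) (arrow_functor (ctx X) F)
        (compr X)"
    and emp: "fob F (emp X) = emp Y"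
  shows "cxl_strict_map X Y \<lparr>m_ctx = F, m_ty = G,
    m_iso = (\<lambda>A \<in> obs (ty X). idn (arrow_cat (ctx Y)) (fob (compr Y) (fob G A))),
    m_emp = idn (ctx Y) (emp Y)\<rparr>"
proof -
  interpret X: contextual_comp_cat X by fact
  interpret Y: contextual_comp_cat Y by fact
  interpret F: cat_functor "ctx X" "ctx Y" F by fact
  interpret G: cat_functor "ty X" "ty Y" G by fact
  have compr_G: "cat_functor (ty X) (arrow_cat (ctx Y)) (comp_functor (ty X) (compr Y) G)"
    using functor_comp[OF G Y.compr.cat_functor_axioms] .
  have "nat_iso (ty X) (arrow_cat (ctx Y)) (comp_functor (ty X) (compr Y) G)
      (comp_functor (ty X) (arrow_functor (ctx X) F) (compr X))
      (\<lambda>A \<in> obs (ty X). idn (arrow_cat (ctx Y)) (fob (compr Y) (fob G A)))"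
    using nat_iso_id[OF compr_G] unfolding compr by (simp cong: restrict_cong flip: compr)
  moreover have "trg (ctx Y) (fob (compr Y) (fob G A)) = fob F (fob (proj X) A)"
    if A: "A \<in> obs (ty X)" for A
    using Y.compr_hom[OF G.fob_obs[OF A]] arg_cong[OF over, of "\<lambda>F. fob F A"] A
    by (simp add: hom_iff)
  moreover have "emp Y \<in> obs (ctx Y)"
    using Y.emp_terminal by (simp add: terminal_def)
  ultimately show ?thesis
    using assms Y.target.idn_in[of "emp Y"] Y.target.iso_idn[of "emp Y"]
      X.comprehension_category_axioms Y.comprehension_category_axioms
    by (intro cxl_strict_map.intro cxl_strict_map_axioms.intro cxl_pseudo_map.intro
        cxl_pseudo_map_axioms.intro pseudo_map.intro pseudo_map_axioms.intro) auto
qed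

lemma strict_id_map:
  assumes "contextual_comp_cat X"
  shows "cxl_strict_map X X (id_map X)"
proof -
  interpret X: contextual_comp_cat X by fact
  have "cxl_strict_map X X \<lparr>m_ctx = id_functor (ctx X), m_ty = id_functor (ty X),
    m_iso = (\<lambda>A \<in> obs (ty X). idn (arrow_cat (ctx X)) (fob (compr X) (fob (id_functor
        (ty X)) A))),
    m_emp = idn (ctx X) (emp X)\<rparr>"
    using X.emp_terminal
    by (intro strict_mapI assms functor_id X.source.category_axioms X.target.category_axioms)
      (auto simp: comp_functor_id_right[OF X.cat_functor_axioms]
        comp_functor_id_right[OF X.compr.cat_functor_axioms] comp_functor_id_left[OF
            X.cat_functor_axioms]
        comp_functor_id_left[OF X.compr.cat_functor_axioms]
        arrow_functor_id[OF X.target.category_axioms] cartesian_def terminal_def)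
  then show ?thesis
    by (simp add: id_map_def cong: restrict_cong)
qed

text \<open>The comparison of a composite is a pasting: that of \<open>N\<close> whiskered with
  \<open>m_ty M\<close>, followed by the image under \<open>m_ctx N\<close> of that of
  \<open>M\<close>.\<close>

lemma pseudo_comp_map:
  assumes "cxl_pseudo_map X Y M" "cxl_pseudo_map Y Z N"
  shows "cxl_pseudo_map X Z (comp_map X Y Z N M)"
proof -
  interpret M: cxl_pseudo_map X Y M by fact
  interpret N: cxl_pseudo_map Y Z N by fact
  let ?F = "comp_functor (ctx X) (m_ctx N) (m_ctx M)" and ?G = "comp_functor (ty X) (m_ty N) (m_ty
      M)"
  have F: "cat_functor (ctx X) (ctx Z) ?F"
    using functor_comp[OF M.m_ctx.cat_functor_axioms N.m_ctx.cat_functor_axioms] .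
  have G: "cat_functor (ty X) (ty Z) ?G"
    using functor_comp[OF M.m_ty.cat_functor_axioms N.m_ty.cat_functor_axioms] .
  note a = comp_functor_assoc[OF M.m_ty.cat_functor_axioms]
    comp_functor_assoc[OF M.source.cat_functor_axioms]
    comp_functor_assoc[OF M.source.compr.cat_functor_axioms]
  have over: "comp_functor (ty X) (proj Z) ?G = comp_functor (ty X) ?F (proj X)"
    by (metis a(1,2) N.m_ty_over M.m_ty_over)
  \<comment> \<open>Strict associativity of functor composition makes the sources and targets of the
    two whiskered isomorphisms literally match, so that they can be composed.\<close>
  have c1: "comp_functor (ty X) (comp_functor (ty Y) (compr Z) (m_ty N)) (m_ty M) =
      comp_functor (ty X) (compr Z) ?G"
    by (metis a(1))
  have c2: "comp_functor (ty X) (comp_functor (ty Y) (arrow_functor (ctx Y) (m_ctx N)) (compr Y))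
      (m_ty M) =
      comp_functor (ty X) (arrow_functor (ctx Y) (m_ctx N)) (comp_functor (ty X) (compr Y) (m_ty
          M))"
    by (metis a(1))
  have c3: "comp_functor (ty X) (arrow_functor (ctx Y) (m_ctx N))
        (comp_functor (ty X) (arrow_functor (ctx X) (m_ctx M)) (compr X)) =
      comp_functor (ty X) (arrow_functor (ctx X) ?F) (compr X)"
    by (metis a(3) arrow_functor_comp[OF M.m_ctx.cat_functor_axioms N.m_ctx.cat_functor_axioms])
  have "nat_iso (ty X) (arrow_cat (ctx Z)) (comp_functor (ty X) (compr Z) ?G)
      (comp_functor (ty X) (arrow_functor (ctx X) ?F) (compr X))
      (m_iso (comp_map X Y Z N M))"
    using nat_iso_vcomp[OF
        nat_iso_whisker_right[OF N.m_iso.nat_iso_axioms M.m_ty.cat_functor_axioms, unfolded c1 c2]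
        nat_iso_whisker_left[OF M.m_iso.nat_iso_axioms
          arrow_functor[OF N.m_ctx.cat_functor_axioms], unfolded c3]]
    by (simp add: comp_map_def cong: restrict_cong)
  moreover have "s_bot (m_iso (comp_map X Y Z N M) A) = idn (ctx Z) (fob ?F (fob (proj X) A))"
    if A: "A \<in> obs (ty X)" for A
  proof -
    let ?x = "fob (m_ctx M) (fob (proj X) A)"
    have x: "?x \<in> obs (ctx Y)" "fob (proj X) A \<in> obs (ctx X)"
      using M.m_ctx.fob_obs M.source.fob_obs[OF A] by auto
    have "m_iso M A \<in> arrs (arrow_cat (ctx Y))"
      using M.m_iso_hom[OF A] by (simp add: hom_def)
    then have "s_bot (m_iso (comp_map X Y Z N M) A) =
        cmp (ctx Z) (far (m_ctx N) (idn (ctx Y) ?x)) (idn (ctx Z) (fob (m_ctx N) ?x))"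
      using A M.m_iso_over[OF A] N.m_iso_over[OF M.m_ty.fob_obs[OF A]] M.proj_m_ty[OF A]
      by (cases "m_iso M A") (simp add: comp_map_def)
    then show ?thesis
      using x N.m_ctx.far_idn[OF x(1)]
        N.target.target.cmp_idn_left[OF N.target.target.idn_in[OF N.m_ctx.fob_obs[OF x(1)]]] by simp
  qed
  moreover have "m_emp (comp_map X Y Z N M) \<in> hom (ctx Z) (fob ?F (emp X)) (emp Z) \<and>
      iso (ctx Z) (m_emp (comp_map X Y Z N M))"
    using N.target.target.cmp_in[OF N.m_ctx.far_hom[OF M.m_emp_in] N.m_emp_in]
      N.target.target.iso_cmp[OF N.m_ctx.far_hom[OF M.m_emp_in] N.m_emp_in
        N.m_ctx.far_iso[OF M.m_emp_in M.m_emp_iso] N.m_emp_iso]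
      M.source.emp_terminal by (simp add: comp_map_def terminal_def)
  moreover have "cartesian (ty Z) (ctx Z) (proj Z) (far ?G h)"
    if "cartesian (ty X) (ctx X) (proj X) h" for h
    using that N.m_ty_cartesian[OF M.m_ty_cartesian[OF that]] by (simp add: cartesian_def)
  ultimately show ?thesis
    using F G over M.source.contextual_comp_cat_axioms N.target.contextual_comp_cat_axioms
      M.source.comprehension_category_axioms N.target.comprehension_category_axioms
    by (intro cxl_pseudo_map.intro cxl_pseudo_map_axioms.intro pseudo_map.intro
        pseudo_map_axioms.intro) (auto simp: comp_map_def)
qed

text \<open>The induced functor of arrow categories preserves identities, so the pasted comparison
  of two strict maps is an identity again.\<close>

lemma strict_comp_map:
  assumes "cxl_strict_map X Y M" "cxl_strict_map Y Z N"
  shows "cxl_strict_map X Z (comp_map X Y Z N M)"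
proof -
  interpret M: cxl_strict_map X Y M by fact
  interpret N: cxl_strict_map Y Z N by fact
  interpret NM: cxl_pseudo_map X Z "comp_map X Y Z N M"
    using pseudo_comp_map[OF M.cxl_pseudo_map_axioms N.cxl_pseudo_map_axioms] .
  note a = comp_functor_assoc[OF M.m_ty.cat_functor_axioms]
    comp_functor_assoc[OF M.source.compr.cat_functor_axioms]
  have compr: "comp_functor (ty X) (compr Z) (comp_functor (ty X) (m_ty N) (m_ty M)) =
      comp_functor (ty X) (arrow_functor (ctx X) (comp_functor (ctx X) (m_ctx N) (m_ctx M))) (compr
          X)"
    by (metis a N.compr_strict M.compr_strict
        arrow_functor_comp[OF M.m_ctx.cat_functor_axioms N.m_ctx.cat_functor_axioms])
  show ?thesis
  proof
    fix A assume A: "A \<in> obs (ty X)"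
    have MA: "fob (m_ty M) A \<in> obs (ty Y)" using M.m_ty.fob_obs[OF A] .
    let ?c = "fob (compr Y) (fob (m_ty M) A)"
    have c: "?c \<in> obs (arrow_cat (ctx Y))" using M.target.compr.fob_obs[OF MA] .
    interpret AN: cat_functor "arrow_cat (ctx Y)" "arrow_cat (ctx Z)" "arrow_functor (ctx Y) (m_ctx
        N)"
      using arrow_functor[OF N.m_ctx.cat_functor_axioms] .
    have "fob (compr Z) (fob (m_ty N) (fob (m_ty M) A)) = fob (arrow_functor (ctx Y) (m_ctx N)) ?c"
      using arg_cong[OF N.compr_strict, of "\<lambda>F. fob F (fob (m_ty M) A)"] MA by simp
    moreover have "m_iso (comp_map X Y Z N M) A = cmp (arrow_cat (ctx Z))
        (far (arrow_functor (ctx Y) (m_ctx N)) (idn (arrow_cat (ctx Y)) ?c))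
        (idn (arrow_cat (ctx Z)) (fob (compr Z) (fob (m_ty N) (fob (m_ty M) A))))"
      using A M.m_iso_strict[OF A] N.m_iso_strict[OF MA] by (simp add: comp_map_def del:
          idn_arrow_cat cmp_arrow_cat)
    ultimately show "m_iso (comp_map X Y Z N M) A =
        idn (arrow_cat (ctx Z)) (fob (compr Z) (fob (m_ty (comp_map X Y Z N M)) A))"
      using AN.far_idn[OF c] N.target.compr.target.cmp_idn_left[OF N.target.compr.target.idn_in[OF
          AN.fob_obs[OF c]]] A
      by (simp add: comp_map_def del: idn_arrow_cat cmp_arrow_cat)
  next
    have e: "emp X \<in> obs (ctx X)" "emp Y \<in> obs (ctx Y)"
      using M.source.emp_terminal M.target.emp_terminal by (simp_all add: terminal_def)
    then show "fob (m_ctx (comp_map X Y Z N M)) (emp X) = emp Z"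
      using M.emp_strict N.emp_strict by (simp add: comp_map_def)
    show "m_emp (comp_map X Y Z N M) = idn (ctx Z) (emp Z)"
      using M.m_emp_strict N.m_emp_strict N.m_ctx.far_idn[OF e(2)] N.emp_strict
        N.target.target.cmp_idn_left[OF N.target.target.idn_in] N.target.emp_terminal
      by (simp add: comp_map_def terminal_def)
  qed (simp add: comp_map_def compr)
qed

lemma comp_map_id_left:
  assumes "cxl_pseudo_map X Y M"
  shows "comp_map X Y Y (id_map Y) M = M"
proof -
  interpret cxl_pseudo_map X Y M by fact
  \<comment> \<open>Equality of records needs equality of functions at every argument; away from the
    types both sides are \<open>undefined\<close>, because \<open>m_iso\<close> is
    extensional.\<close>
  have "m_iso (comp_map X Y Y (id_map Y) M) A = m_iso M A" for A
  proof (cases "A \<in> obs (ty X)")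
    case True
    let ?c = "fob (compr Y) (fob (m_ty M) A)"
    have "m_iso M A \<in> hom (arrow_cat (ctx Y)) ?c (far (m_ctx M) (fob (compr X) A))"
      using m_iso_hom[OF True] .
    moreover from this have "m_iso M A \<in> arrs (arrow_cat (ctx Y))"
      by (simp add: hom_def)
    ultimately show ?thesis
      using True target.compr.target.cmp_idn_right m_ty.fob_obs[OF True]
      by (simp add: comp_map_def id_map_def arrow_functor_id[OF target.target.category_axioms]
          del: idn_arrow_cat cmp_arrow_cat far_arrow_functor)
  next
    case False
    then show ?thesis
      using m_iso.component_ext by (simp add: comp_map_def extensional_def)
  qed
  moreover have "m_emp (comp_map X Y Y (id_map Y) M) = m_emp M"
    using m_emp_in target.target.cmp_idn_left[OF m_emp_in]
    by (simp add: comp_map_def id_map_def hom_iff)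
  moreover have "m_ctx (comp_map X Y Y (id_map Y) M) = m_ctx M"
    "m_ty (comp_map X Y Y (id_map Y) M) = m_ty M"
    using comp_functor_id_left[OF m_ctx.cat_functor_axioms] comp_functor_id_left[OF
        m_ty.cat_functor_axioms]
    by (simp_all add: comp_map_def id_map_def)
  ultimately show ?thesis
    by (simp add: fun_eq_iff)
qed

lemma comp_map_id_right:
  assumes "cxl_pseudo_map X Y M"
  shows "comp_map X X Y M (id_map X) = M"
proof -
  interpret cxl_pseudo_map X Y M by fact
  interpret AM: cat_functor "arrow_cat (ctx X)" "arrow_cat (ctx Y)" "arrow_functor (ctx X) (m_ctx
      M)"
    using arrow_functor[OF m_ctx.cat_functor_axioms] .
  have "m_iso (comp_map X X Y M (id_map X)) A = m_iso M A" for A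
  proof (cases "A \<in> obs (ty X)")
    case True
    have c: "fob (compr X) A \<in> obs (arrow_cat (ctx X))"
      using source.compr.fob_obs[OF True] .
    then show ?thesis
      using True AM.far_idn[OF c] target.compr.target.cmp_idn_left[OF m_iso_hom[OF True]]
      by (simp add: comp_map_def id_map_def del: idn_arrow_cat cmp_arrow_cat far_arrow_functor)
  next
    case False
    then show ?thesis
      using m_iso.component_ext by (simp add: comp_map_def extensional_def)
  qed
  moreover have "m_emp (comp_map X X Y M (id_map X)) = m_emp M"
    using m_emp_in target.target.cmp_idn_right[OF m_emp_in] m_ctx.far_idn source.emp_terminal
    by (simp add: comp_map_def id_map_def terminal_def)
  moreover have "m_ctx (comp_map X X Y M (id_map X)) = m_ctx M"
    "m_ty (comp_map X X Y M (id_map X)) = m_ty M"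
    using comp_functor_id_right[OF m_ctx.cat_functor_axioms] comp_functor_id_right[OF
        m_ty.cat_functor_axioms]
    by (simp_all add: comp_map_def id_map_def)
  ultimately show ?thesis
    by (simp add: fun_eq_iff)
qed

lemma comp_map_assoc:
  assumes "cxl_pseudo_map W X L" "cxl_pseudo_map X Y M" "cxl_pseudo_map Y Z N"
  shows "comp_map W Y Z N (comp_map W X Y M L) = comp_map W X Z (comp_map X Y Z N M) L"
proof -
  interpret L: cxl_pseudo_map W X L by fact
  interpret M: cxl_pseudo_map X Y M by fact
  interpret N: cxl_pseudo_map Y Z N by fact
  interpret AM: cat_functor "arrow_cat (ctx X)" "arrow_cat (ctx Y)" "arrow_functor (ctx X) (m_ctx
      M)"
    using arrow_functor[OF M.m_ctx.cat_functor_axioms] .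
  interpret AN: cat_functor "arrow_cat (ctx Y)" "arrow_cat (ctx Z)" "arrow_functor (ctx Y) (m_ctx
      N)"
    using arrow_functor[OF N.m_ctx.cat_functor_axioms] .
  have "m_iso (comp_map W Y Z N (comp_map W X Y M L)) A =
      m_iso (comp_map W X Z (comp_map X Y Z N M) L) A" for A
  proof (cases "A \<in> obs (ty W)")
    case True
    let ?B = "fob (m_ty L) A" and ?C = "fob (m_ty M) (fob (m_ty L) A)"
    have B: "?B \<in> obs (ty X)" and C: "?C \<in> obs (ty Y)"
      using L.m_ty.fob_obs[OF True] M.m_ty.fob_obs by auto
    have l: "m_iso L A \<in> hom (arrow_cat (ctx X)) (fob (compr X) ?B) (far (m_ctx L) (fob (compr
        W) A))"
      using L.m_iso_hom[OF True] .
    have m: "m_iso M ?B \<in> hom (arrow_cat (ctx Y)) (fob (compr Y) ?C)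
        (fob (arrow_functor (ctx X) (m_ctx M)) (fob (compr X) ?B))"
      using M.m_iso_hom[OF B] L.target.compr.fob_obs[OF B] by simp
    have n: "m_iso N ?C \<in> hom (arrow_cat (ctx Z)) (fob (compr Z) (fob (m_ty N) ?C))
        (fob (arrow_functor (ctx Y) (m_ctx N)) (fob (compr Y) ?C))"
      using N.m_iso_hom[OF C] M.target.compr.fob_obs[OF C] by simp
    have "m_iso L A \<in> arrs (arrow_cat (ctx X))" using l by (simp add: hom_def)
    then show ?thesis
      using True B AN.far_cmp[OF m AM.far_hom[OF l]] 
        N.target.compr.target.cmp_assoc[OF n AN.far_hom[OF m] AN.far_hom[OF AM.far_hom[OF l]]]
      by (simp add: comp_map_def arrow_functor_comp[OF M.m_ctx.cat_functor_axioms
          N.m_ctx.cat_functor_axioms]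
          del: idn_arrow_cat cmp_arrow_cat far_arrow_functor)
  next
    case False
    then show ?thesis
      by (simp add: comp_map_def)
  qed
  moreover have "m_emp (comp_map W Y Z N (comp_map W X Y M L)) =
      m_emp (comp_map W X Z (comp_map X Y Z N M) L)"
    using N.m_ctx.far_cmp[OF M.m_ctx.far_hom[OF L.m_emp_in] M.m_emp_in]
      N.target.target.cmp_assoc[OF N.m_ctx.far_hom[OF M.m_ctx.far_hom[OF L.m_emp_in]]
        N.m_ctx.far_hom[OF M.m_emp_in] N.m_emp_in] L.m_emp_in
    by (simp add: comp_map_def hom_iff)
  moreover have "m_ctx (comp_map W Y Z N (comp_map W X Y M L)) =
      m_ctx (comp_map W X Z (comp_map X Y Z N M) L)"
    "m_ty (comp_map W Y Z N (comp_map W X Y M L)) = m_ty (comp_map W X Z (comp_map X Y Z N M) L)"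
    using comp_functor_assoc[OF L.m_ctx.cat_functor_axioms] comp_functor_assoc[OF
        L.m_ty.cat_functor_axioms]
    by (simp_all add: comp_map_def)
  ultimately show ?thesis
    by (simp add: fun_eq_iff)
qed

section \<open>Identities and the two compositions of transformations\<close>

lemma transformation_id:
  assumes "cxl_pseudo_map X Y M"
  shows "transformation X Y (id_cell X Y M)"
proof -
  interpret cxl_pseudo_map X Y M by fact
  have "nat_trans (ctx X) (ctx Y) (m_ctx M) (m_ctx M) (c_ctx (id_cell X Y M))"
    "nat_trans (ty X) (ty Y) (m_ty M) (m_ty M) (c_ty (id_cell X Y M))"
    using nat_iso_id[OF m_ctx.cat_functor_axioms] nat_iso_id[OF m_ty.cat_functor_axioms]
    by (simp_all add: id_cell_def nat_iso_iff)
  moreover have "transformation_axioms X Y (id_cell X Y M)"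
  proof
    fix A assume A: "A \<in> obs (ty X)"
    have B: "fob (m_ty M) A \<in> obs (ty Y)" using m_ty.fob_obs[OF A] .
    show "far (proj Y) (c_ty (id_cell X Y M) A) = c_ctx (id_cell X Y M) (fob (proj X) A)"
      using A target.far_idn[OF B] proj_m_ty[OF A] source.fob_obs[OF A] by (simp add: id_cell_def)
    show "cmp (ctx Y) (s_top (m_iso (c_trg (id_cell X Y M)) A))
          (s_top (far (compr Y) (c_ty (id_cell X Y M) A))) =
        cmp (ctx Y) (c_ctx (id_cell X Y M) (ext X A)) (s_top (m_iso (c_src (id_cell X Y M)) A))"
      using A target.compr_top_idn[OF B] target.target.cmp_idn_left[OF m_iso_top[OF A]]
        target.target.cmp_idn_right[OF m_iso_top[OF A]] source.ext_obs[OF A] by (simp add: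
            id_cell_def)
  next
    show "cmp (ctx Y) (m_emp (c_trg (id_cell X Y M))) (c_ctx (id_cell X Y M) (emp X)) =
        m_emp (c_src (id_cell X Y M))"
      using source.emp_terminal target.target.cmp_idn_right[OF m_emp_in]
      by (simp add: id_cell_def terminal_def)
  qed
  ultimately show ?thesis
    using cxl_pseudo_map_axioms by (simp add: transformation_def id_cell_def)
qed

lemma transformation_vcomp:
  assumes "transformation X Y \<alpha>" "transformation X Y \<beta>" "c_trg \<alpha> = c_src
      \<beta>"
  shows "transformation X Y (vcomp_cell X Y \<beta> \<alpha>)"
proof -
  interpret a: transformation X Y \<alpha> by fact
  interpret b: transformation X Y \<beta> by fact
  let ?c = "vcomp_cell X Y \<beta> \<alpha>"
  have "nat_trans (ctx X) (ctx Y) (m_ctx (c_src \<alpha>)) (m_ctx (c_trg \<beta>)) (c_ctx ?c)"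
    "nat_trans (ty X) (ty Y) (m_ty (c_src \<alpha>)) (m_ty (c_trg \<beta>)) (c_ty ?c)"
    using nat_trans_vcomp[OF a.c_ctx.nat_trans_axioms b.c_ctx.nat_trans_axioms[folded assms(3)]]
      nat_trans_vcomp[OF a.c_ty.nat_trans_axioms b.c_ty.nat_trans_axioms[folded assms(3)]]
    by (simp_all add: vcomp_cell_def)
  moreover have "transformation_axioms X Y ?c"
  proof
    fix A assume A: "A \<in> obs (ty X)"
    note ca = a.c_ty.component_in[OF A] and cb = b.c_ty.component_in[OF A, folded assms(3)]
    note xa = a.c_ctx.component_in[OF a.source.source.ext_obs[OF A]]
      and xb = b.c_ctx.component_in[OF a.source.source.ext_obs[OF A], folded assms(3)]
    note ta = a.source.target.compr_top[OF ca] and tb = a.source.target.compr_top[OF cb]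
    note assoc = a.source.target.target.cmp_assoc
    show "far (proj Y) (c_ty ?c A) = c_ctx ?c (fob (proj X) A)"
      using A a.source.target.far_cmp[OF ca cb] a.c_ty_over[OF A] b.c_ty_over[OF A]
        a.source.source.fob_obs[OF A] by (simp add: vcomp_cell_def)
    have "cmp (ctx Y) (s_top (m_iso (c_trg \<beta>) A))
        (cmp (ctx Y) (s_top (far (compr Y) (c_ty \<beta> A))) (s_top (far (compr Y) (c_ty \<alpha>
            A)))) =
      cmp (ctx Y) (cmp (ctx Y) (c_ctx \<beta> (ext X A)) (s_top (m_iso (c_trg \<alpha>) A)))
        (s_top (far (compr Y) (c_ty \<alpha> A)))"
      using assoc[OF ta tb b.target.m_iso_top[OF A]] b.c_compr[OF A] assms(3) by simp
    also have "\<dots> = cmp (ctx Y) (cmp (ctx Y) (c_ctx \<beta> (ext X A)) (c_ctx \<alpha> (ext X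
        A)))
        (s_top (m_iso (c_src \<alpha>) A))"
      using assoc[OF ta a.target.m_iso_top[OF A] xb] assoc[OF a.source.m_iso_top[OF A] xa xb]
        a.c_compr[OF A] by simp
    finally show "cmp (ctx Y) (s_top (m_iso (c_trg ?c) A)) (s_top (far (compr Y) (c_ty ?c A))) =
        cmp (ctx Y) (c_ctx ?c (ext X A)) (s_top (m_iso (c_src ?c) A))"
      using A a.source.target.compr_top_cmp[OF ca cb] a.source.source.ext_obs[OF A]
      by (simp add: vcomp_cell_def)
  next
    have e: "emp X \<in> obs (ctx X)" using a.source.source.emp_terminal by (simp add: terminal_def)
    show "cmp (ctx Y) (m_emp (c_trg ?c)) (c_ctx ?c (emp X)) = m_emp (c_src ?c)"
      using e a.source.target.target.cmp_assoc[OF a.c_ctx.component_in[OF e]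
          b.c_ctx.component_in[OF e, folded assms(3)] b.target.m_emp_in]
        a.c_emp b.c_emp assms(3) by (simp add: vcomp_cell_def)
  qed
  ultimately show ?thesis
    using a.source.cxl_pseudo_map_axioms b.target.cxl_pseudo_map_axioms
    by (simp add: transformation_def vcomp_cell_def)
qed

text \<open>Each component is the image of \<alpha> under the source of \<beta>, followed by \<beta>
  at the target of \<alpha>. It is thus a vertical composite of two whiskerings, which gives
  naturality; compatibility with comprehension and with the empty context has to be pasted.\<close>

lemma transformation_hcomp:
  assumes "transformation X Y \<alpha>" "transformation Y Z \<beta>"
  shows "transformation X Z (hcomp_cell X Y Z \<beta> \<alpha>)"
proof -
  interpret a: transformation X Y \<alpha> by fact
  interpret b: transformation Y Z \<beta> by fact
  let ?c = "hcomp_cell X Y Z \<beta> \<alpha>"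
  let ?M = "comp_map X Y Z (c_src \<beta>) (c_src \<alpha>)" and ?N = "comp_map X Y Z (c_trg
      \<beta>) (c_trg \<alpha>)"
  interpret M: cxl_pseudo_map X Z ?M
    using pseudo_comp_map[OF a.source.cxl_pseudo_map_axioms b.source.cxl_pseudo_map_axioms] .
  interpret N: cxl_pseudo_map X Z ?N
    using pseudo_comp_map[OF a.target.cxl_pseudo_map_axioms b.target.cxl_pseudo_map_axioms] .
  have "nat_trans (ctx X) (ctx Z) (m_ctx ?M) (m_ctx ?N) (c_ctx ?c)"
    using nat_trans_vcomp[OF
        nat_trans_whisker_left[OF a.c_ctx.nat_trans_axioms b.source.m_ctx.cat_functor_axioms]
        nat_trans_whisker_right[OF b.c_ctx.nat_trans_axioms a.target.m_ctx.cat_functor_axioms]]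
    by (simp add: hcomp_cell_def comp_map_def cong: restrict_cong)
  moreover have "nat_trans (ty X) (ty Z) (m_ty ?M) (m_ty ?N) (c_ty ?c)"
    using nat_trans_vcomp[OF
        nat_trans_whisker_left[OF a.c_ty.nat_trans_axioms b.source.m_ty.cat_functor_axioms]
        nat_trans_whisker_right[OF b.c_ty.nat_trans_axioms a.target.m_ty.cat_functor_axioms]]
    by (simp add: hcomp_cell_def comp_map_def cong: restrict_cong)
  moreover have "transformation_axioms X Z ?c"
  proof
    fix A assume A: "A \<in> obs (ty X)"
    let ?F = "c_src \<alpha>" and ?G = "c_trg \<alpha>" and ?F' = "c_src \<beta>" and ?G' = "c_trg
        \<beta>"
    have FA: "fob (m_ty ?F) A \<in> obs (ty Y)" and GA: "fob (m_ty ?G) A \<in> obs (ty Y)"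
      using a.source.m_ty.fob_obs[OF A] a.target.m_ty.fob_obs[OF A] by auto
    have eA: "ext X A \<in> obs (ctx X)" using a.source.source.ext_obs[OF A] .
    note assoc = b.source.target.target.cmp_assoc
    note ca = a.c_ty.component_in[OF A]
    have pA: "fob (proj X) A \<in> obs (ctx X)" using a.source.source.fob_obs[OF A] .
    show "far (proj Z) (c_ty ?c A) = c_ctx ?c (fob (proj X) A)"
      using A pA b.source.target.far_cmp[OF b.source.m_ty.far_hom[OF ca] b.c_ty.component_in[OF GA]]
        b.c_ty_over[OF GA] a.target.proj_m_ty[OF A] a.c_ty_over[OF A]
        b.source.proj_m_ty_far[of "c_ty \<alpha> A"] ca
      by (simp add: hcomp_cell_def hom_iff)
    let ?a = "c_ctx \<alpha> (ext X A)" and ?b = "c_ctx \<beta> (fob (m_ctx ?G) (ext X A))"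
    let ?g = "s_top (m_iso ?G A)" and ?f = "s_top (m_iso ?F A)"
    let ?g' = "s_top (m_iso ?G' (fob (m_ty ?G) A))" and ?f' = "s_top (m_iso ?F' (fob (m_ty ?F) A))"
    let ?f'' = "s_top (m_iso ?F' (fob (m_ty ?G) A))"
    let ?ta = "s_top (far (compr Y) (c_ty \<alpha> A))"
    let ?tb = "s_top (far (compr Z) (c_ty \<beta> (fob (m_ty ?G) A)))"
    let ?tfa = "s_top (far (compr Z) (far (m_ty ?F') (c_ty \<alpha> A)))"
    note g = a.target.m_iso_top[OF A] and f = a.source.m_iso_top[OF A]
    note g' = b.target.m_iso_top[OF GA] and f' = b.source.m_iso_top[OF FA]
      and f'' = b.source.m_iso_top[OF GA]
    note ta = a.source.target.compr_top[OF ca]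
      and tb = b.source.target.compr_top[OF b.c_ty.component_in[OF GA]]
      and tfa = b.source.target.compr_top[OF b.source.m_ty.far_hom[OF ca]]
    note xa = a.c_ctx.component_in[OF eA]
      and xb = b.c_ctx.component_in[OF a.target.m_ctx.fob_obs[OF eA]]
      and xb' = b.c_ctx.component_in[OF a.source.target.ext_obs[OF GA]]
    note Fxa = b.source.m_ctx.far_hom[OF xa] and Fta = b.source.m_ctx.far_hom[OF ta]
      and Fg = b.source.m_ctx.far_hom[OF g] and Gg = b.target.m_ctx.far_hom[OF g]
      and Ff = b.source.m_ctx.far_hom[OF f]
    note cmp' = b.source.target.target.cmp_in
    let ?K = "cmp (ctx Z)" and ?F'g = "far (m_ctx ?F') ?g"
    \<comment> \<open>Four squares are pasted: compatibility of \<beta> at the type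
      \<open>?G A\<close>, naturality of the comparison of \<open>?F'\<close> at the type component
      of \<alpha>, naturality of \<beta> at \<open>?g\<close>, and the image under
      \<open>?F'\<close> of the compatibility of \<alpha> at \<open>A\<close>.\<close>
    have "?K (?K (far (m_ctx ?G') ?g) ?g') (?K ?tb ?tfa) =
        ?K (far (m_ctx ?G') ?g) (?K (?K ?g' ?tb) ?tfa)"
      using assoc[OF cmp'[OF tfa tb] g' Gg] assoc[OF tfa tb g'] by simp
    also have "\<dots> = ?K (far (m_ctx ?G') ?g) (?K (c_ctx \<beta> (ext Y (fob (m_ty ?G) A))) (?K
        ?f'' ?tfa))"
      using b.c_compr[OF GA] assoc[OF tfa f'' xb'] by simp
    also have "\<dots> = ?K (?K ?b ?F'g) (?K (far (m_ctx ?F') ?ta) ?f')"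
      using b.source.m_iso_natural[OF ca] b.c_ctx.naturality[OF g]
        assoc[OF cmp'[OF f' Fta] xb' Gg] by simp
    also have "\<dots> = ?K ?b (?K (?K ?F'g (far (m_ctx ?F') ?ta)) ?f')"
      using assoc[OF cmp'[OF f' Fta] Fg xb] assoc[OF f' Fta Fg] by simp
    also have "\<dots> = ?K ?b (?K (?K (far (m_ctx ?F') ?a) (far (m_ctx ?F') ?f)) ?f')"
      using b.source.m_ctx.far_cmp[OF ta g] b.source.m_ctx.far_cmp[OF f xa] a.c_compr[OF A] by simp
    also have "\<dots> = ?K (?K ?b (far (m_ctx ?F') ?a)) (?K (far (m_ctx ?F') ?f) ?f')"
      using assoc[OF f' Ff Fxa] assoc[OF cmp'[OF f' Ff] Fxa xb] by simp
    finally have "?K (?K (far (m_ctx ?G') ?g) ?g') (?K ?tb ?tfa) = \<dots>" .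
    moreover have "m_iso ?F A \<in> arrs (arrow_cat (ctx Y))" "m_iso ?G A \<in> arrs (arrow_cat
        (ctx Y))"
      using a.source.m_iso_hom[OF A] a.target.m_iso_hom[OF A] by (simp_all add: hom_def)
    ultimately show "cmp (ctx Z) (s_top (m_iso (c_trg ?c) A)) (s_top (far (compr Z) (c_ty ?c A))) =
        cmp (ctx Z) (c_ctx ?c (ext X A)) (s_top (m_iso (c_src ?c) A))"
      using A eA b.source.target.compr_top_cmp[OF b.source.m_ty.far_hom[OF ca]
          b.c_ty.component_in[OF GA]]
      by (cases "m_iso ?F A"; cases "m_iso ?G A") (simp add: hcomp_cell_def comp_map_def)
  next
    have e: "emp X \<in> obs (ctx X)" "emp Y \<in> obs (ctx Y)"
      using a.source.source.emp_terminal a.source.target.emp_terminal by (simp_all add: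
          terminal_def)
    let ?K = "cmp (ctx Z)"
    note assoc = b.source.target.target.cmp_assoc and cmp' = b.source.target.target.cmp_in
    note xa = a.c_ctx.component_in[OF e(1)] and xb = b.c_ctx.component_in[OF e(2)]
      and xb' = b.c_ctx.component_in[OF a.target.m_ctx.fob_obs[OF e(1)]]
    note Fxa = b.source.m_ctx.far_hom[OF xa] and Fg = b.source.m_ctx.far_hom[OF a.target.m_emp_in]
      and Gg = b.target.m_ctx.far_hom[OF a.target.m_emp_in]
    let ?b = "c_ctx \<beta> (fob (m_ctx (c_trg \<alpha>)) (emp X))"
    let ?Fa = "far (m_ctx (c_src \<beta>)) (c_ctx \<alpha> (emp X))"
    \<comment> \<open>At the empty context the pasting uses naturality of \<beta> at the isomorphism
      \<open>m_emp\<close> of the target of \<alpha>, and then the conditions on \<beta> and on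
      \<alpha>.\<close>
    have "?K (?K (m_emp (c_trg \<beta>)) (far (m_ctx (c_trg \<beta>)) (m_emp (c_trg \<alpha>))))
        (?K ?b ?Fa) =
        ?K (m_emp (c_trg \<beta>)) (?K (?K (far (m_ctx (c_trg \<beta>)) (m_emp (c_trg \<alpha>)))
            ?b) ?Fa)"
      using assoc[OF cmp'[OF Fxa xb'] Gg b.target.m_emp_in] assoc[OF Fxa xb' Gg] by simp
    also have "\<dots> = ?K (m_emp (c_trg \<beta>)) (?K (c_ctx \<beta> (emp Y))
        (?K (far (m_ctx (c_src \<beta>)) (m_emp (c_trg \<alpha>))) ?Fa))"
      using b.c_ctx.naturality[OF a.target.m_emp_in] assoc[OF Fxa Fg xb] by simp
    also have "\<dots> = ?K (m_emp (c_src \<beta>)) (far (m_ctx (c_src \<beta>)) (m_emp (c_src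
        \<alpha>)))"
      using assoc[OF cmp'[OF Fxa Fg] xb b.target.m_emp_in] b.c_emp a.c_emp
        b.source.m_ctx.far_cmp[OF xa a.target.m_emp_in] by simp
    finally show "cmp (ctx Z) (m_emp (c_trg ?c)) (c_ctx ?c (emp X)) = m_emp (c_src ?c)"
      using e by (simp add: hcomp_cell_def comp_map_def)
  qed
  ultimately show ?thesis
    using M.cxl_pseudo_map_axioms N.cxl_pseudo_map_axioms
    by (simp add: transformation_def hcomp_cell_def)
qed

section \<open>Discrete contextual comprehension categories\<close>

context contextual_comp_cat
begin

lemma emp_obs: "emp X \<in> obs (ctx X)"
  using emp_terminal by (simp add: terminal_def)

lemma iterated_ext_obs: "iterated_ext X As \<Gamma> \<Longrightarrow> \<Gamma> \<in> obs (ctx X)"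
  by (induction rule: iterated_ext.induct) (auto simp: emp_obs ext_obs)

lemma iterated_ext_unique: "iterated_ext X As \<Gamma> \<Longrightarrow> iterated_ext X Bs \<Gamma>
    \<Longrightarrow> As = Bs"
  using unique_iterated_ext iterated_ext_obs by blast

text \<open>Every context is the end of a derivation of \<open>iterated_ext\<close>, so induction on
  derivations becomes induction on contexts, with no list in sight.\<close>

lemma ctx_induct [consumes 1, case_names empty extend]:
  assumes "\<Gamma> \<in> obs (ctx X)" "P (emp X)"
    and "\<And>A. A \<in> obs (ty X) \<Longrightarrow> P (fob (proj X) A) \<Longrightarrow> P (ext
        X A)"
  shows "P \<Gamma>"
proof -
  obtain As where "iterated_ext X As \<Gamma>" using unique_iterated_ext assms(1) by blast
  then show ?thesis
    by (induction rule: iterated_ext.induct) (use assms in auto)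
qed

lemma iterated_ext_snoc:
  assumes "A \<in> obs (ty X)" "iterated_ext X As (fob (proj X) A)"
  shows "iterated_ext X (As @ [A]) (ext X A)"
  using assms by (auto intro: iterated_ext.extend)

lemma obtain_iterated_ext:
  assumes "A \<in> obs (ty X)"
  obtains As where "iterated_ext X As (fob (proj X) A)" "iterated_ext X (As @ [A]) (ext X A)"
proof -
  obtain As where "iterated_ext X As (fob (proj X) A)"
    using unique_iterated_ext[OF fob_obs[OF assms]] by blast
  then show thesis using that iterated_ext_snoc[OF assms] by simp
qed

text \<open>The empty context has the empty list as its unique expression, while an extension has
  one ending in \<open>A\<close>.\<close>

lemma ext_ne_emp:
  assumes "A \<in> obs (ty X)"
  shows "ext X A \<noteq> emp X"
proof
  assume e: "ext X A = emp X"
  obtain As where "iterated_ext X (As @ [A]) (ext X A)"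
    using obtain_iterated_ext[OF assms] .
  then show False
    using iterated_ext_unique[OF iterated_ext.empty] e by fastforce
qed

text \<open>The type is the last entry of the unique list that expresses the extended
  context.\<close>

lemma ext_inj:
  assumes "A \<in> obs (ty X)" "B \<in> obs (ty X)" "ext X A = ext X B"
  shows "A = B"
proof -
  obtain As where "iterated_ext X (As @ [A]) (ext X A)"
    using obtain_iterated_ext[OF assms(1)] .
  moreover obtain Bs where "iterated_ext X (Bs @ [B]) (ext X B)"
    using obtain_iterated_ext[OF assms(2)] .
  ultimately show ?thesis
    using iterated_ext_unique assms(3) by fastforce
qed

lemma ext_surj:
  assumes "\<Gamma> \<in> obs (ctx X)" "\<Gamma> \<noteq> emp X"
  obtains A where "A \<in> obs (ty X)" "ext X A = \<Gamma>"
proof -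
  have "\<Gamma> = emp X \<or> (\<exists>A \<in> obs (ty X). ext X A = \<Gamma>)"
    using assms(1) by (induction rule: ctx_induct) auto
  then show thesis using assms(2) that by blast
qed

text \<open>Uniqueness of the expression of a context as a list is what makes definition by
  recursion on contexts legitimate; strictification builds its isomorphisms this way.\<close>

lemma ctx_recursion:
  obtains b where "b (emp X) = z" "\<And>A. A \<in> obs (ty X) \<Longrightarrow> b (ext X A) = s A
      (b (fob (proj X) A))"
proof -
  \<comment> \<open>\<open>rev\<close> moves the most recent extension to the head, where list
    recursion consumes it first.\<close>
  define b where "b \<Gamma> = rec_list z (\<lambda>A As. s A) (rev (THE As. iterated_ext X As
      \<Gamma>))" for \<Gamma>
  have the: "(THE As. iterated_ext X As \<Gamma>) = As" if "iterated_ext X As \<Gamma>" for As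
      \<Gamma>
    using that iterated_ext_unique by blast
  have "b (emp X) = z"
    using the[OF iterated_ext.empty] by (simp add: b_def)
  moreover have "b (ext X A) = s A (b (fob (proj X) A))" if A: "A \<in> obs (ty X)" for A
  proof -
    obtain As where "iterated_ext X As (fob (proj X) A)" "iterated_ext X (As @ [A]) (ext X A)"
      using obtain_iterated_ext[OF A] .
    then show ?thesis using the by (simp add: b_def)
  qed
  ultimately show thesis using that by blast
qed

end

text \<open>In a discrete fibration this is the chosen reindexing: the source of
  \<open>lift X f A\<close> is the type \<open>f\<^sup>*A\<close>. The description is meaningful for
  \<open>f\<close> with codomain the base of \<open>A\<close>.\<close>

definition lift :: "('o, 'a, 't, 'm) cxl_comp_cat \<Rightarrow> 'a \<Rightarrow> 't \<Rightarrow>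
    'm" where
  "lift X f A = (THE h. h \<in> arrs (ty X) \<and> trg (ty X) h = A \<and> far (proj X) h = f)"

context discrete_contextual_comp_cat
begin

text \<open>Uniqueness of lifts. The sources need not be compared beforehand; their equality is a
  consequence, and is repeatedly used to identify a reindexed type.\<close>

lemma lift_eqI:
  assumes "h \<in> arrs (ty X)" "h' \<in> arrs (ty X)"
    and "trg (ty X) h = trg (ty X) h'" "far (proj X) h = far (proj X) h'"
  shows "h = h'"
proof -
  have "\<exists>!k. k \<in> arrs (ty X) \<and> trg (ty X) k = trg (ty X) h \<and> far (proj X) k =
      far (proj X) h"
    using assms(1) by (intro unique_lift) (auto simp: source.trg_in far_arr far_trg)
  then show ?thesis using assms by metis
qed

lemma lift:
  assumes "A \<in> obs (ty X)" "f \<in> hom (ctx X) \<Delta> (fob (proj X) A)"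
  shows "lift X f A \<in> hom (ty X) (src (ty X) (lift X f A)) A" "far (proj X) (lift X f A) = f"
    and "fob (proj X) (src (ty X) (lift X f A)) = \<Delta>" "src (ty X) (lift X f A) \<in> obs (ty
        X)"
proof -
  have "\<exists>!h. h \<in> arrs (ty X) \<and> trg (ty X) h = A \<and> far (proj X) h = f"
    using assms by (intro unique_lift) (auto simp: hom_iff)
  then have "lift X f A \<in> arrs (ty X) \<and> trg (ty X) (lift X f A) = A \<and> far (proj X)
      (lift X f A) = f"
    unfolding lift_def by (rule theI')
  then show "lift X f A \<in> hom (ty X) (src (ty X) (lift X f A)) A" "far (proj X) (lift X f A) =
      f"
    "fob (proj X) (src (ty X) (lift X f A)) = \<Delta>" "src (ty X) (lift X f A) \<in> obs (ty X)"
    using assms far_src[of "lift X f A"] source.src_in by (auto simp: hom_iff)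
qed

lemma lift_far: "h \<in> hom (ty X) A B \<Longrightarrow> lift X (far (proj X) h) B = h"
  using lift(1,2)[of B "far (proj X) h" "fob (proj X) A"] far_hom[of h A B] source.hom_obs[of h A B]
  by (intro lift_eqI) (auto simp: hom_iff)

text \<open>The required factor is the lift of \<open>w\<close>. As a consequence, preservation of
  cartesian arrows is automatic for maps into a discrete fibration, and every comprehension square
  is a pullback.\<close>

lemma arr_cartesian:
  assumes h: "h \<in> arrs (ty X)"
  shows "cartesian (ty X) (ctx X) (proj X) h"
  unfolding cartesian_def
proof (intro conjI ballI impI h)
  fix g w
  assume g: "g \<in> arrs (ty X)" and w: "w \<in> hom (ctx X) (fob (proj X) (src (ty X) g)) (fob
      (proj X) (src (ty X) h))"
    and e: "trg (ty X) g = trg (ty X) h \<and> cmp (ctx X) (far (proj X) h) w = far (proj X) g"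
  let ?k = "lift X w (src (ty X) h)"
  note k = lift(1,2)[OF source.src_in[OF h] w]
  note hk = source.cmp_in[OF k(1) source.arr_hom[OF h]]
  \<comment> \<open>The composite and \<open>g\<close> have the same target and the same projection.
    Their equality also shows that the source of the lift is the source of \<open>g\<close>.\<close>
  have "cmp (ty X) h ?k = g"
    using hk e g far_cmp[OF k(1) source.arr_hom[OF h]] k(2)
    by (intro lift_eqI) (auto simp: hom_iff)
  moreover from this have "src (ty X) ?k = src (ty X) g"
    using hk by (simp add: hom_iff)
  ultimately show "\<exists>!k. k \<in> hom (ty X) (src (ty X) g) (src (ty X) h) \<and> far (proj
      X) k = w \<and> cmp (ty X) h k = g"
  proof (intro ex1I[of _ ?k] conjI)
    show "?k \<in> hom (ty X) (src (ty X) g) (src (ty X) h)"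
      using k(1) \<open>src (ty X) ?k = src (ty X) g\<close> by simp
    show "k' = ?k" if "k' \<in> hom (ty X) (src (ty X) g) (src (ty X) h) \<and> far (proj X) k' = w
        \<and>
        cmp (ty X) h k' = g" for k'
      using that lift_far[of k'] by auto
  qed (use k(2) in auto)
qed

text \<open>The inverse is the lift to \<open>A\<close> of the inverse of the projection of
  \<open>h\<close>.\<close>

lemma lift_iso:
  assumes "h \<in> hom (ty X) A B" "iso (ctx X) (far (proj X) h)"
  shows "iso (ty X) h"
proof -
  have A: "A \<in> obs (ty X)" and B: "B \<in> obs (ty X)" using source.hom_obs assms(1) by auto
  obtain g where g: "g \<in> hom (ctx X) (fob (proj X) B) (fob (proj X) A)"
    "cmp (ctx X) g (far (proj X) h) = idn (ctx X) (fob (proj X) A)"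
    "cmp (ctx X) (far (proj X) h) g = idn (ctx X) (fob (proj X) B)"
    using target.iso_inverse[OF far_hom[OF assms(1)] assms(2)] by metis
  note k = lift(1,2)[OF A g(1)]
  let ?k = "lift X g A"
  have hk: "cmp (ty X) h ?k = idn (ty X) B"
    using source.cmp_in[OF k(1) assms(1)] source.idn_in[OF B] far_cmp[OF k(1) assms(1)] far_idn[OF
        B] g(3) k(2)
    by (intro lift_eqI) (auto simp: hom_iff)
  \<comment> \<open>The source of a lift is not known in advance; it is read off from the composite
    being the identity of \<open>B\<close>.\<close>
  then have "src (ty X) ?k = B"
    using source.cmp_in[OF k(1) assms(1)] source.idn_in[OF B] by (simp add: hom_iff)
  with k have k': "?k \<in> hom (ty X) B A" by simp
  have "cmp (ty X) ?k h = idn (ty X) A"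
    using source.cmp_in[OF assms(1) k'] source.idn_in[OF A] far_cmp[OF assms(1) k'] far_idn[OF A]
        g(2) k(2)
    by (intro lift_eqI) (auto simp: hom_iff)
  then show ?thesis
    using source.isoI[OF assms(1) k'] hk by blast
qed

lemma compr_top_iso:
  assumes "h \<in> hom (ty X) A B" "iso (ctx X) (far (proj X) h)"
  shows "iso (ctx X) (s_top (far (compr X) h))"
  using iso_arrow_top[OF compr.far_iso[OF assms(1) lift_iso[OF assms]] compr_square[OF assms(1)]] .

end

section \<open>Rigidity and inversion of transformations\<close>

lemma cell_eqI:
  assumes "discrete_contextual_comp_cat Y" "transformation X Y \<alpha>" "transformation X Y
      \<beta>"
    and s: "c_src \<alpha> = c_src \<beta>" and t: "c_trg \<alpha> = c_trg \<beta>"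
  shows "\<alpha> = \<beta>"
proof -
  interpret Y: discrete_contextual_comp_cat Y by fact
  interpret a: transformation X Y \<alpha> by fact
  interpret b: transformation X Y \<beta> by fact
  have ty: "c_ty \<alpha> A = c_ty \<beta> A"
    if A: "A \<in> obs (ty X)" and e: "c_ctx \<alpha> (fob (proj X) A) = c_ctx \<beta> (fob (proj
        X) A)" for A
    using a.c_ty.component_in[OF A] b.c_ty.component_in[OF A] t e a.c_ty_over[OF A] b.c_ty_over[OF
        A]
    by (intro Y.lift_eqI) (auto simp: hom_iff)
  have ctx: "c_ctx \<alpha> \<Gamma> = c_ctx \<beta> \<Gamma>" if "\<Gamma> \<in> obs (ctx X)" for
      \<Gamma>
    using that
  proof (induction rule: a.source.source.ctx_induct)
    \<comment> \<open>Both components followed by the isomorphism \<open>m_emp\<close> of the target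
      map give \<open>m_emp\<close> of the source map, so the isomorphism cancels.\<close>
    case empty
    have e: "emp X \<in> obs (ctx X)" by (rule a.source.source.emp_obs)
    show ?case
      using Y.target.iso_cancel_left[OF a.c_ctx.component_in[OF e] b.c_ctx.component_in[OF e,
          folded s t]
          a.target.m_emp_in a.target.m_emp_iso] a.c_emp b.c_emp s t by simp
  next
    \<comment> \<open>The components at the base agree by induction, hence so do the type
      components. Compatibility fixes the component at the extension up to the comparison of the
      source map, which cancels on the right.\<close>
    case (extend A)
    have e: "ext X A \<in> obs (ctx X)" by (rule a.source.source.ext_obs[OF extend(1)])
    show ?case
      using Y.target.iso_cancel_right[OF a.c_ctx.component_in[OF e] b.c_ctx.component_in[OF e,
          folded s t]
          a.source.m_iso_top[OF extend(1)] a.source.m_iso_top_iso[OF extend(1)]]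
        a.c_compr[OF extend(1)] b.c_compr[OF extend(1)] s t ty[OF extend] by simp
  qed
  have "c_ctx \<alpha> = c_ctx \<beta>"
    using a.c_ctx.component_ext b.c_ctx.component_ext ctx by (rule extensionalityI)
  moreover have "c_ty \<alpha> = c_ty \<beta>"
    using a.c_ty.component_ext b.c_ty.component_ext ty ctx a.source.source.fob_obs
    by (intro extensionalityI) auto
  ultimately show ?thesis using s t by simp
qed

text \<open>Only invertibility on contexts is demanded: a type component lies over a context
  component, and arrows over isomorphisms are isomorphisms in a discrete fibration.\<close>

lemma transformation_inverse:
  assumes "discrete_contextual_comp_cat Y" "transformation X Y \<alpha>"
    and iso: "\<And>\<Gamma>. \<Gamma> \<in> obs (ctx X) \<Longrightarrow> iso (ctx Y) (c_ctx
        \<alpha> \<Gamma>)"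
  obtains \<beta> where "transformation X Y \<beta>" "c_src \<beta> = c_trg \<alpha>" "c_trg
      \<beta> = c_src \<alpha>"
proof -
  interpret Y: discrete_contextual_comp_cat Y by fact
  interpret a: transformation X Y \<alpha> by fact
  let ?F = "c_src \<alpha>" and ?G = "c_trg \<alpha>"
  have "\<exists>k. k \<in> hom (ctx Y) (fob (m_ctx ?G) \<Gamma>) (fob (m_ctx ?F) \<Gamma>) \<and>
      cmp (ctx Y) k (c_ctx \<alpha> \<Gamma>) = idn (ctx Y) (fob (m_ctx ?F) \<Gamma>) \<and>
      cmp (ctx Y) (c_ctx \<alpha> \<Gamma>) k = idn (ctx Y) (fob (m_ctx ?G) \<Gamma>)" if "\<Gamma>
          \<in> obs (ctx X)" for \<Gamma>
    using Y.target.iso_inverse[OF a.c_ctx.component_in[OF that] iso[OF that]] by metis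
  then obtain b where b: "\<And>\<Gamma>. \<Gamma> \<in> obs (ctx X) \<Longrightarrow> b \<Gamma>
      \<in> hom (ctx Y) (fob (m_ctx ?G) \<Gamma>) (fob (m_ctx ?F) \<Gamma>)"
    "\<And>\<Gamma>. \<Gamma> \<in> obs (ctx X) \<Longrightarrow> cmp (ctx Y) (b \<Gamma>) (c_ctx
        \<alpha> \<Gamma>) = idn (ctx Y) (fob (m_ctx ?F) \<Gamma>)"
    "\<And>\<Gamma>. \<Gamma> \<in> obs (ctx X) \<Longrightarrow> cmp (ctx Y) (c_ctx \<alpha>
        \<Gamma>) (b \<Gamma>) = idn (ctx Y) (fob (m_ctx ?G) \<Gamma>)"
    by metis
  have "\<exists>k. k \<in> hom (ty Y) (fob (m_ty ?G) A) (fob (m_ty ?F) A) \<and>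
      cmp (ty Y) k (c_ty \<alpha> A) = idn (ty Y) (fob (m_ty ?F) A) \<and>
      cmp (ty Y) (c_ty \<alpha> A) k = idn (ty Y) (fob (m_ty ?G) A)" if A: "A \<in> obs (ty X)" for
          A
    using Y.source.iso_inverse[OF a.c_ty.component_in[OF A] Y.lift_iso[OF a.c_ty.component_in[OF
        A]]]
      a.c_ty_over[OF A] iso[OF a.source.source.fob_obs[OF A]] by metis
  then obtain d where d: "\<And>A. A \<in> obs (ty X) \<Longrightarrow> d A \<in> hom (ty Y) (fob
      (m_ty ?G) A) (fob (m_ty ?F) A)"
    "\<And>A. A \<in> obs (ty X) \<Longrightarrow> cmp (ty Y) (d A) (c_ty \<alpha> A) = idn (ty Y)
        (fob (m_ty ?F) A)"
    "\<And>A. A \<in> obs (ty X) \<Longrightarrow> cmp (ty Y) (c_ty \<alpha> A) (d A) = idn (ty Y)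
        (fob (m_ty ?G) A)"
    by metis
  define \<beta> where "\<beta> = \<lparr>c_src = ?G, c_trg = ?F, c_ctx = restrict b (obs (ctx X)),
      c_ty = restrict d (obs (ty X))\<rparr>"
  have "nat_trans (ctx X) (ctx Y) (m_ctx ?G) (m_ctx ?F) (restrict b (obs (ctx X)))"
    using b by (intro nat_trans_inverse[OF a.c_ctx.nat_trans_axioms]) auto
  moreover have "nat_trans (ty X) (ty Y) (m_ty ?G) (m_ty ?F) (restrict d (obs (ty X)))"
    using d by (intro nat_trans_inverse[OF a.c_ty.nat_trans_axioms]) auto
  moreover have "transformation_axioms X Y \<beta>"
  proof
    fix A assume A: "A \<in> obs (ty X)"
    have pA: "fob (proj X) A \<in> obs (ctx X)" and eA: "ext X A \<in> obs (ctx X)"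
      using a.source.source.fob_obs[OF A] a.source.source.ext_obs[OF A] by auto
    have FA: "fob (m_ty ?F) A \<in> obs (ty Y)" and GA: "fob (m_ty ?G) A \<in> obs (ty Y)"
      using a.source.m_ty.fob_obs[OF A] a.target.m_ty.fob_obs[OF A] by auto
    \<comment> \<open>The inverses on types and on contexts were chosen independently. They lie over
      each other because both are right inverse to the same invertible component.\<close>
    have "cmp (ctx Y) (c_ctx \<alpha> (fob (proj X) A)) (far (proj Y) (d A)) =
        cmp (ctx Y) (c_ctx \<alpha> (fob (proj X) A)) (b (fob (proj X) A))"
      using Y.far_cmp[OF d(1)[OF A] a.c_ty.component_in[OF A]] a.c_ty_over[OF A] d(3)[OF A]
        b(3)[OF pA] Y.far_idn[OF GA] a.target.proj_m_ty[OF A] by simp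
    then have "far (proj Y) (d A) = b (fob (proj X) A)"
      using Y.target.iso_cancel_left[OF _ b(1)[OF pA] a.c_ctx.component_in[OF pA] iso[OF pA]]
        Y.far_hom[OF d(1)[OF A]] a.source.proj_m_ty[OF A] a.target.proj_m_ty[OF A] by simp
    then show "far (proj Y) (c_ty \<beta> A) = c_ctx \<beta> (fob (proj X) A)"
      using A pA by (simp add: \<beta>_def)
    let ?t = "\<lambda>h. s_top (far (compr Y) h)"
    have t: "?t (c_ty \<alpha> A) \<in> hom (ctx Y) (ext Y (fob (m_ty ?F) A)) (ext Y (fob (m_ty ?G)
        A))"
      "?t (d A) \<in> hom (ctx Y) (ext Y (fob (m_ty ?G) A)) (ext Y (fob (m_ty ?F) A))"
      using Y.compr_top[OF a.c_ty.component_in[OF A]] Y.compr_top[OF d(1)[OF A]] by auto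
    have ti: "cmp (ctx Y) (?t (d A)) (?t (c_ty \<alpha> A)) = idn (ctx Y) (ext Y (fob (m_ty ?F) A))"
      "cmp (ctx Y) (?t (c_ty \<alpha> A)) (?t (d A)) = idn (ctx Y) (ext Y (fob (m_ty ?G) A))"
      using Y.compr_top_cmp[OF d(1)[OF A] a.c_ty.component_in[OF A]] d(2,3)[OF A]
        Y.compr_top_cmp[OF a.c_ty.component_in[OF A] d(1)[OF A]]
        Y.compr_top_idn[OF FA] Y.compr_top_idn[OF GA] by auto
    have "cmp (ctx Y) (b (ext X A)) (s_top (m_iso ?G A)) = cmp (ctx Y) (s_top (m_iso ?F A)) (?t (d
        A))"
      using Y.target.iso_commute[OF t(1) Y.target.isoI[OF t ti] a.c_ctx.component_in[OF eA] iso[OF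
          eA]
        a.source.m_iso_top[OF A] a.target.m_iso_top[OF A] a.c_compr[OF A, symmetric] t(2) ti
        b(1)[OF eA] b(2)[OF eA] b(3)[OF eA]] .
    then show "cmp (ctx Y) (s_top (m_iso (c_trg \<beta>) A)) (s_top (far (compr Y) (c_ty \<beta>
        A))) =
        cmp (ctx Y) (c_ctx \<beta> (ext X A)) (s_top (m_iso (c_src \<beta>) A))"
      using A eA by (simp add: \<beta>_def)
  next
    have e: "emp X \<in> obs (ctx X)" by (rule a.source.source.emp_obs)
    \<comment> \<open>Both sides are maps into the terminal context.\<close>
    have "cmp (ctx Y) (m_emp ?F) (b (emp X)) = m_emp ?G"
      using Y.target.terminal_unique[OF Y.emp_terminal] Y.target.cmp_in[OF b(1)[OF e]
          a.source.m_emp_in]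
        a.target.m_emp_in by blast
    then show "cmp (ctx Y) (m_emp (c_trg \<beta>)) (c_ctx \<beta> (emp X)) = m_emp (c_src \<beta>)"
      using e by (simp add: \<beta>_def)
  qed
  ultimately have "transformation X Y \<beta>"
    using a.source.cxl_pseudo_map_axioms a.target.cxl_pseudo_map_axioms
    by (simp add: transformation_def \<beta>_def)
  then show thesis using that by (simp add: \<beta>_def)
qed

text \<open>
  The object map of the strict map is forced by \<open>1 \<mapsto> 1\<close> and
  \<open>\<Gamma>.A \<mapsto> G\<Gamma>.\<beta>\<^sub>\<Gamma>\<^sup>*FA\<close>, where the
      isomorphism \<open>\<beta>\<^sub>\<Gamma> : G\<Gamma> \<rightarrow> F\<Gamma>\<close> is
      built along with it.
\<close>

lemma strictification:
  assumes "discrete_contextual_comp_cat X" "discrete_contextual_comp_cat Y" "cxl_pseudo_map X Y M"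
  obtains \<alpha> where "transformation X Y \<alpha>" "cxl_strict_map X Y (c_src \<alpha>)" "c_trg
      \<alpha> = M"
    "\<And>\<Gamma>. \<Gamma> \<in> obs (ctx X) \<Longrightarrow> iso (ctx Y) (c_ctx \<alpha>
        \<Gamma>)"
proof -
  interpret X: discrete_contextual_comp_cat X by fact
  interpret Y: discrete_contextual_comp_cat Y by fact
  interpret M: cxl_pseudo_map X Y M by fact
  let ?F = "m_ctx M" and ?F' = "m_ty M"
  obtain z where z: "z \<in> hom (ctx Y) (emp Y) (fob ?F (emp X))" "iso (ctx Y) z"
    "cmp (ctx Y) (m_emp M) z = idn (ctx Y) (emp Y)"
    using Y.target.iso_inverse[OF M.m_emp_in M.m_emp_iso] by metis
  \<comment> \<open>The recursion step: \<open>r\<close>, from \<open>G\<Gamma>\<close> to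
    \<open>F\<Gamma>\<close>, is lifted to the type \<open>FA\<close>, and the top map of the
    comprehension square of the lift is followed by the comparison of \<open>M\<close>. The result
    runs from the new extended context to \<open>F(\<Gamma>.A)\<close>.\<close>
  define t where "t A r = cmp (ctx Y) (s_top (m_iso M A)) (s_top (far (compr Y) (lift Y r (fob ?F'
      A))))" for A r
  obtain b where b: "b (emp X) = z" "\<And>A. A \<in> obs (ty X) \<Longrightarrow> b (ext X A) = t
      A (b (fob (proj X) A))"
    using X.ctx_recursion[of z t] by blast
  \<comment> \<open>The type component of the transformation; its source is the type that the strict
    map assigns to \<open>A\<close>.\<close>
  define l where "l A = lift Y (b (fob (proj X) A)) (fob ?F' A)" for A
  have step: "l A \<in> hom (ty Y) (src (ty Y) (l A)) (fob ?F' A) \<and> far (proj Y) (l A) = b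
      (fob (proj X) A) \<and>
      fob (proj Y) (src (ty Y) (l A)) = src (ctx Y) (b (fob (proj X) A)) \<and>
      t A (b (fob (proj X) A)) \<in> hom (ctx Y) (ext Y (src (ty Y) (l A))) (fob ?F (ext X A))
          \<and>
      iso (ctx Y) (t A (b (fob (proj X) A)))"
    if A: "A \<in> obs (ty X)" and r: "b (fob (proj X) A) \<in> hom (ctx Y) (src (ctx Y) (b (fob
        (proj X) A))) (fob ?F (fob (proj X) A))"
      and i: "iso (ctx Y) (b (fob (proj X) A))" for A
  proof -
    have FA: "fob ?F' A \<in> obs (ty Y)" using M.m_ty.fob_obs[OF A] .
    note k = Y.lift[OF FA r[folded M.proj_m_ty[OF A]], folded l_def]
    have "iso (ctx Y) (s_top (far (compr Y) (l A)))"
      using Y.compr_top_iso[OF k(1)] k(2) i by simp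
    then show ?thesis
      using k Y.target.iso_cmp[OF Y.compr_top[OF k(1)] M.m_iso_top[OF A] _ M.m_iso_top_iso[OF A]]
        Y.target.cmp_in[OF Y.compr_top[OF k(1)] M.m_iso_top[OF A]]
      by (simp add: t_def flip: l_def)
  qed
  \<comment> \<open>The object part of the strict map is never defined separately: it is the domain
    of \<open>b \<Gamma>\<close>. The induction only has to secure the codomain and
    invertibility.\<close>
  have "b \<Gamma> \<in> hom (ctx Y) (src (ctx Y) (b \<Gamma>)) (fob ?F \<Gamma>) \<and> iso (ctx
      Y) (b \<Gamma>)"
    if "\<Gamma> \<in> obs (ctx X)" for \<Gamma>
    using that
  proof (induction rule: X.ctx_induct)
    case empty
    show ?case using z b(1) by (simp add: hom_iff)
  next
    case (extend A)
    then show ?case using step[of A] b(2)[of A] by (simp add: hom_iff)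
  qed
  then have b_hom: "b \<Gamma> \<in> hom (ctx Y) (src (ctx Y) (b \<Gamma>)) (fob ?F \<Gamma>)" and
      b_iso: "iso (ctx Y) (b \<Gamma>)"
    if "\<Gamma> \<in> obs (ctx X)" for \<Gamma> using that by blast+
  have l: "l A \<in> hom (ty Y) (src (ty Y) (l A)) (fob ?F' A)" "far (proj Y) (l A) = b (fob (proj
      X) A)"
    "fob (proj Y) (src (ty Y) (l A)) = src (ctx Y) (b (fob (proj X) A))"
    "b (ext X A) \<in> hom (ctx Y) (ext Y (src (ty Y) (l A))) (fob ?F (ext X A))"
    "b (ext X A) = cmp (ctx Y) (s_top (m_iso M A)) (s_top (far (compr Y) (l A)))"
    "iso (ty Y) (l A)"
    if A: "A \<in> obs (ty X)" for A
  proof -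
    note s = step[OF A b_hom b_iso, OF X.fob_obs[OF A] X.fob_obs[OF A]]
    show "l A \<in> hom (ty Y) (src (ty Y) (l A)) (fob ?F' A)" "far (proj Y) (l A) = b (fob (proj
        X) A)"
      "fob (proj Y) (src (ty Y) (l A)) = src (ctx Y) (b (fob (proj X) A))"
      "b (ext X A) \<in> hom (ctx Y) (ext Y (src (ty Y) (l A))) (fob ?F (ext X A))"
      "b (ext X A) = cmp (ctx Y) (s_top (m_iso M A)) (s_top (far (compr Y) (l A)))"
      using s b(2)[OF A] by (auto simp: t_def l_def)
    then show "iso (ty Y) (l A)"
      using Y.lift_iso b_iso[OF X.fob_obs[OF A]] by metis
  qed
  \<comment> \<open>Both functors of the strict map are conjugates of those of \<open>M\<close>, by
    \<open>b\<close> and by \<open>l\<close>, so \<open>b\<close> and \<open>l\<close> are natural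
    by construction.\<close>
  obtain G where G: "cat_functor (ctx X) (ctx Y) G" "\<And>\<Gamma>. \<Gamma> \<in> obs (ctx X)
      \<Longrightarrow> fob G \<Gamma> = src (ctx Y) (b \<Gamma>)"
    "\<And>f x y. f \<in> hom (ctx X) x y \<Longrightarrow> cmp (ctx Y) (b y) (far G f) = cmp (ctx
        Y) (far ?F f) (b x)"
    using functor_conjugate[of _ _ ?F b "\<lambda>\<Gamma>. src (ctx Y) (b \<Gamma>)", OF
        M.m_ctx.cat_functor_axioms b_hom b_iso]
    by auto
  obtain H where H: "cat_functor (ty X) (ty Y) H" "\<And>A. A \<in> obs (ty X) \<Longrightarrow>
      fob H A = src (ty Y) (l A)"
    "\<And>f x y. f \<in> hom (ty X) x y \<Longrightarrow> cmp (ty Y) (l y) (far H f) = cmp (ty Y)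
        (far ?F' f) (l x)"
    using functor_conjugate[of _ _ ?F' l "\<lambda>A. src (ty Y) (l A)", OF
        M.m_ty.cat_functor_axioms l(1) l(6)]
    by auto
  interpret G: cat_functor "ctx X" "ctx Y" G by (fact G(1))
  interpret H: cat_functor "ty X" "ty Y" H by (fact H(1))
  have G_ext: "fob G (ext X A) = ext Y (fob H A)" if "A \<in> obs (ty X)" for A
    using l(4)[OF that] G(2)[OF X.ext_obs[OF that]] H(2)[OF that] by (simp add: hom_iff)
  have b_hom': "b \<Gamma> \<in> hom (ctx Y) (fob G \<Gamma>) (fob ?F \<Gamma>)" if "\<Gamma> \<in>
      obs (ctx X)" for \<Gamma>
    using b_hom[OF that] G(2)[OF that] by simp
  have l_hom': "l A \<in> hom (ty Y) (fob H A) (fob ?F' A)" if "A \<in> obs (ty X)" for A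
    using l(1)[OF that] H(2)[OF that] by simp
  have proj_H: "fob (proj Y) (fob H A) = fob G (fob (proj X) A)" if "A \<in> obs (ty X)" for A
    using l(3)[OF that] G(2)[OF X.fob_obs[OF that]] H(2)[OF that] by simp
  \<comment> \<open>This equation and the ones for comprehension are verified after composing with
    the invertible \<open>b\<close>, where they turn into the corresponding properties of
    \<open>M\<close>.\<close>
  have far_proj_H: "far (proj Y) (far H h) = far G (far (proj X) h)" if h: "h \<in> hom (ty X) A B"
      for h A B
  proof -
    have A: "A \<in> obs (ty X)" and B: "B \<in> obs (ty X)" using X.source.hom_obs[OF h] by auto
    have pA: "fob (proj X) A \<in> obs (ctx X)" and pB: "fob (proj X) B \<in> obs (ctx X)"
      using X.fob_obs A B by auto
    have "cmp (ctx Y) (b (fob (proj X) B)) (far (proj Y) (far H h)) =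
        cmp (ctx Y) (b (fob (proj X) B)) (far G (far (proj X) h))"
      using Y.far_cmp[OF H.far_hom[OF h] l_hom'[OF B]] H(3)[OF h] G(3)[OF X.far_hom[OF h]]
        Y.far_cmp[OF l_hom'[OF A] M.m_ty.far_hom[OF h]] l(2)[OF A] l(2)[OF B]
        M.proj_m_ty_far[of h] h by (simp add: hom_iff)
    then show ?thesis
      using Y.target.iso_cancel_left[OF _ G.far_hom[OF X.far_hom[OF h]] b_hom'[OF pB] b_iso[OF pB]]
        Y.far_hom[OF H.far_hom[OF h]] proj_H[OF A] proj_H[OF B] by simp
  qed
  have over: "comp_functor (ty X) (proj Y) H = comp_functor (ty X) G (proj X)"
    by (rule functor_eqI[OF functor_comp[OF H(1) Y.cat_functor_axioms] functor_comp[OF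
        X.cat_functor_axioms G(1)]])
      (simp_all add: proj_H far_proj_H[OF X.source.arr_hom])
  \<comment> \<open>Here the choice of \<open>b\<close> at an extension pays off: the comprehension
    square of \<open>l A\<close>, the triangle of the comparison of \<open>M\<close>, and naturality
    of \<open>b\<close> at the projection of \<open>A\<close> give strict commutation.\<close>
  have compr_ob: "fob (compr Y) (fob H A) = far G (fob (compr X) A)" if A: "A \<in> obs (ty X)" for
      A
  proof -
    have pA: "fob (proj X) A \<in> obs (ctx X)" and FA: "fob ?F' A \<in> obs (ty Y)" and HA: "fob H
        A \<in> obs (ty Y)"
      using X.fob_obs[OF A] M.m_ty.fob_obs[OF A] H.fob_obs[OF A] by auto
    have "cmp (ctx Y) (b (fob (proj X) A)) (fob (compr Y) (fob H A)) =
        cmp (ctx Y) (fob (compr Y) (fob ?F' A)) (s_top (far (compr Y) (l A)))"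
      using Y.compr_commute[OF l_hom'[OF A]] l(2)[OF A] by simp
    also have "\<dots> = cmp (ctx Y) (far ?F (fob (compr X) A)) (b (ext X A))"
      using M.m_iso_commute[OF A] l(5)[OF A] Y.target.cmp_assoc[OF Y.compr_top[OF l(1)[OF A]]
        M.m_iso_top[OF A] M.m_ctx.far_hom[OF X.compr_hom[OF A]]] by simp
    also have "\<dots> = cmp (ctx Y) (b (fob (proj X) A)) (far G (fob (compr X) A))"
      using G(3)[OF X.compr_hom[OF A]] by simp
    finally show ?thesis
      using Y.target.iso_cancel_left[OF _ G.far_hom[OF X.compr_hom[OF A]] b_hom'[OF pA] b_iso[OF
          pA]]
        Y.compr_hom[OF HA] proj_H[OF A] G_ext[OF A] by simp
  qed
  have compr_far: "s_top (far (compr Y) (far H h)) = far G (s_top (far (compr X) h))"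
    if h: "h \<in> hom (ty X) A B" for h A B
  proof -
    have A: "A \<in> obs (ty X)" and B: "B \<in> obs (ty X)" using X.source.hom_obs[OF h] by auto
    have eB: "ext X B \<in> obs (ctx X)" using X.ext_obs[OF B] .
    let ?t = "\<lambda>h. s_top (far (compr Y) h)"
    have "cmp (ctx Y) (b (ext X B)) (?t (far H h)) =
        cmp (ctx Y) (s_top (m_iso M B)) (cmp (ctx Y) (?t (l B)) (?t (far H h)))"
      using l(5)[OF B] Y.target.cmp_assoc[OF Y.compr_top[OF H.far_hom[OF h]] Y.compr_top[OF
          l_hom'[OF B]]
          M.m_iso_top[OF B]] by simp
    also have "\<dots> = cmp (ctx Y) (s_top (m_iso M B)) (cmp (ctx Y) (?t (far ?F' h)) (?t (l A)))"
      using Y.compr_top_cmp[OF H.far_hom[OF h] l_hom'[OF B]] H(3)[OF h]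
        Y.compr_top_cmp[OF l_hom'[OF A] M.m_ty.far_hom[OF h]] by simp
    also have "\<dots> = cmp (ctx Y) (far ?F (s_top (far (compr X) h))) (b (ext X A))"
      using l(5)[OF A] M.m_iso_natural[OF h]
        Y.target.cmp_assoc[OF Y.compr_top[OF l_hom'[OF A]] Y.compr_top[OF M.m_ty.far_hom[OF h]]
            M.m_iso_top[OF B]]
        Y.target.cmp_assoc[OF Y.compr_top[OF l_hom'[OF A]] M.m_iso_top[OF A] M.m_ctx.far_hom[OF
            X.compr_top[OF h]]]
      by simp
    also have "\<dots> = cmp (ctx Y) (b (ext X B)) (far G (s_top (far (compr X) h)))"
      using G(3)[OF X.compr_top[OF h]] by simp
    finally show ?thesis
      using Y.target.iso_cancel_left[OF _ G.far_hom[OF X.compr_top[OF h]] b_hom'[OF eB] b_iso[OF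
          eB]]
        Y.compr_top[OF H.far_hom[OF h]] G_ext[OF A] G_ext[OF B] by simp
  qed
  have compr: "comp_functor (ty X) (compr Y) H = comp_functor (ty X) (arrow_functor (ctx X) G)
      (compr X)"
  proof (rule functor_eqI[OF functor_comp[OF H(1) Y.compr.cat_functor_axioms]
        functor_comp[OF X.compr.cat_functor_axioms arrow_functor[OF G(1)]]])
    fix A assume A: "A \<in> obs (ty X)"
    then show "fob (comp_functor (ty X) (compr Y) H) A =
        fob (comp_functor (ty X) (arrow_functor (ctx X) G) (compr X)) A"
      using compr_ob[OF A] X.compr.fob_obs[OF A] by simp
  next
    fix h assume a: "h \<in> arrs (ty X)"
    let ?A = "src (ty X) h" and ?B = "trg (ty X) h"
    note h = X.source.arr_hom[OF a]
    have A: "?A \<in> obs (ty X)" and B: "?B \<in> obs (ty X)" using X.source.hom_obs[OF h] by auto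
    show "far (comp_functor (ty X) (compr Y) H) h =
        far (comp_functor (ty X) (arrow_functor (ctx X) G) (compr X)) h"
      using a X.compr.far_arr[OF a] Y.compr_eq_Sq[OF H.far_hom[OF h]] compr_ob[OF A] compr_ob[OF B]
        compr_far[OF h] far_proj_H[OF h] arg_cong[OF X.compr_eq_Sq[OF h], of "map_square (far G)"]
      by simp
  qed
  define M' where "M' = \<lparr>m_ctx = G, m_ty = H,
    m_iso = (\<lambda>A \<in> obs (ty X). idn (arrow_cat (ctx Y)) (fob (compr Y) (fob H A))),
    m_emp = idn (ctx Y) (emp Y)\<rparr>"
  have M': "cxl_strict_map X Y M'"
    unfolding M'_def using over compr G(2)[OF X.emp_obs] b(1) z(1)
    by (intro strict_mapI X.contextual_comp_cat_axioms Y.contextual_comp_cat_axioms G(1) H(1)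
        Y.arr_cartesian)
      (auto simp: cartesian_def hom_iff H.far_arr)
  interpret M': cxl_strict_map X Y M' by (fact M')
  define \<alpha> where "\<alpha> = \<lparr>c_src = M', c_trg = M, c_ctx = restrict b (obs (ctx
      X)), c_ty = restrict l (obs (ty X))\<rparr>"
  have "nat_trans (ctx X) (ctx Y) G ?F (restrict b (obs (ctx X)))"
    using G(3) b_hom' X.target.hom_obs
    by (intro nat_trans.intro nat_trans_axioms.intro G(1) M.m_ctx.cat_functor_axioms) auto
  moreover have "nat_trans (ty X) (ty Y) H ?F' (restrict l (obs (ty X)))"
    using H(3) l_hom' X.source.hom_obs
    by (intro nat_trans.intro nat_trans_axioms.intro H(1) M.m_ty.cat_functor_axioms) auto
  moreover have "transformation_axioms X Y \<alpha>"
  proof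
    fix A assume A: "A \<in> obs (ty X)"
    show "far (proj Y) (c_ty \<alpha> A) = c_ctx \<alpha> (fob (proj X) A)"
      using A l(2)[OF A] X.fob_obs[OF A] by (simp add: \<alpha>_def)
    show "cmp (ctx Y) (s_top (m_iso (c_trg \<alpha>) A)) (s_top (far (compr Y) (c_ty \<alpha> A))) =
        cmp (ctx Y) (c_ctx \<alpha> (ext X A)) (s_top (m_iso (c_src \<alpha>) A))"
      using A X.ext_obs[OF A] l(5)[OF A] Y.target.cmp_idn_right[OF b_hom'[OF X.ext_obs[OF A]]]
          G_ext[OF A]
      by (simp add: \<alpha>_def M'_def ext_def)
  next
    show "cmp (ctx Y) (m_emp (c_trg \<alpha>)) (c_ctx \<alpha> (emp X)) = m_emp (c_src \<alpha>)"
      using b(1) z(3) X.emp_obs by (simp add: \<alpha>_def M'_def)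
  qed
  ultimately have "transformation X Y \<alpha>"
    using M'.cxl_pseudo_map_axioms M.cxl_pseudo_map_axioms
    by (simp add: transformation_def \<alpha>_def) (simp add: M'_def)
  then show thesis
    using that[of \<alpha>] M' b_iso by (simp add: \<alpha>_def)
qed

section \<open>Rigidity of strict maps\<close>

lemma strict_ext:
  assumes "cxl_strict_map X Y M" "A \<in> obs (ty X)"
  shows "far (m_ctx M) (fob (compr X) A) = fob (compr Y) (fob (m_ty M) A)"
    and "fob (m_ctx M) (ext X A) = ext Y (fob (m_ty M) A)"
proof -
  interpret cxl_strict_map X Y M by fact
  show 1: "far (m_ctx M) (fob (compr X) A) = fob (compr Y) (fob (m_ty M) A)"
    using arg_cong[OF compr_strict, of "\<lambda>F. fob F A"] assms(2) source.compr.fob_obs[OF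
        assms(2)] by simp
  show "fob (m_ctx M) (ext X A) = ext Y (fob (m_ty M) A)"
    using m_ctx.far_src[of "fob (compr X) A"] source.compr.fob_obs[OF assms(2)] 1 by (simp add:
        ext_def)
qed

lemma strict_top:
  assumes "cxl_strict_map X Y M" "h \<in> arrs (ty X)"
  shows "far (m_ctx M) (s_top (far (compr X) h)) = s_top (far (compr Y) (far (m_ty M) h))"
proof -
  interpret cxl_strict_map X Y M by fact
  show ?thesis
    using arg_cong[OF compr_strict, of "\<lambda>F. s_top (far F h)"] assms(2)
        source.compr.far_arr[OF assms(2)]
    by (cases "far (compr X) h") simp
qed

text \<open>The image of a type is recovered from the image of its extension, since
  \<open>ext\<close> is injective, and the image of a type morphism from its target and its
  projection; the remaining data of a strict map are identities.\<close>

lemma strict_map_eqI: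
  assumes "discrete_contextual_comp_cat Y" "cxl_strict_map X Y M" "cxl_strict_map X Y N"
    and eq: "m_ctx M = m_ctx N"
  shows "M = N"
proof -
  interpret Y: discrete_contextual_comp_cat Y by fact
  interpret M: cxl_strict_map X Y M by fact
  interpret N: cxl_strict_map X Y N by fact
  have ob: "fob (m_ty M) A = fob (m_ty N) A" if A: "A \<in> obs (ty X)" for A
    using Y.ext_inj[OF M.m_ty.fob_obs[OF A] N.m_ty.fob_obs[OF A]]
      strict_ext(2)[OF assms(2) A] strict_ext(2)[OF assms(3) A] eq by simp
  have ar: "far (m_ty M) h = far (m_ty N) h" if h: "h \<in> arrs (ty X)" for h
    using h M.m_ty.far_arr N.m_ty.far_arr M.m_ty.far_trg N.m_ty.far_trg ob M.source.source.trg_in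
      M.proj_m_ty_far N.proj_m_ty_far eq by (intro Y.lift_eqI) simp_all
  have ty: "m_ty M = m_ty N"
    using functor_eqI[OF M.m_ty.cat_functor_axioms N.m_ty.cat_functor_axioms ob ar] .
  moreover have "m_iso M = m_iso N"
    by (rule extensionalityI[OF M.m_iso.component_ext N.m_iso.component_ext])
      (simp add: M.m_iso_strict N.m_iso_strict ty)
  ultimately show ?thesis
    using eq M.m_emp_strict N.m_emp_strict by simp
qed

text \<open>Induction on contexts shows that every context component is an identity. Naturality then
  makes the two context functors agree on arrows, and a strict map is determined by its context
  functor.\<close>

lemma transformation_strict_eq:
  assumes "discrete_contextual_comp_cat Y" "transformation X Y \<alpha>"
    and "cxl_strict_map X Y (c_src \<alpha>)" "cxl_strict_map X Y (c_trg \<alpha>)"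
  shows "c_src \<alpha> = c_trg \<alpha>"
proof -
  interpret Y: discrete_contextual_comp_cat Y by fact
  interpret a: transformation X Y \<alpha> by fact
  interpret F: cxl_strict_map X Y "c_src \<alpha>" by fact
  interpret G: cxl_strict_map X Y "c_trg \<alpha>" by fact
  let ?F = "m_ctx (c_src \<alpha>)" and ?G = "m_ctx (c_trg \<alpha>)"
  have c: "c_ctx \<alpha> \<Gamma> = idn (ctx Y) (fob ?G \<Gamma>) \<and> fob ?F \<Gamma> = fob ?G
      \<Gamma>" if "\<Gamma> \<in> obs (ctx X)" for \<Gamma>
    using that
  proof (induction rule: a.source.source.ctx_induct)
    case empty
    show ?case
      using Y.target.terminal_unique[OF Y.emp_terminal] a.c_ctx.component_in[OF
          a.source.source.emp_obs]
        F.emp_strict G.emp_strict Y.target.idn_in[OF Y.emp_obs] by metis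
  next
    case (extend A)
    note A = extend(1)
    have GA: "fob (m_ty (c_trg \<alpha>)) A \<in> obs (ty Y)" using a.target.m_ty.fob_obs[OF A] .
    have e: "ext X A \<in> obs (ctx X)" using a.source.source.ext_obs[OF A] .
    \<comment> \<open>The type component is the lift of an identity, hence an identity. Comparing
      sources shows that both maps send \<open>A\<close> to the same type.\<close>
    have ty: "c_ty \<alpha> A = idn (ty Y) (fob (m_ty (c_trg \<alpha>)) A)"
      using a.c_ty.component_in[OF A] Y.source.idn_in[OF GA] a.c_ty_over[OF A] extend(2)
        Y.far_idn[OF GA] a.target.proj_m_ty[OF A] by (intro Y.lift_eqI) (auto simp: hom_iff)
    then have FG: "fob (m_ty (c_src \<alpha>)) A = fob (m_ty (c_trg \<alpha>)) A"
      using a.c_ty.component_in[OF A] Y.source.idn_in[OF GA] by (simp add: hom_iff)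
    have xe: "c_ctx \<alpha> (ext X A) \<in> hom (ctx Y) (ext Y (fob (m_ty (c_trg \<alpha>)) A))
        (ext Y (fob (m_ty (c_trg \<alpha>)) A))"
      using a.c_ctx.component_in[OF e] strict_ext(2)[OF assms(3) A] strict_ext(2)[OF assms(4) A] FG
          by simp
    have "s_top (m_iso (c_src \<alpha>) A) = idn (ctx Y) (ext Y (fob (m_ty (c_trg \<alpha>)) A))"
      "s_top (m_iso (c_trg \<alpha>) A) = idn (ctx Y) (ext Y (fob (m_ty (c_trg \<alpha>)) A))"
      using F.m_iso_strict[OF A] G.m_iso_strict[OF A] FG by (simp_all add: ext_def)
    then show ?case
      using a.c_compr[OF A] ty Y.compr_top_idn[OF GA] Y.target.cmp_idn_right[OF xe]
        Y.target.cmp_idn_left[OF Y.target.idn_in[OF Y.ext_obs[OF GA]]] strict_ext(2)[OF assms(3) A]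
        strict_ext(2)[OF assms(4) A] FG by simp
  qed
  have "?F = ?G"
  proof (rule functor_eqI[OF a.source.m_ctx.cat_functor_axioms a.target.m_ctx.cat_functor_axioms])
    fix f assume f: "f \<in> arrs (ctx X)"
    note f' = a.source.source.target.arr_hom[OF f]
    have s: "src (ctx X) f \<in> obs (ctx X)" and t: "trg (ctx X) f \<in> obs (ctx X)"
      using a.source.source.target.hom_obs[OF f'] by auto
    show "far ?F f = far ?G f"
      using a.c_ctx.naturality[OF f'] c[OF s] c[OF t]
        Y.target.cmp_idn_left[OF a.source.m_ctx.far_hom[OF f']]
        Y.target.cmp_idn_right[OF a.target.m_ctx.far_hom[OF f']] by simp
  qed (use c in blast)
  then show ?thesis
    using strict_map_eqI[OF assms(1,3,4)] by simp
qed


section \<open>The 2-categories of comprehension categories\<close>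

lemma hom_map_cat: "\<alpha> \<in> hom (map_cat P X Y) M N \<longleftrightarrow>
    transformation X Y \<alpha> \<and> c_src \<alpha> = M \<and> c_trg \<alpha> = N \<and> P X Y M
        \<and> P X Y N"
  by (auto simp: hom_iff map_cat_def)

lemma map_cat_simps [simp]:
  "obs (map_cat P X Y) = {M. P X Y M}"
  "src (map_cat P X Y) = c_src" "trg (map_cat P X Y) = c_trg"
  "idn (map_cat P X Y) = id_cell X Y" "cmp (map_cat P X Y) = vcomp_cell X Y"
  by (simp_all add: map_cat_def)

lemma arrs_map_cat: "\<alpha> \<in> arrs (map_cat P X Y) \<longleftrightarrow>
    transformation X Y \<alpha> \<and> P X Y (c_src \<alpha>) \<and> P X Y (c_trg \<alpha>)"
  by (simp add: map_cat_def)

lemma cell_simps [simp]: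
  "c_src (id_cell X Y M) = M" "c_trg (id_cell X Y M) = M"
  "c_src (vcomp_cell X Y \<beta> \<alpha>) = c_src \<alpha>" "c_trg (vcomp_cell X Y \<beta>
      \<alpha>) = c_trg \<beta>"
  "c_src (hcomp_cell X Y Z \<beta> \<alpha>) = comp_map X Y Z (c_src \<beta>) (c_src \<alpha>)"
  "c_trg (hcomp_cell X Y Z \<beta> \<alpha>) = comp_map X Y Z (c_trg \<beta>) (c_trg \<alpha>)"
  by (simp_all add: id_cell_def vcomp_cell_def hcomp_cell_def)

lemma category_prod_cat:
  assumes "category C" "category D"
  shows "category (prod_cat C D)"
proof -
  interpret C: category C by fact
  interpret D: category D by fact
  have hom: "p \<in> hom (prod_cat C D) x y \<longleftrightarrow>
      fst p \<in> hom C (fst x) (fst y) \<and> snd p \<in> hom D (snd x) (snd y)" for p x y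
    by (auto simp: hom_iff prod_cat_def split: prod.splits)
  show ?thesis
  proof
    fix f g h w x y z
    assume f: "f \<in> hom (prod_cat C D) w x"
    show "cmp (prod_cat C D) (idn (prod_cat C D) x) f = f"
      "cmp (prod_cat C D) f (idn (prod_cat C D) w) = f"
      using f C.cmp_idn_left C.cmp_idn_right D.cmp_idn_left D.cmp_idn_right
      unfolding hom by (auto simp: prod_cat_def split: prod.splits)
    assume g: "g \<in> hom (prod_cat C D) x y"
    show "cmp (prod_cat C D) g f \<in> hom (prod_cat C D) w y"
      using f g C.cmp_in D.cmp_in unfolding hom by (auto simp: prod_cat_def split: prod.splits)
    assume h: "h \<in> hom (prod_cat C D) y z"
    show "cmp (prod_cat C D) h (cmp (prod_cat C D) g f) = cmp (prod_cat C D) (cmp (prod_cat C D) h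
        g) f"
      using f g h C.cmp_assoc D.cmp_assoc unfolding hom by (auto simp: prod_cat_def split:
          prod.splits)
  next
    fix x assume "x \<in> obs (prod_cat C D)"
    then show "idn (prod_cat C D) x \<in> hom (prod_cat C D) x x"
      using C.idn_in D.idn_in unfolding hom by (auto simp: prod_cat_def)
  qed (auto simp: prod_cat_def C.src_in C.trg_in D.src_in D.trg_in)
qed

text \<open>Strict and pseudo maps share the same cells and the same compositions, so the 2-category
  laws are derived once from these closure properties.\<close>

locale map_class =
  fixes P :: "'u CC \<Rightarrow> 'u CC \<Rightarrow> 'u CC_map \<Rightarrow> bool"
  assumes pseudo: "P X Y M \<Longrightarrow> cxl_pseudo_map X Y M"
    and id_closed: "discrete_contextual_comp_cat X \<Longrightarrow> P X X (id_map X)"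
    and comp_closed: "P X Y M \<Longrightarrow> P Y Z N \<Longrightarrow> P X Z (comp_map X Y Z N
        M)"
begin

lemma category_map_cat:
  assumes Y: "discrete_contextual_comp_cat Y"
  shows "category (map_cat P X Y)"
proof
  fix \<alpha> \<beta> \<gamma> K L M N
  show "src (map_cat P X Y) \<alpha> \<in> obs (map_cat P X Y)" "trg (map_cat P X Y) \<alpha> \<in>
      obs (map_cat P X Y)"
    if "\<alpha> \<in> arrs (map_cat P X Y)"
    using that by (simp_all add: arrs_map_cat)
  show "idn (map_cat P X Y) M \<in> hom (map_cat P X Y) M M" if "M \<in> obs (map_cat P X Y)"
    using that transformation_id[OF pseudo] by (simp add: hom_map_cat)
  assume a: "\<alpha> \<in> hom (map_cat P X Y) K L"
  show "cmp (map_cat P X Y) (idn (map_cat P X Y) L) \<alpha> = \<alpha>"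
    "cmp (map_cat P X Y) \<alpha> (idn (map_cat P X Y) K) = \<alpha>"
    using a by (auto simp: hom_map_cat intro!: cell_eqI[OF Y] transformation_vcomp
        transformation_id pseudo)
  assume b: "\<beta> \<in> hom (map_cat P X Y) L M"
  show "cmp (map_cat P X Y) \<beta> \<alpha> \<in> hom (map_cat P X Y) K M"
    using a b by (auto simp: hom_map_cat intro!: transformation_vcomp)
  assume c: "\<gamma> \<in> hom (map_cat P X Y) M N"
  show "cmp (map_cat P X Y) \<gamma> (cmp (map_cat P X Y) \<beta> \<alpha>) =
      cmp (map_cat P X Y) (cmp (map_cat P X Y) \<gamma> \<beta>) \<alpha>"
    using a b c by (auto simp: hom_map_cat intro!: cell_eqI[OF Y] transformation_vcomp)
qed

text \<open>An equation between 2-cells only requires its two sides to be transformations with the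
  same source and target, by \<open>cell_eqI\<close>. The interchange law is thus reduced to the
  definitions of the boundaries, and associativity and units to the same laws for maps.\<close>

lemma two_category_CompCat: "two_category (CompCat P)"
proof -
  have dc: "contextual_comp_cat X" if "discrete_contextual_comp_cat X" for X :: "'u CC"
    using that by (simp add: discrete_contextual_comp_cat_def)
  note pseudo_id = pseudo[OF id_closed]
  have hcomp: "cat_functor (prod_cat (map_cat P Y Z) (map_cat P X Y)) (map_cat P X Z)
      \<lparr>fob = (\<lambda>(N, M) \<in> obs (map_cat P Y Z) \<times> obs (map_cat P X Y).
          comp_map X Y Z N M),
       far = (\<lambda>(\<beta>, \<alpha>) \<in> arrs (map_cat P Y Z) \<times> arrs (map_cat P X
           Y). hcomp_cell X Y Z \<beta> \<alpha>)\<rparr>"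
    (is "cat_functor ?D _ ?H")
    if Y: "discrete_contextual_comp_cat Y" and Z: "discrete_contextual_comp_cat Z" for X Y Z
  proof (intro cat_functor.intro category_prod_cat category_map_cat Y Z cat_functor_axioms.intro)
    show "fob ?H \<in> obs ?D \<rightarrow>\<^sub>E obs (map_cat P X Z)" "far ?H \<in> arrs ?D
        \<rightarrow>\<^sub>E arrs (map_cat P X Z)"
      by (auto simp: prod_cat_def arrs_map_cat intro: comp_closed transformation_hcomp)
    show "src (map_cat P X Z) (far ?H p) = fob ?H (src ?D p)"
      "trg (map_cat P X Z) (far ?H p) = fob ?H (trg ?D p)" if "p \<in> arrs ?D" for p
      using that by (auto simp: prod_cat_def arrs_map_cat)
    show "far ?H (idn ?D q) = idn (map_cat P X Z) (fob ?H q)" if q: "q \<in> obs ?D" for q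
    proof -
      obtain N M where "q = (N, M)" "P Y Z N" "P X Y M"
        using q by (auto simp: prod_cat_def)
      then show ?thesis
        by (auto simp: prod_cat_def arrs_map_cat transformation_id[OF pseudo] comp_closed
            intro!: cell_eqI[OF Z] transformation_hcomp)
    qed
    show "far ?H (cmp ?D g f) = cmp (map_cat P X Z) (far ?H g) (far ?H f)"
      if f: "f \<in> hom ?D x y" and g: "g \<in> hom ?D y z" for f g x y z
    proof -
      obtain \<beta> \<alpha> where f': "f = (\<beta>, \<alpha>)" by force
      obtain \<delta> \<gamma> where g': "g = (\<delta>, \<gamma>)" by force
      have "transformation Y Z \<beta>" "transformation X Y \<alpha>" "transformation Y Z \<delta>"
          "transformation X Y \<gamma>"
        "c_trg \<beta> = c_src \<delta>" "c_trg \<alpha> = c_src \<gamma>" "P Y Z (c_src \<beta>)"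
            "P X Y (c_src \<alpha>)"
        "P Y Z (c_src \<delta>)" "P X Y (c_src \<gamma>)" "P Y Z (c_trg \<delta>)" "P X Y (c_trg
            \<gamma>)"
        using f g by (auto simp: f' g' hom_iff prod_cat_def arrs_map_cat)
      then show ?thesis
        by (auto simp: f' g' prod_cat_def arrs_map_cat
            intro!: cell_eqI[OF Z] transformation_hcomp transformation_vcomp)
    qed
  qed
  show ?thesis
  proof (rule two_category.intro)
    fix W X Y Z
    assume "X \<in> objs (CompCat P)" "Y \<in> objs (CompCat P)"
    then have X: "discrete_contextual_comp_cat X" and Y: "discrete_contextual_comp_cat Y"
      by (simp_all add: CompCat_def)
    show "category (homc (CompCat P) X Y)"
      using category_map_cat[OF Y] by (simp add: CompCat_def)
    show "fob (hcomp (CompCat P) X Y Y) (id1 (CompCat P) Y, f) = f" if "f \<in> obs (homc (CompCat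
        P) X Y)" for f
      using that comp_map_id_left[OF pseudo] id_closed[OF Y] by (simp add: CompCat_def)
    show "fob (hcomp (CompCat P) X X Y) (f, id1 (CompCat P) X) = f" if "f \<in> obs (homc (CompCat
        P) X Y)" for f
      using that comp_map_id_right[OF pseudo] id_closed[OF X] by (simp add: CompCat_def)
    show "far (hcomp (CompCat P) X Y Y) (idn (homc (CompCat P) Y Y) (id1 (CompCat P) Y), \<alpha>)
        = \<alpha>"
      if "\<alpha> \<in> arrs (homc (CompCat P) X Y)" for \<alpha>
      using that id_closed[OF Y]
      by (auto simp: CompCat_def arrs_map_cat transformation_id pseudo comp_map_id_left
          intro!: cell_eqI[OF Y] transformation_hcomp)
    show "far (hcomp (CompCat P) X X Y) (\<alpha>, idn (homc (CompCat P) X X) (id1 (CompCat P) X))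
        = \<alpha>"
      if "\<alpha> \<in> arrs (homc (CompCat P) X Y)" for \<alpha>
      using that id_closed[OF X]
      by (auto simp: CompCat_def arrs_map_cat transformation_id pseudo comp_map_id_right
          intro!: cell_eqI[OF Y] transformation_hcomp)
    assume "Z \<in> objs (CompCat P)"
    then have Z: "discrete_contextual_comp_cat Z"
      by (simp add: CompCat_def)
    show "cat_functor (prod_cat (homc (CompCat P) Y Z) (homc (CompCat P) X Y)) (homc (CompCat P) X
        Z)
        (hcomp (CompCat P) X Y Z)"
      using hcomp[OF Y Z] by (simp add: CompCat_def)
    show "fob (hcomp (CompCat P) W Y Z) (h, fob (hcomp (CompCat P) W X Y) (g, f)) =
        fob (hcomp (CompCat P) W X Z) (fob (hcomp (CompCat P) X Y Z) (h, g), f)"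
      if "f \<in> obs (homc (CompCat P) W X)" "g \<in> obs (homc (CompCat P) X Y)"
        "h \<in> obs (homc (CompCat P) Y Z)" for f g h
      using that comp_map_assoc[OF pseudo pseudo pseudo]
      by (simp add: CompCat_def comp_closed)
    show "far (hcomp (CompCat P) W Y Z) (\<gamma>, far (hcomp (CompCat P) W X Y) (\<beta>,
        \<alpha>)) =
        far (hcomp (CompCat P) W X Z) (far (hcomp (CompCat P) X Y Z) (\<gamma>, \<beta>), \<alpha>)"
      if "\<alpha> \<in> arrs (homc (CompCat P) W X)" "\<beta> \<in> arrs (homc (CompCat P) X Y)"
        "\<gamma> \<in> arrs (homc (CompCat P) Y Z)" for \<alpha> \<beta> \<gamma>
      using that comp_map_assoc[OF pseudo pseudo pseudo]
      by (auto simp: CompCat_def arrs_map_cat comp_closed transformation_hcomp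
          intro!: cell_eqI[OF Z, of W] transformation_hcomp)
  next
    fix X assume "X \<in> objs (CompCat P)"
    then show "id1 (CompCat P) X \<in> obs (homc (CompCat P) X X)"
      by (simp add: CompCat_def id_closed)
  qed
qed

end

lemma map_class_pseudo: "map_class (cxl_pseudo_map :: 'u CC \<Rightarrow> _)"
proof (rule map_class.intro)
  show "cxl_pseudo_map X X (id_map X)" if "discrete_contextual_comp_cat X" for X :: "'u CC"
    using strict_id_map[of X] that by (simp add: discrete_contextual_comp_cat_def
        cxl_strict_map_def)
qed (auto intro: pseudo_comp_map)

lemma map_class_strict: "map_class (cxl_strict_map :: 'u CC \<Rightarrow> _)"
proof (rule map_class.intro)
  show "cxl_strict_map X X (id_map X)" if "discrete_contextual_comp_cat X" for X :: "'u CC"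
    using strict_id_map[of X] that by (simp add: discrete_contextual_comp_cat_def)
qed (blast intro: strict_comp_map cxl_strict_map.axioms(1))+

lemma internally_equivalent_refl:
  assumes "two_category K" "X \<in> objs K"
  shows "internally_equivalent K X X"
proof -
  interpret two_category K by fact
  show ?thesis
    unfolding internally_equivalent_def
    using id1_in[OF assms(2)] hcomp_unit_left1[OF assms(2,2)] isomorphic_refl[OF homc_category[OF
        assms(2,2)]]
    by metis
qed

text \<open>The inclusion is the identity on objects, on strict maps and on cells between them. What
  remains is that each pseudo map is isomorphic to a strict one in its hom-category.\<close>

lemma str2_equivalent_ps:
  "(CompCat_str2 :: ('u CC, 'u CC_map, 'u CC_cell) twocat) \<simeq>\<^sub>2 (CompCat_ps :: ('u CC,
      'u CC_map, 'u CC_cell) twocat)"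
proof -
  let ?S = "cxl_strict_map :: 'u CC \<Rightarrow> 'u CC \<Rightarrow> 'u CC_map \<Rightarrow> bool"
  let ?P = "cxl_pseudo_map :: 'u CC \<Rightarrow> 'u CC \<Rightarrow> 'u CC_map \<Rightarrow> bool"
  interpret S: map_class ?S by (rule map_class_strict)
  interpret P: map_class ?P by (rule map_class_pseudo)
  let ?\<Phi> = "\<lparr>f_ob = (\<lambda>X. X), f_hom = (\<lambda>X Y. id_functor (map_cat ?S X
      Y))\<rparr> ::
    ('u CC, 'u CC_map, 'u CC_cell, 'u CC, 'u CC_map, 'u CC_cell) two_fctr"
  have F: "cat_functor (map_cat ?S X Y) (map_cat ?P X Y) (id_functor (map_cat ?S X Y))"
    if Y: "discrete_contextual_comp_cat Y" for X Y :: "'u CC"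
  proof (intro cat_functor.intro cat_functor_axioms.intro S.category_map_cat[OF Y]
      P.category_map_cat[OF Y])
    interpret C: category "map_cat ?S X Y" by (rule S.category_map_cat[OF Y])
    fix x y z f g
    show "far (id_functor (map_cat ?S X Y)) (idn (map_cat ?S X Y) x) =
        idn (map_cat ?P X Y) (fob (id_functor (map_cat ?S X Y)) x)" if "x \<in> obs (map_cat ?S X
            Y)"
      using C.idn_in[OF that] that by (simp add: hom_iff)
    show "far (id_functor (map_cat ?S X Y)) (cmp (map_cat ?S X Y) g f) = cmp (map_cat ?P X Y)
        (far (id_functor (map_cat ?S X Y)) g) (far (id_functor (map_cat ?S X Y)) f)"
      if "f \<in> hom (map_cat ?S X Y) x y" "g \<in> hom (map_cat ?S X Y) y z"
      using C.cmp_in[OF that] that by (simp add: hom_iff)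
  qed (auto simp: id_functor_def arrs_map_cat S.pseudo)
  have two: "two_functor CompCat_str2 CompCat_ps ?\<Phi>"
    unfolding CompCat_str2_def CompCat_ps_def
  proof (intro two_functor.intro S.two_category_CompCat P.two_category_CompCat
      two_functor_axioms.intro)
    fix X Y Z :: "'u CC"
    assume "X \<in> objs (CompCat ?S)" "Y \<in> objs (CompCat ?S)"
    then have X: "discrete_contextual_comp_cat X" and Y: "discrete_contextual_comp_cat Y"
      by (simp_all add: CompCat_def)
    show "cat_functor (homc (CompCat ?S) X Y) (homc (CompCat ?P) (f_ob ?\<Phi> X) (f_ob ?\<Phi> Y))
        (f_hom ?\<Phi> X Y)"
      using F[OF Y] by (simp add: CompCat_def)
    show "fob (f_hom ?\<Phi> X Z) (fob (hcomp (CompCat ?S) X Y Z) (g, f)) =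
        fob (hcomp (CompCat ?P) (f_ob ?\<Phi> X) (f_ob ?\<Phi> Y) (f_ob ?\<Phi> Z))
          (fob (f_hom ?\<Phi> Y Z) g, fob (f_hom ?\<Phi> X Y) f)"
      if "f \<in> obs (homc (CompCat ?S) X Y)" "g \<in> obs (homc (CompCat ?S) Y Z)" for f g
      using that by (simp add: CompCat_def S.comp_closed S.pseudo)
    show "far (f_hom ?\<Phi> X Z) (far (hcomp (CompCat ?S) X Y Z) (\<beta>, \<alpha>)) =
        far (hcomp (CompCat ?P) (f_ob ?\<Phi> X) (f_ob ?\<Phi> Y) (f_ob ?\<Phi> Z))
          (far (f_hom ?\<Phi> Y Z) \<beta>, far (f_hom ?\<Phi> X Y) \<alpha>)"
      if "\<alpha> \<in> arrs (homc (CompCat ?S) X Y)" "\<beta> \<in> arrs (homc (CompCat ?S) Y Z)"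
          for \<alpha> \<beta>
      using that by (simp add: CompCat_def arrs_map_cat S.comp_closed S.pseudo transformation_hcomp)
  qed (auto simp: CompCat_def S.id_closed)
  have "two_equivalence CompCat_str2 CompCat_ps ?\<Phi>"
  proof (intro two_equivalence.intro two two_equivalence_axioms.intro)
    fix V :: "'u CC" assume V: "V \<in> objs CompCat_ps"
    have "internally_equivalent CompCat_ps (f_ob ?\<Phi> V) V"
      using internally_equivalent_refl[OF P.two_category_CompCat] V by (simp add: CompCat_ps_def)
    moreover have "V \<in> objs CompCat_str2"
      using V by (simp add: CompCat_ps_def CompCat_str2_def CompCat_def)
    ultimately show "\<exists>X \<in> objs CompCat_str2. internally_equivalent CompCat_ps (f_ob
        ?\<Phi> X) V" by blast
  next
    fix X Y :: "'u CC"
    assume "X \<in> objs CompCat_str2" "Y \<in> objs CompCat_str2"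
    then have X: "discrete_contextual_comp_cat X" and Y: "discrete_contextual_comp_cat Y"
      by (simp_all add: CompCat_def CompCat_str2_def)
    interpret PC: category "map_cat ?P X Y" by (rule P.category_map_cat[OF Y])
    have "cat_equivalence (map_cat ?S X Y) (map_cat ?P X Y) (id_functor (map_cat ?S X Y))"
    proof (rule full_faithful_ess_surj_equivalence[OF F[OF Y]])
      fix M assume "M \<in> obs (map_cat ?P X Y)"
      then have M: "cxl_pseudo_map X Y M" by simp
      obtain \<alpha> where \<alpha>: "transformation X Y \<alpha>" "cxl_strict_map X Y (c_src
          \<alpha>)" "c_trg \<alpha> = M"
          "\<And>\<Gamma>. \<Gamma> \<in> obs (ctx X) \<Longrightarrow> iso (ctx Y) (c_ctx \<alpha>
              \<Gamma>)"
        using strictification[OF X Y M] by blast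
      obtain \<beta> where \<beta>: "transformation X Y \<beta>" "c_src \<beta> = M" "c_trg \<beta>
          = c_src \<alpha>"
        using transformation_inverse[OF Y \<alpha>(1,4)] \<alpha>(3) by metis
      have h: "\<alpha> \<in> hom (map_cat ?P X Y) (c_src \<alpha>) M" "\<beta> \<in> hom (map_cat
          ?P X Y) M (c_src \<alpha>)"
        using \<alpha> \<beta> M S.pseudo by (simp_all add: hom_map_cat)
      \<comment> \<open>The inverse laws for \<alpha> and \<beta> are equations between cells with
        equal boundaries, so rigidity settles them.\<close>
      have "iso (map_cat ?P X Y) \<alpha>"
        using \<alpha> \<beta> M S.pseudo
        by (intro PC.isoI[OF h])
          (auto intro!: cell_eqI[OF Y] transformation_vcomp transformation_id)
      then have "isomorphic (map_cat ?P X Y) (fob (id_functor (map_cat ?S X Y)) (c_src \<alpha>)) M"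
        using h \<alpha>(2) by (auto simp: isomorphic_def)
      then show "\<exists>N \<in> obs (map_cat ?S X Y). isomorphic (map_cat ?P X Y) (fob
          (id_functor (map_cat ?S X Y)) N) M"
        using \<alpha>(2) by auto
    next
      fix M N \<alpha>
      assume "M \<in> obs (map_cat ?S X Y)" "N \<in> obs (map_cat ?S X Y)"
        "\<alpha> \<in> hom (map_cat ?P X Y) (fob (id_functor (map_cat ?S X Y)) M) (fob (id_functor
            (map_cat ?S X Y)) N)"
      then have "\<alpha> \<in> hom (map_cat ?S X Y) M N" by (simp add: hom_map_cat)
      then show "\<exists>\<beta> \<in> hom (map_cat ?S X Y) M N. far (id_functor (map_cat ?S X Y))
          \<beta> = \<alpha>"
        by (intro bexI[of _ \<alpha>]) (auto simp: hom_iff)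
    qed (auto simp: hom_iff)
    then show "cat_equivalence (homc CompCat_str2 X Y) (homc CompCat_ps (f_ob ?\<Phi> X) (f_ob
        ?\<Phi> Y)) (f_hom ?\<Phi> X Y)"
      by (simp add: CompCat_ps_def CompCat_str2_def CompCat_def)
  qed
  then show ?thesis
    unfolding two_equivalent_def by blast
qed

section \<open>Locally discrete 2-categories\<close>

lemma hom_discrete_cat: "f \<in> hom (discrete_cat S) x y \<longleftrightarrow> f \<in> S \<and> x
    = f \<and> y = f"
  by (auto simp: hom_iff discrete_cat_def)

lemma discrete_cat_simps [simp]:
  "obs (discrete_cat S) = S" "arrs (discrete_cat S) = S" "src (discrete_cat S) = (\<lambda>x. x)"
  "trg (discrete_cat S) = (\<lambda>x. x)" "idn (discrete_cat S) = (\<lambda>x. x)" "cmp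
      (discrete_cat S) = (\<lambda>y x. x)"
  by (simp_all add: discrete_cat_def)

lemma category_discrete_cat: "category (discrete_cat S)"
  by unfold_locales (auto simp: hom_discrete_cat)

text \<open>The arrows of a discrete category are its identities, which leaves no freedom in the
  arrow part.\<close>

lemma functor_discrete_cat:
  assumes "category D" "k \<in> S \<rightarrow>\<^sub>E obs D" "a \<in> extensional S" "\<And>x. x
      \<in> S \<Longrightarrow> a x = idn D (k x)"
  shows "cat_functor (discrete_cat S) D \<lparr>fob = k, far = a\<rparr>"
proof (intro cat_functor.intro cat_functor_axioms.intro category_discrete_cat assms(1))
  interpret D: category D by fact
  have k: "k x \<in> obs D" if "x \<in> S" for x using assms(2) that by blast
  show "far \<lparr>fob = k, far = a\<rparr> \<in> arrs (discrete_cat S) \<rightarrow>\<^sub>E arrs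
      D"
    using assms(3,4) D.idn_in[OF k] by (auto simp: PiE_def hom_iff)
  fix x y z f g
  show "src D (far \<lparr>fob = k, far = a\<rparr> f) = fob \<lparr>fob = k, far = a\<rparr> (src
      (discrete_cat S) f)"
    "trg D (far \<lparr>fob = k, far = a\<rparr> f) = fob \<lparr>fob = k, far = a\<rparr> (trg
        (discrete_cat S) f)"
    if "f \<in> arrs (discrete_cat S)"
    using that assms(4) D.idn_in[OF k] by (auto simp: hom_iff)
  show "far \<lparr>fob = k, far = a\<rparr> (cmp (discrete_cat S) g f) =
      cmp D (far \<lparr>fob = k, far = a\<rparr> g) (far \<lparr>fob = k, far = a\<rparr> f)"
    if "f \<in> hom (discrete_cat S) x y" "g \<in> hom (discrete_cat S) y z"
    using that assms(4) D.cmp_idn_left[OF D.idn_in[OF k]] by (auto simp: hom_discrete_cat)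
qed (use assms in auto)

lemma two_category_locally_discrete:
  assumes "category C"
  shows "two_category (locally_discrete C)"
proof -
  interpret category C by fact
  have hcomp: "cat_functor (prod_cat (discrete_cat (hom C Y Z)) (discrete_cat (hom C X Y)))
      (discrete_cat (hom C X Z)) \<lparr>fob = (\<lambda>(g, f) \<in> hom C Y Z \<times> hom C X Y.
          cmp C g f),
      far = (\<lambda>(g, f) \<in> hom C Y Z \<times> hom C X Y. cmp C g f)\<rparr>" for X Y Z
  proof -
    \<comment> \<open>The product of discrete categories is literally a discrete category, so the
      criterion for functors out of discrete categories applies to horizontal composition.\<close>
    have "prod_cat (discrete_cat (hom C Y Z)) (discrete_cat (hom C X Y)) =
        discrete_cat (hom C Y Z \<times> hom C X Y)"
      by (auto simp: prod_cat_def discrete_cat_def fun_eq_iff)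
    then show ?thesis
      using cmp_in by (auto intro!: functor_discrete_cat category_discrete_cat split: if_splits)
  qed
  show ?thesis
  proof (rule two_category.intro)
    fix W X Y Z f g h
    assume f: "f \<in> obs (homc (locally_discrete C) W X)" and g: "g \<in> obs (homc
        (locally_discrete C) X Y)"
      and h: "h \<in> obs (homc (locally_discrete C) Y Z)"
    then show "fob (hcomp (locally_discrete C) W Y Z) (h, fob (hcomp (locally_discrete C) W X Y)
        (g, f)) =
        fob (hcomp (locally_discrete C) W X Z) (fob (hcomp (locally_discrete C) X Y Z) (h, g), f)"
      using cmp_in[of f W X g Y] cmp_in[of g X Y h Z] cmp_assoc by (simp add: locally_discrete_def)
  next
    fix W X Y Z f g h
    assume f: "f \<in> arrs (homc (locally_discrete C) W X)" and g: "g \<in> arrs (homc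
        (locally_discrete C) X Y)"
      and h: "h \<in> arrs (homc (locally_discrete C) Y Z)"
    then show "far (hcomp (locally_discrete C) W Y Z) (h, far (hcomp (locally_discrete C) W X Y)
        (g, f)) =
        far (hcomp (locally_discrete C) W X Z) (far (hcomp (locally_discrete C) X Y Z) (h, g), f)"
      using cmp_in[of f W X g Y] cmp_in[of g X Y h Z] cmp_assoc by (simp add: locally_discrete_def)
  qed (use hcomp in \<open>auto simp: locally_discrete_def category_discrete_cat idn_in
      cmp_idn_left cmp_idn_right\<close>)
qed

text \<open>The assumptions speak of 1-cells only: 2-cells go to identities, and these are respected
  because horizontal composition in \<open>L\<close> is a functor and preserves identities.\<close>

lemma locally_discrete_two_functor:
  assumes C: "category C" and L: "two_category L"
    and k: "\<And>X. X \<in> obs C \<Longrightarrow> k X \<in> objs L"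
    and a: "\<And>X Y f. f \<in> hom C X Y \<Longrightarrow> a f \<in> obs (homc L (k X) (k Y))"
    and a_idn: "\<And>X. X \<in> obs C \<Longrightarrow> a (idn C X) = id1 L (k X)"
    and a_cmp: "\<And>X Y Z f g. f \<in> hom C X Y \<Longrightarrow> g \<in> hom C Y Z
        \<Longrightarrow>
      a (cmp C g f) = fob (hcomp L (k X) (k Y) (k Z)) (a g, a f)"
  shows "two_functor (locally_discrete C) L \<lparr>f_ob = k, f_hom = (\<lambda>X Y.
    \<lparr>fob = \<lambda>f \<in> hom C X Y. a f, far = \<lambda>f \<in> hom C X Y. idn (homc L (k
        X) (k Y)) (a f)\<rparr>)\<rparr>"
    (is "two_functor _ _ ?\<Phi>")
proof (intro two_functor.intro two_category_locally_discrete C L two_functor_axioms.intro)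
  interpret C: category C by fact
  interpret L: two_category L by fact
  fix X Y Z
  assume "X \<in> objs (locally_discrete C)" "Y \<in> objs (locally_discrete C)"
  then have X: "X \<in> obs C" and Y: "Y \<in> obs C"
    by (simp_all add: locally_discrete_def)
  show "cat_functor (homc (locally_discrete C) X Y) (homc L (f_ob ?\<Phi> X) (f_ob ?\<Phi> Y))
      (f_hom ?\<Phi> X Y)"
    using L.homc_category[OF k[OF X] k[OF Y]] a
    by (auto simp: locally_discrete_def intro!: functor_discrete_cat)
  show "fob (f_hom ?\<Phi> X Z) (fob (hcomp (locally_discrete C) X Y Z) (g, f)) =
      fob (hcomp L (f_ob ?\<Phi> X) (f_ob ?\<Phi> Y) (f_ob ?\<Phi> Z)) (fob (f_hom ?\<Phi> Y Z) g,
          fob (f_hom ?\<Phi> X Y) f)"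
    if "f \<in> obs (homc (locally_discrete C) X Y)" "g \<in> obs (homc (locally_discrete C) Y Z)"
        for f g
    using that C.cmp_in a_cmp by (simp add: locally_discrete_def)
  assume "Z \<in> objs (locally_discrete C)"
  then have Z: "Z \<in> obs C" by (simp add: locally_discrete_def)
  interpret H: cat_functor "prod_cat (homc L (k Y) (k Z)) (homc L (k X) (k Y))" "homc L (k X) (k Z)"
    "hcomp L (k X) (k Y) (k Z)"
    using L.hcomp_functor[OF k[OF X] k[OF Y] k[OF Z]] .
  show "far (f_hom ?\<Phi> X Z) (far (hcomp (locally_discrete C) X Y Z) (g, f)) =
      far (hcomp L (f_ob ?\<Phi> X) (f_ob ?\<Phi> Y) (f_ob ?\<Phi> Z)) (far (f_hom ?\<Phi> Y Z) g,
          far (f_hom ?\<Phi> X Y) f)"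
    if "f \<in> arrs (homc (locally_discrete C) X Y)" "g \<in> arrs (homc (locally_discrete C) Y
        Z)" for f g
    using that C.cmp_in a_cmp[of f X Y g Z] H.far_idn[of "(a g, a f)"] a[of f X Y] a[of g Y Z]
    by (simp add: locally_discrete_def prod_cat_def)
qed (use k a_idn category.idn_in[OF C] in \<open>auto simp: locally_discrete_def\<close>)

text \<open>An equivalence between discrete hom-categories amounts to a bijection of hom-sets, and
  an isomorphism of \<open>D\<close> is an internal equivalence whose 2-cells are
  identities.\<close>

lemma locally_discrete_equivalent:
  assumes F: "cat_functor C D F"
    and bij: "\<And>X Y. X \<in> obs C \<Longrightarrow> Y \<in> obs C \<Longrightarrow> bij_betw
        (far F) (hom C X Y) (hom D (fob F X) (fob F Y))"
    and surj: "\<And>V. V \<in> obs D \<Longrightarrow> \<exists>X \<in> obs C. isomorphic D (fob F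
        X) V"
  shows "locally_discrete C \<simeq>\<^sub>2 locally_discrete D"
proof -
  interpret F: cat_functor C D F by fact
  let ?\<Phi> = "\<lparr>f_ob = fob F, f_hom = (\<lambda>X Y. \<lparr>fob = \<lambda>f \<in> hom C
      X Y. far F f,
    far = \<lambda>f \<in> hom C X Y. idn (homc (locally_discrete D) (fob F X) (fob F Y)) (far F
        f)\<rparr>)\<rparr>"
  have two: "two_functor (locally_discrete C) (locally_discrete D) ?\<Phi>"
  proof (intro locally_discrete_two_functor two_category_locally_discrete F.source.category_axioms
      F.target.category_axioms)
    fix X Y Z f g assume "f \<in> hom C X Y" "g \<in> hom C Y Z"
    then show "far F (cmp C g f) =
        fob (hcomp (locally_discrete D) (fob F X) (fob F Y) (fob F Z)) (far F g, far F f)"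
      using F.far_cmp F.far_hom by (simp add: locally_discrete_def)
  qed (use F.fob_obs F.far_hom F.far_idn in \<open>auto simp: locally_discrete_def\<close>)
  have "two_equivalence (locally_discrete C) (locally_discrete D) ?\<Phi>"
  proof (intro two_equivalence.intro two two_equivalence_axioms.intro)
    fix X Y assume "X \<in> objs (locally_discrete C)" "Y \<in> objs (locally_discrete C)"
    then have X: "X \<in> obs C" and Y: "Y \<in> obs C" by (simp_all add: locally_discrete_def)
    let ?G = "\<lparr>fob = \<lambda>f \<in> hom C X Y. far F f, far = \<lambda>f \<in> hom C X Y.
        far F f\<rparr>"
    have "cat_equivalence (discrete_cat (hom C X Y)) (discrete_cat (hom D (fob F X) (fob F Y))) ?G"
    proof (rule full_faithful_ess_surj_equivalence)
      show "cat_functor (discrete_cat (hom C X Y)) (discrete_cat (hom D (fob F X) (fob F Y))) ?G"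
        using F.far_hom by (intro functor_discrete_cat category_discrete_cat) auto
      fix v assume "v \<in> obs (discrete_cat (hom D (fob F X) (fob F Y)))"
      then have "v \<in> far F ` hom C X Y"
        using bij_betw_imp_surj_on[OF bij[OF X Y]] by simp
      then obtain f where "f \<in> hom C X Y" "far F f = v"
        by blast
      then show "\<exists>f \<in> obs (discrete_cat (hom C X Y)). isomorphic (discrete_cat (hom D
          (fob F X) (fob F Y))) (fob ?G f) v"
        using F.far_hom by (auto intro!: bexI[of _ f] isomorphic_refl category_discrete_cat)
    qed (use bij[OF X Y] in \<open>auto simp: hom_discrete_cat bij_betw_def inj_on_def\<close>)
    then show "cat_equivalence (homc (locally_discrete C) X Y)
        (homc (locally_discrete D) (f_ob ?\<Phi> X) (f_ob ?\<Phi> Y)) (f_hom ?\<Phi> X Y)"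
      by (simp add: locally_discrete_def)
  next
    fix V assume "V \<in> objs (locally_discrete D)"
    then have "V \<in> obs D" by (simp add: locally_discrete_def)
    then obtain X f where X: "X \<in> obs C" and f: "f \<in> hom D (fob F X) V" "iso D f"
      using surj unfolding isomorphic_def by blast
    obtain g where g: "g \<in> hom D V (fob F X)" "cmp D g f = idn D (fob F X)" "cmp D f g = idn D
        V"
      using F.target.iso_inverse[OF f] by metis
    have "internally_equivalent (locally_discrete D) (fob F X) V"
      unfolding internally_equivalent_def
    proof (intro bexI conjI)
      show "f \<in> obs (homc (locally_discrete D) (fob F X) V)" "g \<in> obs (homc
          (locally_discrete D) V (fob F X))"
        using f g by (simp_all add: locally_discrete_def)
    qed (use f g F.target.idn_in F.target.hom_obs[OF f(1)] in
      \<open>auto simp: locally_discrete_def intro!: isomorphic_refl category_discrete_cat\<close>)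
    then show "\<exists>X \<in> objs (locally_discrete C). internally_equivalent (locally_discrete
        D) (f_ob ?\<Phi> X) V"
      using X by (auto simp: locally_discrete_def)
  qed
  then show ?thesis
    unfolding two_equivalent_def by blast
qed

section \<open>Strict maps without and with transformations\<close>

lemma CompCat_str1_simps [simp]:
  "obs CompCat_str1 = {X. discrete_contextual_comp_cat X}"
  "src CompCat_str1 = (\<lambda>(X, M, Y). X)" "trg CompCat_str1 = (\<lambda>(X, M, Y). Y)"
  "idn CompCat_str1 = (\<lambda>X. (X, id_map X, X))"
  "cmp CompCat_str1 = (\<lambda>(Y, N, Z) (X, M, _). (X, comp_map X Y Z N M, Z))"
  by (simp_all add: CompCat_str1_def)

lemma hom_CompCat_str1: "m \<in> hom CompCat_str1 X Y \<longleftrightarrow> (\<exists>M. m = (X, M,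
    Y) \<and>
    discrete_contextual_comp_cat X \<and> discrete_contextual_comp_cat Y \<and> cxl_strict_map X Y
        M)"
  by (auto simp: hom_iff CompCat_str1_def)

lemma category_CompCat_str1: "category (CompCat_str1 :: ('u CC, 'u CC_arr) cat)"
proof -
  note s = cxl_strict_map.axioms(1)
  interpret S: map_class "cxl_strict_map :: 'u CC \<Rightarrow> _" by (rule map_class_strict)
  show ?thesis
  proof
    fix W X Y Z :: "'u CC" and f g h
    assume "f \<in> hom CompCat_str1 W X"
    then show "cmp CompCat_str1 (idn CompCat_str1 X) f = f" "cmp CompCat_str1 f (idn CompCat_str1
        W) = f"
      by (auto simp: hom_CompCat_str1 comp_map_id_left[OF s] comp_map_id_right[OF s])
    assume "f \<in> hom CompCat_str1 W X" "g \<in> hom CompCat_str1 X Y"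
    then show "cmp CompCat_str1 g f \<in> hom CompCat_str1 W Y"
      by (auto simp: hom_CompCat_str1 S.comp_closed)
    assume "f \<in> hom CompCat_str1 W X" "g \<in> hom CompCat_str1 X Y" "h \<in> hom CompCat_str1
        Y Z"
    then show "cmp CompCat_str1 h (cmp CompCat_str1 g f) = cmp CompCat_str1 (cmp CompCat_str1 h g)
        f"
      by (auto simp: hom_CompCat_str1 comp_map_assoc[OF s s s])
  next
    fix X :: "'u CC" assume "X \<in> obs CompCat_str1"
    then show "idn CompCat_str1 X \<in> hom CompCat_str1 X X"
      by (simp add: hom_CompCat_str1 S.id_closed)
  qed (auto simp: CompCat_str1_def)
qed

text \<open>Fullness on hom-categories is the content: a transformation between strict maps has
  equal ends, and by rigidity it is then the identity cell. \<open>?a\<close> strips the recorded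
  source and target from an arrow of the 1-category.\<close>

lemma str1_equivalent_str2:
  "locally_discrete (CompCat_str1 :: ('u CC, 'u CC_arr) cat) \<simeq>\<^sub>2
    (CompCat_str2 :: ('u CC, 'u CC_map, 'u CC_cell) twocat)"
proof -
  let ?S = "cxl_strict_map :: 'u CC \<Rightarrow> 'u CC \<Rightarrow> 'u CC_map \<Rightarrow> bool"
  interpret S: map_class ?S by (rule map_class_strict)
  let ?C = "CompCat_str1 :: ('u CC, 'u CC_arr) cat"
  let ?a = "\<lambda>(X, M, Y). M"
  let ?\<Phi> = "\<lparr>f_ob = (\<lambda>X. X), f_hom = (\<lambda>X Y. \<lparr>fob = \<lambda>f
      \<in> hom ?C X Y. ?a f,
    far = \<lambda>f \<in> hom ?C X Y. idn (homc (CompCat ?S) X Y) (?a f)\<rparr>)\<rparr>"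
  have two: "two_functor (locally_discrete ?C) (CompCat ?S) ?\<Phi>"
    by (intro locally_discrete_two_functor category_CompCat_str1 S.two_category_CompCat)
      (auto simp: CompCat_def hom_CompCat_str1)
  have "two_equivalence (locally_discrete ?C) (CompCat ?S) ?\<Phi>"
  proof (intro two_equivalence.intro two two_equivalence_axioms.intro)
    fix X Y assume "X \<in> objs (locally_discrete ?C)" "Y \<in> objs (locally_discrete ?C)"
    then have X: "discrete_contextual_comp_cat X" and Y: "discrete_contextual_comp_cat Y"
      by (simp_all add: locally_discrete_def)
    let ?F = "\<lparr>fob = \<lambda>f \<in> hom ?C X Y. ?a f, far = \<lambda>f \<in> hom ?C X Y.
        id_cell X Y (?a f)\<rparr>"
    have "cat_equivalence (discrete_cat (hom ?C X Y)) (map_cat ?S X Y) ?F"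
    proof (rule full_faithful_ess_surj_equivalence)
      show "cat_functor (discrete_cat (hom ?C X Y)) (map_cat ?S X Y) ?F"
        by (intro functor_discrete_cat S.category_map_cat[OF Y]) (auto simp: hom_CompCat_str1)
      fix M assume "M \<in> obs (map_cat ?S X Y)"
      then show "\<exists>f \<in> obs (discrete_cat (hom ?C X Y)). isomorphic (map_cat ?S X Y) (fob
          ?F f) M"
        using X Y by (intro bexI[of _ "(X, M, Y)"])
          (auto simp: hom_CompCat_str1 intro!: isomorphic_refl S.category_map_cat)
    next
      fix f g \<alpha>
      assume "f \<in> obs (discrete_cat (hom ?C X Y))" "g \<in> obs (discrete_cat (hom ?C X Y))"
      then obtain M N where fg: "f = (X, M, Y)" "g = (X, N, Y)" "?S X Y M" "?S X Y N"
        by (auto simp: hom_CompCat_str1)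
      assume "\<alpha> \<in> hom (map_cat ?S X Y) (fob ?F f) (fob ?F g)"
      then have \<alpha>: "transformation X Y \<alpha>" "c_src \<alpha> = M" "c_trg \<alpha> = N"
        using X Y fg by (auto simp: hom_map_cat hom_CompCat_str1)
      then have "M = N" using transformation_strict_eq[OF Y \<alpha>(1)] fg by simp
      moreover have "id_cell X Y M = \<alpha>"
        using \<alpha> \<open>M = N\<close> transformation_id[OF S.pseudo[OF fg(3)]] by (intro
            cell_eqI[OF Y]) auto
      ultimately show "\<exists>h \<in> hom (discrete_cat (hom ?C X Y)) f g. far ?F h = \<alpha>"
        using X Y fg by (intro bexI[of _ "(X, M, Y)"]) (auto simp: hom_discrete_cat
            hom_CompCat_str1)
    qed (auto simp: hom_discrete_cat hom_CompCat_str1 dest: arg_cong[of _ _ c_src])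
    then show "cat_equivalence (homc (locally_discrete ?C) X Y)
        (homc (CompCat ?S) (f_ob ?\<Phi> X) (f_ob ?\<Phi> Y)) (f_hom ?\<Phi> X Y)"
      by (simp add: locally_discrete_def CompCat_def)
  next
    fix V assume V: "V \<in> objs (CompCat ?S)"
    have "internally_equivalent (CompCat ?S) (f_ob ?\<Phi> V) V"
      using internally_equivalent_refl[OF S.two_category_CompCat V] by simp
    then show "\<exists>X \<in> objs (locally_discrete ?C). internally_equivalent (CompCat ?S)
        (f_ob ?\<Phi> X) V"
      using V by (intro bexI[of _ V]) (auto simp: locally_discrete_def CompCat_def)
  qed
  then show ?thesis
    unfolding two_equivalent_def CompCat_str2_def by blast
qed

section \<open>Contextual categories as comprehension categories\<close>

context discrete_contextual_comp_cat
begin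

lemma lift_idn:
  assumes "A \<in> obs (ty X)"
  shows "lift X (idn (ctx X) (fob (proj X) A)) A = idn (ty X) A"
  using lift_far[OF source.idn_in[OF assms]] far_idn[OF assms] by simp

text \<open>The composite of the two lifts has target \<open>A\<close> and projection
  \<open>f\<close> after \<open>g\<close>. Strict functoriality of chosen pullbacks and of their top
  maps comes from here.\<close>

lemma lift_cmp:
  assumes "A \<in> obs (ty X)" "f \<in> hom (ctx X) \<Delta> (fob (proj X) A)" "g \<in> hom (ctx X)
      \<Theta> \<Delta>"
  defines "B \<equiv> src (ty X) (lift X f A)"
  shows "lift X (cmp (ctx X) f g) A = cmp (ty X) (lift X f A) (lift X g B)"
    and "lift X f A \<in> hom (ty X) B A" "lift X g B \<in> hom (ty X) (src (ty X) (lift X g B)) B"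
proof -
  note f = lift[OF assms(1,2), folded B_def]
  note g = lift[OF f(4) assms(3)[folded f(3)]]
  show "lift X f A \<in> hom (ty X) B A" "lift X g B \<in> hom (ty X) (src (ty X) (lift X g B)) B"
    using f g by auto
  show "lift X (cmp (ctx X) f g) A = cmp (ty X) (lift X f A) (lift X g B)"
    using lift_far[OF source.cmp_in[OF g(1) f(1)]] far_cmp[OF g(1) f(1)] f(2) g(2) by simp
qed

end

text \<open>Types of \<open>V\<close> are identified with the context extensions by them.\<close>

locale presentation = contextual_category X + V: discrete_contextual_comp_cat V
  for X :: "('o, 'a) cxl_cat" and V :: "('o, 'a, 't, 'm) cxl_comp_cat" +
  assumes ctx_und: "ctx V = und X" and emp_root: "emp V = root X"
    and parent_ext: "A \<in> obs (ty V) \<Longrightarrow> parent X (ext V A) = fob (proj V) A"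
    and pr_ext: "A \<in> obs (ty V) \<Longrightarrow> pr X (ext V A) = fob (compr V) A"
    and pb_ext: "h \<in> arrs (ty V) \<Longrightarrow>
      pb X (far (proj V) h) (ext V (trg (ty V) h)) = ext V (src (ty V) h)"
    and pb_top_ext: "h \<in> arrs (ty V) \<Longrightarrow>
      pb_top X (far (proj V) h) (ext V (trg (ty V) h)) = s_top (far (compr V) h)"
begin

lemma ext_nonroot: "A \<in> obs (ty V) \<Longrightarrow> ext V A \<in> obs (und X) - {root X}"
  using V.ext_obs V.ext_ne_emp by (simp add: ctx_und emp_root)

lemma nonroot_ext:
  assumes "\<Gamma> \<in> obs (und X) - {root X}"
  obtains A where "A \<in> obs (ty V)" "ext V A = \<Gamma>"
  using V.ext_surj[of \<Gamma>] assms by (auto simp: ctx_und emp_root)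

lemma pb_lift:
  assumes "A \<in> obs (ty V)" "f \<in> hom (und X) \<Delta> (parent X (ext V A))"
  shows "pb X f (ext V A) = ext V (src (ty V) (lift V f A))"
    and "pb_top X f (ext V A) = s_top (far (compr V) (lift V f A))"
    and "lift V f A \<in> hom (ty V) (src (ty V) (lift V f A)) A" "far (proj V) (lift V f A) = f"
proof -
  have "f \<in> hom (ctx V) \<Delta> (fob (proj V) A)"
    using assms by (simp add: ctx_und parent_ext)
  note l = V.lift[OF assms(1) this]
  then show "lift V f A \<in> hom (ty V) (src (ty V) (lift V f A)) A" "far (proj V) (lift V f A) =
      f"
    by auto
  then show "pb X f (ext V A) = ext V (src (ty V) (lift V f A))"
    "pb_top X f (ext V A) = s_top (far (compr V) (lift V f A))"
    using pb_ext[of "lift V f A"] pb_top_ext[of "lift V f A"] by (simp_all add: hom_iff)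
qed

end

section \<open>Strict maps and homomorphisms correspond through the context functor\<close>

text \<open>Every non-root object is the extension by a type, and its pullback along
  \<open>f\<close> is read off from the lift of \<open>f\<close>. A strict map sends this lift to an
  arrow over the image of \<open>f\<close> and preserves extensions and top maps.\<close>

lemma strict_map_cxl_hom:
  assumes "presentation X V" "presentation Y W" "cxl_strict_map V W M"
  shows "cxl_hom X Y (m_ctx M)"
proof -
  interpret X: presentation X V by fact
  interpret Y: presentation Y W by fact
  interpret M: cxl_strict_map V W M by fact
  have F: "cat_functor (und X) (und Y) (m_ctx M)"
    using M.m_ctx.cat_functor_axioms by (simp add: X.ctx_und Y.ctx_und)
  interpret F: cat_functor "und X" "und Y" "m_ctx M" by (rule F)
  note e = strict_ext[OF assms(3)]
  have ty: "fob (m_ty M) A \<in> obs (ty W)" if "A \<in> obs (ty V)" for A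
    using M.m_ty.fob_obs[OF that] .
  show ?thesis
  proof (intro cxl_hom.intro cxl_hom_axioms.intro X.contextual_category_axioms
      Y.contextual_category_axioms F)
    show "fob (m_ctx M) (root X) = root Y"
      using M.emp_strict by (simp add: X.emp_root Y.emp_root)
    fix \<Gamma> assume "\<Gamma> \<in> obs (und X) - {root X}"
    then obtain A where A: "A \<in> obs (ty V)" "\<Gamma> = ext V A"
      using X.nonroot_ext by metis
    show "fob (m_ctx M) \<Gamma> \<noteq> root Y"
      using e(2)[OF A(1)] Y.ext_nonroot[OF ty[OF A(1)]] A(2) by simp
    show p: "fob (m_ctx M) (parent X \<Gamma>) = parent Y (fob (m_ctx M) \<Gamma>)"
      using e(2)[OF A(1)] X.parent_ext[OF A(1)] Y.parent_ext[OF ty[OF A(1)]] M.proj_m_ty[OF A(1)]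
          A(2)
      by simp
    show "far (m_ctx M) (pr X \<Gamma>) = pr Y (fob (m_ctx M) \<Gamma>)"
      using e[OF A(1)] X.pr_ext[OF A(1)] Y.pr_ext[OF ty[OF A(1)]] A(2) by simp
    fix f \<Delta> assume f: "f \<in> hom (und X) \<Delta> (parent X \<Gamma>)"
    note l = X.pb_lift[OF A(1) f[unfolded A(2)]]
    let ?h = "lift V f A"
    have h: "?h \<in> arrs (ty V)" "trg (ty V) ?h = A" using l(3) by (simp_all add: hom_iff)
    have h': "far (m_ty M) ?h \<in> arrs (ty W)" using M.m_ty.far_arr[OF h(1)] .
    have "far (proj W) (far (m_ty M) ?h) = far (m_ctx M) f"
      using M.proj_m_ty_far[OF h(1)] l(4) by simp
    moreover have "trg (ty W) (far (m_ty M) ?h) = fob (m_ty M) A"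
      "src (ty W) (far (m_ty M) ?h) = fob (m_ty M) (src (ty V) ?h)"
      using M.m_ty.far_trg[OF h(1)] M.m_ty.far_src[OF h(1)] h(2) by simp_all
    moreover have "src (ty V) ?h \<in> obs (ty V)"
      using X.V.source.src_in[OF h(1)] .
    ultimately show "fob (m_ctx M) (pb X f \<Gamma>) = pb Y (far (m_ctx M) f) (fob (m_ctx M)
        \<Gamma>)"
      "far (m_ctx M) (pb_top X f \<Gamma>) = pb_top Y (far (m_ctx M) f) (fob (m_ctx M) \<Gamma>)"
      using Y.pb_ext[OF h'] Y.pb_top_ext[OF h'] e(2) A l(1,2) strict_top[OF assms(3) h(1)] by
          simp_all
  qed
qed

text \<open>The type part is forced: \<open>k A\<close> is the type whose extension is the image of
  the extension by \<open>A\<close>, and it exists because non-root objects are preserved. A type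
  morphism goes to the lift of the image of its projection.\<close>

lemma cxl_hom_strict_map:
  assumes "presentation X V" "presentation Y W" "cxl_hom X Y F"
  obtains M where "cxl_strict_map V W M" "m_ctx M = F"
proof -
  interpret X: presentation X V by fact
  interpret Y: presentation Y W by fact
  interpret F: cxl_hom X Y F by fact
  have F: "cat_functor (ctx V) (ctx W) F"
    using F.cat_functor_axioms by (simp add: X.ctx_und Y.ctx_und)
  interpret F': cat_functor "ctx V" "ctx W" F by (rule F)
  have "\<exists>B. B \<in> obs (ty W) \<and> ext W B = fob F (ext V A)" if "A \<in> obs (ty V)"
      for A
    using Y.nonroot_ext[of "fob F (ext V A)"] F.preserves_nonroot F.fob_obs X.ext_nonroot[OF that]
        by blast
  then obtain k where k: "\<And>A. A \<in> obs (ty V) \<Longrightarrow> k A \<in> obs (ty W)"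
    "\<And>A. A \<in> obs (ty V) \<Longrightarrow> ext W (k A) = fob F (ext V A)"
    by metis
  have proj: "fob (proj W) (k A) = fob F (fob (proj V) A)" if A: "A \<in> obs (ty V)" for A
    using F.preserves_parent[OF X.ext_nonroot[OF A]] X.parent_ext[OF A] Y.parent_ext[OF k(1)[OF A]]
        k(2)[OF A]
    by simp
  have compr: "fob (compr W) (k A) = far F (fob (compr V) A)" if A: "A \<in> obs (ty V)" for A
    using F.preserves_pr[OF X.ext_nonroot[OF A]] X.pr_ext[OF A] Y.pr_ext[OF k(1)[OF A]] k(2)[OF A]
    by simp
  define l where "l h = lift W (far F (far (proj V) h)) (k (trg (ty V) h))" for h
  have l: "l h \<in> hom (ty W) (k A) (k B)" "far (proj W) (l h) = far F (far (proj V) h)"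
    "s_top (far (compr W) (l h)) = far F (s_top (far (compr V) h))"
    if h: "h \<in> hom (ty V) A B" for h A B
  proof -
    have A: "A \<in> obs (ty V)" and B: "B \<in> obs (ty V)" using X.V.source.hom_obs[OF h] by auto
    have ph: "far (proj V) h \<in> hom (und X) (fob (proj V) A) (parent X (ext V B))"
      using X.V.far_hom[OF h] X.parent_ext[OF B] by (simp add: X.ctx_und)
    have "far F (far (proj V) h) \<in> hom (und Y) (fob F (fob (proj V) A)) (parent Y (ext W (k
        B)))"
      using F.far_hom[OF ph] Y.parent_ext[OF k(1)[OF B]] proj[OF B] X.parent_ext[OF B] by simp
    note p = Y.pb_lift[OF k(1)[OF B] this]
    have lh: "l h = lift W (far F (far (proj V) h)) (k B)"
      using h by (simp add: l_def hom_iff)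
    have h': "h \<in> arrs (ty V)" "src (ty V) h = A" "trg (ty V) h = B" using h by (simp_all add:
        hom_iff)
    show "far (proj W) (l h) = far F (far (proj V) h)"
      using p(4) lh by simp
    \<comment> \<open>A lift only comes with the right target. That its source is \<open>k A\<close>
      is preservation of chosen pullbacks, combined with injectivity of extension.\<close>
    have "ext W (src (ty W) (l h)) = ext W (k A)"
      using p(1) lh F.preserves_pb[OF X.ext_nonroot[OF B] ph] X.pb_ext[OF h'(1)] h' k(2) A B by simp
    then have "src (ty W) (l h) = k A"
      using Y.V.ext_inj k(1)[OF A] p(3) Y.V.source.hom_obs lh by metis
    then show "l h \<in> hom (ty W) (k A) (k B)"
      using p(3) lh by simp
    show "s_top (far (compr W) (l h)) = far F (s_top (far (compr V) h))"
      using p(2) lh F.preserves_pb_top[OF X.ext_nonroot[OF B] ph] X.pb_top_ext[OF h'(1)] h' k(2)[OF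
          B] by simp
  qed
  define G where "G = \<lparr>fob = restrict k (obs (ty V)), far = restrict l (arrs (ty V))\<rparr>"
  have Go: "fob G A = k A" if "A \<in> obs (ty V)" for A
    using that by (simp add: G_def)
  have Ga: "far G h = l h" if "h \<in> hom (ty V) A B" for h A B
    using that by (simp add: G_def hom_iff)
  have G: "cat_functor (ty V) (ty W) G"
  proof
    show "fob G \<in> obs (ty V) \<rightarrow>\<^sub>E obs (ty W)" using k(1) by (auto simp: G_def)
    show "far G \<in> arrs (ty V) \<rightarrow>\<^sub>E arrs (ty W)"
      using l(1)[OF X.V.source.arr_hom] by (auto simp: G_def hom_iff)
    fix A B D f g h
    show "src (ty W) (far G h) = fob G (src (ty V) h)" "trg (ty W) (far G h) = fob G (trg (ty V) h)"
      if "h \<in> arrs (ty V)"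
      using l(1)[OF X.V.source.arr_hom[OF that]] Ga[OF X.V.source.arr_hom[OF that]] that
        X.V.source.src_in[OF that] X.V.source.trg_in[OF that] by (auto simp: hom_iff Go)
    show "far G (idn (ty V) A) = idn (ty W) (fob G A)" if A: "A \<in> obs (ty V)"
    proof -
      note i = X.V.source.idn_in[OF A] and j = Y.V.source.idn_in[OF k(1)[OF A]]
      have "l (idn (ty V) A) = idn (ty W) (k A)"
        using l(1,2)[OF i] j X.V.far_idn[OF A] Y.V.far_idn[OF k(1)[OF A]] proj[OF A]
          F'.far_idn[OF X.V.fob_obs[OF A]]
        by (intro Y.V.lift_eqI) (auto simp: hom_iff)
      then show ?thesis using Ga[OF i] Go[OF A] by simp
    qed
    show "far G (cmp (ty V) g f) = cmp (ty W) (far G g) (far G f)"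
      if f: "f \<in> hom (ty V) A B" and g: "g \<in> hom (ty V) B D"
    proof -
      note gf = X.V.source.cmp_in[OF f g] and lgf = Y.V.source.cmp_in[OF l(1)[OF f] l(1)[OF g]]
      have "far (proj W) (l (cmp (ty V) g f)) = far (proj W) (cmp (ty W) (l g) (l f))"
        using l(2)[OF gf] X.V.far_cmp[OF f g] Y.V.far_cmp[OF l(1)[OF f] l(1)[OF g]] l(2)[OF f]
            l(2)[OF g]
          F'.far_cmp[OF X.V.far_hom[OF f] X.V.far_hom[OF g]] by simp
      then have "l (cmp (ty V) g f) = cmp (ty W) (l g) (l f)"
        using l(1)[OF gf] lgf by (intro Y.V.lift_eqI) (simp_all add: hom_iff)
      then show ?thesis using Ga[OF f] Ga[OF g] Ga[OF gf] by simp
    qed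
  qed
  interpret G: cat_functor "ty V" "ty W" G by (rule G)
  have over: "comp_functor (ty V) (proj W) G = comp_functor (ty V) F (proj V)"
    by (rule functor_eqI[OF functor_comp[OF G Y.V.cat_functor_axioms] functor_comp[OF
        X.V.cat_functor_axioms F]])
      (simp_all add: Go Ga[OF X.V.source.arr_hom] proj l(2)[OF X.V.source.arr_hom])
  have "comp_functor (ty V) (compr W) G = comp_functor (ty V) (arrow_functor (ctx V) F) (compr V)"
  proof (rule functor_eqI[OF functor_comp[OF G Y.V.compr.cat_functor_axioms]
        functor_comp[OF X.V.compr.cat_functor_axioms arrow_functor[OF F]]])
    fix A assume A: "A \<in> obs (ty V)"
    then show "fob (comp_functor (ty V) (compr W) G) A =
        fob (comp_functor (ty V) (arrow_functor (ctx V) F) (compr V)) A"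
      using compr[OF A] X.V.compr.fob_obs[OF A] Go[OF A] by simp
  next
    fix h assume a: "h \<in> arrs (ty V)"
    note h = X.V.source.arr_hom[OF a]
    have A: "src (ty V) h \<in> obs (ty V)" and B: "trg (ty V) h \<in> obs (ty V)"
      using X.V.source.hom_obs[OF h] by auto
    show "far (comp_functor (ty V) (compr W) G) h =
        far (comp_functor (ty V) (arrow_functor (ctx V) F) (compr V)) h"
      using a X.V.compr.far_arr[OF a] Y.V.compr_eq_Sq[OF l(1)[OF h]] compr[OF A] compr[OF B]
        l(2,3)[OF h] Ga[OF h] arg_cong[OF X.V.compr_eq_Sq[OF h], of "map_square (far F)"]
      by simp
  qed
  moreover have "fob F (emp V) = emp W"
    using F.preserves_root by (simp add: X.emp_root Y.emp_root)
  ultimately have "cxl_strict_map V W \<lparr>m_ctx = F, m_ty = G,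
    m_iso = (\<lambda>A \<in> obs (ty V). idn (arrow_cat (ctx W)) (fob (compr W) (fob G A))),
    m_emp = idn (ctx W) (emp W)\<rparr>"
    using over by (intro strict_mapI X.V.contextual_comp_cat_axioms Y.V.contextual_comp_cat_axioms
        F G Y.V.arr_cartesian) (auto simp: cartesian_def G.far_arr)
  then show thesis using that by simp
qed

text \<open>The underlying category is the category of contexts. The tree structure reads a
  non-empty context through its last type, and chosen pullbacks are comprehensions of lifts.\<close>

lemma presentation_of_comp_cat:
  fixes V :: "('o, 'a, 't, 'm) cxl_comp_cat"
  assumes "discrete_contextual_comp_cat V"
  obtains X where "presentation X V"
proof -
  interpret V: discrete_contextual_comp_cat V by fact
  \<comment> \<open>\<open>t\<close> returns the last type of a non-empty context; it is well
    determined because \<open>ext V\<close> is injective on types.\<close>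
  define t where "t = inv_into (obs (ty V)) (ext V)"
  have t: "t (ext V A) = A" if "A \<in> obs (ty V)" for A
    unfolding t_def using V.ext_inj that by (intro inv_into_f_f) (auto simp: inj_on_def)
  define X where "X = \<lparr>und = ctx V, root = emp V, parent = (\<lambda>\<Gamma>. fob (proj V)
      (t \<Gamma>)),
    pr = (\<lambda>\<Gamma>. fob (compr V) (t \<Gamma>)), pb = (\<lambda>f \<Gamma>. ext V (src (ty
        V) (lift V f (t \<Gamma>)))),
    pb_top = (\<lambda>f \<Gamma>. s_top (far (compr V) (lift V f (t \<Gamma>))))\<rparr>"
  have X: "und X = ctx V" "root X = emp V"
    "\<And>A. A \<in> obs (ty V) \<Longrightarrow> parent X (ext V A) = fob (proj V) A"
    "\<And>A. A \<in> obs (ty V) \<Longrightarrow> pr X (ext V A) = fob (compr V) A"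
    "\<And>A f. A \<in> obs (ty V) \<Longrightarrow> pb X f (ext V A) = ext V (src (ty V) (lift V f
        A))"
    "\<And>A f. A \<in> obs (ty V) \<Longrightarrow> pb_top X f (ext V A) = s_top (far (compr V)
        (lift V f A))"
    by (simp_all add: X_def t)
  have "contextual_category X"
  proof (intro contextual_category.intro contextual_category_axioms.intro)
    show "category (und X)" using V.target.category_axioms X(1) by simp
    show "terminal (und X) (root X)" using V.emp_terminal X(1,2) by simp
    show "\<exists>n. (parent X ^^ n) \<Gamma> = root X" if "\<Gamma> \<in> obs (und X)" for
        \<Gamma>
      using that unfolding X(1)
    proof (induction rule: V.ctx_induct)
      case empty
      show ?case using X(2) by (intro exI[of _ 0]) simp
    next
      case (extend A)
      then obtain n where "(parent X ^^ n) (parent X (ext V A)) = root X"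
        using X(3) by auto
      then show ?case by (intro exI[of _ "Suc n"]) (simp add: funpow_swap1)
    qed
    fix \<Gamma> assume "\<Gamma> \<in> obs (und X) - {root X}"
    then obtain A where A: "A \<in> obs (ty V)" and \<Gamma>: "\<Gamma> = ext V A"
      using V.ext_surj[of \<Gamma>] X(1,2) by auto
    note XA = X(3-)[OF A, folded \<Gamma>]
    show "parent X \<Gamma> \<in> obs (und X)" "pr X \<Gamma> \<in> hom (und X) \<Gamma> (parent X
        \<Gamma>)"
      using V.fob_obs[OF A] V.compr_hom[OF A] XA X(1) \<Gamma> by auto
    show "pb X (idn (und X) (parent X \<Gamma>)) \<Gamma> = \<Gamma>"
      "pb_top X (idn (und X) (parent X \<Gamma>)) \<Gamma> = idn (und X) \<Gamma>"
      using V.lift_idn[OF A] V.source.idn_in[OF A] V.compr_top_idn[OF A] XA X(1) \<Gamma>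
      by (simp_all add: hom_iff)
    fix f \<Delta> assume "f \<in> hom (und X) \<Delta> (parent X \<Gamma>)"
    then have f: "f \<in> hom (ctx V) \<Delta> (fob (proj V) A)" using XA X(1) by simp
    let ?B = "src (ty V) (lift V f A)"
    note l = V.lift[OF A f]
    show "pb X f \<Gamma> \<in> obs (und X) - {root X}"
      using XA X(1,2) V.ext_obs[OF l(4)] V.ext_ne_emp[OF l(4)] by simp
    show "parent X (pb X f \<Gamma>) = \<Delta>"
      using XA X(3)[OF l(4)] l(3) by simp
    \<comment> \<open>Every lift is cartesian, and comprehension sends cartesian arrows to
      pullbacks.\<close>
    have "pullback_square (ctx V) (far (compr V) (lift V f A))"
      using V.compr_cartesian V.arr_cartesian l(1) by (simp add: hom_iff)
    then show "pullback_square (und X) (Sq (pr X (pb X f \<Gamma>)) (pb_top X f \<Gamma>) f (pr X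
        \<Gamma>))"
      using V.compr_eq_Sq[OF l(1)] l(2) XA X(1) X(4)[OF l(4)] by simp
    fix g \<Theta> assume "g \<in> hom (und X) \<Theta> \<Delta>"
    then have g: "g \<in> hom (ctx V) \<Theta> \<Delta>" using X(1) by simp
    note c = V.lift_cmp[OF A f g]
    note c' = V.source.cmp_in[OF c(3,2)]
    show "pb X (cmp (und X) f g) \<Gamma> = pb X g (pb X f \<Gamma>)"
      using c' c(1) XA X(1) X(5)[OF l(4)] by (simp add: hom_iff)
    show "pb_top X (cmp (und X) f g) \<Gamma> = cmp (und X) (pb_top X f \<Gamma>) (pb_top X g (pb X
        f \<Gamma>))"
      using c(1) V.compr_top_cmp[OF c(3,2)] XA X(1) X(6)[OF l(4)] by simp
  qed
  moreover have "lift V (far (proj V) h) (trg (ty V) h) = h" "trg (ty V) h \<in> obs (ty V)"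
    if "h \<in> arrs (ty V)" for h
    using V.lift_far[OF V.source.arr_hom[OF that]] V.source.trg_in[OF that] by auto
  ultimately have "presentation X V"
    using X V.discrete_contextual_comp_cat_axioms
    by (intro presentation.intro presentation_axioms.intro) auto
  then show thesis using that by blast
qed

text \<open>The types are the non-root objects themselves, so that extension by a type is that
  object again, and only the morphisms of types need new names in the universe.\<close>

lemma comp_cat_presenting:
  fixes X :: "('u::infinite, 'u) cxl_cat"
  assumes "contextual_category X"
  obtains V :: "'u CC" where "presentation X V"
proof -
  interpret X: contextual_category X by fact
  \<comment> \<open>An infinite type is equinumerous with its square, which supplies the
    pairing.\<close>
  obtain e :: "'u \<times> 'u \<Rightarrow> 'u" where e: "inj e"
  proof -
    have "\<exists>f :: 'u \<times> 'u \<Rightarrow> 'u. bij_betw f (UNIV \<times> UNIV) UNIV"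
      using card_of_Times_same_infinite[OF infinite_UNIV] card_of_ordIso by blast
    then show thesis
      using that by (auto simp: bij_betw_def)
  qed
  let ?C = "und X"
  define N where "N = obs ?C - {root X}"
  \<comment> \<open>A morphism of types with target \<open>A\<close> over \<open>f\<close> is the
      pair \<open>(f, A)\<close>, coded as an element of
    the universe.  The top map of the pullback square does not determine \<open>f\<close>.\<close>
  define E where "E = {e (f, A) | f A. A \<in> N \<and> f \<in> arrs ?C \<and> trg ?C f = parent X
      A}"
  define a where "a h = fst (inv e h)" for h
  define b where "b h = snd (inv e h)" for h
  have ab [simp]: "a (e (f, A)) = f" "b (e (f, A)) = A" for f A
    using e by (simp_all add: a_def b_def)
  \<comment> \<open>The code of \<open>(f, A)\<close> is an arrow from \<open>f\<^sup>*A\<close> to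
    \<open>A\<close>, and composition composes the first components. The laws \<open>pb_idn\<close>
    and \<open>pb_cmp\<close> are what gives identities and composites the right source.\<close>
  define T where "T = \<lparr>obs = N, arrs = E, src = (\<lambda>h. pb X (a h) (b h)), trg = b,
    idn = (\<lambda>A. e (idn ?C (parent X A), A)), cmp = (\<lambda>k h. e (cmp ?C (a k) (a h), b
        k))\<rparr>"
  define p where "p = \<lparr>fob = (\<lambda>A \<in> N. parent X A), far = (\<lambda>h \<in> E. a
      h)\<rparr>"
  define c where "c = \<lparr>fob = (\<lambda>A \<in> N. pr X A),
    far = (\<lambda>h \<in> E. Sq (pr X (pb X (a h) (b h))) (pb_top X (a h) (b h)) (a h) (pr X (b
        h)))\<rparr>"
  define V :: "'u CC" where "V = \<lparr>ctx = ?C, ty = T, proj = p, compr = c, emp = root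
      X\<rparr>"
  have hom: "h \<in> hom T B A \<longleftrightarrow>
      (\<exists>f. h = e (f, A) \<and> A \<in> N \<and> f \<in> hom ?C (src ?C f) (parent X A)
          \<and> B = pb X f A)" for h A B
    by (auto simp: T_def E_def hom_iff)
  have arr: "h \<in> E \<longleftrightarrow> (\<exists>f A. h = e (f, A) \<and> A \<in> N \<and> f
      \<in> hom ?C (src ?C f) (parent X A))" for h
    by (auto simp: E_def hom_iff)
  have hom_E: "h \<in> hom T B A \<Longrightarrow> h \<in> E" for h A B
    by (simp add: T_def hom_iff)
  have par: "A \<in> N \<Longrightarrow> parent X A \<in> obs ?C" for A
    using X.parent_in by (simp add: N_def)
  have pr: "A \<in> N \<Longrightarrow> pr X A \<in> hom ?C A (parent X A)" for A
    using X.pr_in by (simp add: N_def)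
  have pb: "A \<in> N \<Longrightarrow> f \<in> hom ?C \<Delta> (parent X A) \<Longrightarrow> pb X
      f A \<in> N"
    and ppb: "A \<in> N \<Longrightarrow> f \<in> hom ?C \<Delta> (parent X A) \<Longrightarrow>
        parent X (pb X f A) = \<Delta>"
    and sq: "A \<in> N \<Longrightarrow> f \<in> hom ?C \<Delta> (parent X A) \<Longrightarrow>
      pullback_square ?C (Sq (pr X (pb X f A)) (pb_top X f A) f (pr X A))" for A f \<Delta>
    using X.pb_in X.parent_pb X.pb_pullback unfolding N_def by blast+
  have T: "category T"
  proof
    fix B A D k h g f
    show "src T h \<in> obs T" "trg T h \<in> obs T" if "h \<in> arrs T"
      using that pb by (auto simp: T_def arr)
    show "idn T A \<in> hom T A A" if "A \<in> obs T"
      unfolding hom using that X.idn_in[OF par] X.pb_idn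
      by (auto simp: T_def N_def hom_iff)
    assume "h \<in> hom T B A"
    then obtain f where h: "h = e (f, A)" "A \<in> N" "f \<in> hom ?C (src ?C f) (parent X A)" "B =
        pb X f A"
      by (auto simp: hom)
    have pB: "parent X B = src ?C f" using ppb h by simp
    show "cmp T (idn T A) h = h" "cmp T h (idn T B) = h"
      using h X.cmp_idn_left[OF h(3)] X.cmp_idn_right[OF h(3)] pB by (auto simp: T_def)
    fix k D assume "k \<in> hom T A D"
    then obtain g where k: "k = e (g, D)" "D \<in> N" "g \<in> hom ?C (src ?C g) (parent X D)" "A =
        pb X g D"
      by (auto simp: hom)
    have pA: "parent X A = src ?C g" using ppb k by simp
    note f' = h(3)[unfolded pA]
    show "cmp T k h \<in> hom T B D"
      unfolding hom using h k X.cmp_in[OF f' k(3)] X.pb_cmp[of D g "src ?C g" f "src ?C f"] f'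
      by (auto simp: T_def N_def hom_iff)
    fix l G assume "l \<in> hom T D G"
    then obtain m where l: "l = e (m, G)" "G \<in> N" "m \<in> hom ?C (src ?C m) (parent X G)" "D =
        pb X m G"
      by (auto simp: hom)
    have pD: "parent X D = src ?C m" using ppb l by simp
    show "cmp T l (cmp T k h) = cmp T (cmp T l k) h"
      using h k l X.cmp_assoc[OF f' k(3)[unfolded pD] l(3)] by (simp add: T_def)
  qed
  have p: "cat_functor T ?C p"
  proof (intro cat_functor.intro cat_functor_axioms.intro T X.category_axioms)
    show "fob p \<in> obs T \<rightarrow>\<^sub>E obs ?C" "far p \<in> arrs T \<rightarrow>\<^sub>E
        arrs ?C"
      using par by (auto simp: p_def T_def E_def)
    fix h show "src ?C (far p h) = fob p (src T h)" "trg ?C (far p h) = fob p (trg T h)"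
      if "h \<in> arrs T"
      using that pb ppb by (auto simp: p_def T_def arr hom_iff)
  next
    fix A assume A: "A \<in> obs T"
    show "far p (idn T A) = idn ?C (fob p A)"
      using category.idn_in[OF T A] A by (simp add: p_def T_def hom_def)
  next
    fix f g A B D assume h: "f \<in> hom T A B" "g \<in> hom T B D"
    have "f \<in> E" "g \<in> E" "cmp T g f \<in> E"
      using hom_E category.cmp_in[OF T h] h by blast+
    then show "far p (cmp T g f) = cmp ?C (far p g) (far p f)"
      by (simp add: p_def T_def)
  qed
  interpret p: cat_functor T ?C p by (rule p)
  have far_p: "far p (e (f, A)) = f" if "A \<in> N" "f \<in> hom ?C \<Delta> (parent X A)" for f A
      \<Delta>
    using that by (auto simp: p_def E_def hom_iff)
  have fib: "discrete_fibration T ?C p"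
  proof (intro discrete_fibration.intro p discrete_fibration_axioms.intro)
    fix A f assume "A \<in> obs T" "f \<in> arrs ?C" "trg ?C f = fob p A"
    then have A: "A \<in> N" and f: "f \<in> hom ?C (src ?C f) (parent X A)"
      by (auto simp: T_def p_def hom_iff)
    show "\<exists>!h. h \<in> arrs T \<and> trg T h = A \<and> far p h = f"
    proof (intro ex1I[of _ "e (f, A)"])
      show "e (f, A) \<in> arrs T \<and> trg T (e (f, A)) = A \<and> far p (e (f, A)) = f"
        using A f far_p[OF A f] by (auto simp: T_def arr)
      show "h = e (f, A)" if "h \<in> arrs T \<and> trg T h = A \<and> far p h = f" for h
        using that far_p by (auto simp: T_def arr)
    qed
  qed
  have sqa: "Sq (pr X (pb X f A)) (pb_top X f A) f (pr X A) \<in> hom (arrow_cat ?C) (pr X (pb X f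
      A)) (pr X A)"
    if "A \<in> N" "f \<in> hom ?C \<Delta> (parent X A)" for A f \<Delta>
    using sq[OF that] by (simp add: pullback_square_def hom_def)
  \<comment> \<open>Functoriality of comprehension is the strict functoriality of the chosen top
    maps.\<close>
  have c: "cat_functor T (arrow_cat ?C) c"
  proof (intro cat_functor.intro cat_functor_axioms.intro T category_arrow_cat X.category_axioms)
    show "fob c \<in> obs T \<rightarrow>\<^sub>E obs (arrow_cat ?C)"
      using pr by (auto simp: c_def T_def hom_iff)
    show "far c \<in> arrs T \<rightarrow>\<^sub>E arrs (arrow_cat ?C)"
      using sqa by (auto simp: c_def T_def arr hom_def)
    fix h show "src (arrow_cat ?C) (far c h) = fob c (src T h)" "trg (arrow_cat ?C) (far c h) = fob
        c (trg T h)"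
      if "h \<in> arrs T"
      using that pb by (auto simp: c_def T_def arr)
  next
    fix A assume A: "A \<in> obs T"
    then have "A \<in> obs ?C - {root X}" by (simp add: T_def N_def)
    then show "far c (idn T A) = idn (arrow_cat ?C) (fob c A)"
      using category.idn_in[OF T A] A X.pb_idn[of A] X.pb_top_idn[of A] pr[of A]
      by (simp add: c_def T_def hom_def)
  next
    fix k h A B D assume h: "h \<in> hom T A B" and k: "k \<in> hom T B D"
    obtain f where f: "h = e (f, B)" "B \<in> N" "f \<in> hom ?C (src ?C f) (parent X B)" "A = pb X
        f B"
      using h by (auto simp: hom)
    obtain g where g: "k = e (g, D)" "D \<in> N" "g \<in> hom ?C (src ?C g) (parent X D)" "B = pb X
        g D"
      using k by (auto simp: hom)
    have f': "f \<in> hom ?C (src ?C f) (src ?C g)" using f(3) g ppb by simp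
    have D: "D \<in> obs ?C - {root X}" using g(2) by (simp add: N_def)
    have "h \<in> E" "k \<in> E" "cmp T k h \<in> E"
      using hom_E category.cmp_in[OF T h k] h k by blast+
    then show "far c (cmp T k h) = cmp (arrow_cat ?C) (far c k) (far c h)"
      using f g X.pb_cmp[OF D g(3) f'] X.pb_top_cmp[OF D g(3) f'] by (simp add: c_def T_def)
  qed
  have far_c: "far c h = Sq (pr X (src T h)) (pb_top X (a h) (b h)) (a h) (pr X (b h))" if "h \<in>
      E" for h
    using that by (simp add: c_def T_def)
  have dcc: "comprehension_category V"
  proof (intro comprehension_category.intro fibration.intro fibration_axioms.intro
      comprehension_category_axioms.intro)
    show "cat_functor (ty V) (ctx V) (proj V)" "cat_functor (ty V) (arrow_cat (ctx V)) (compr V)"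
      using p c by (simp_all add: V_def)
    interpret F: discrete_fibration T ?C p by (rule fib)
    show "\<exists>h. cartesian (ty V) (ctx V) (proj V) h \<and> trg (ty V) h = A \<and> far (proj
        V) h = f"
      if "A \<in> obs (ty V)" "f \<in> arrs (ctx V)" "trg (ctx V) f = fob (proj V) A" for A f
    proof -
      have A: "A \<in> N" and f: "f \<in> hom ?C (src ?C f) (parent X A)"
        using that by (auto simp: V_def T_def p_def hom_iff)
      \<comment> \<open>\<open>V\<close> is not yet known to be a discrete contextual comprehension
        category, so cartesianness is checked by hand: the factor over \<open>w\<close> must be the
        code of \<open>w\<close> and the type \<open>f\<^sup>*A\<close>.\<close>
      have "cartesian T ?C p (e (f, A))"
        unfolding cartesian_def
      proof (intro conjI ballI impI)
        show h: "e (f, A) \<in> arrs T" using A f by (auto simp: T_def arr)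
        have src_h: "src T (e (f, A)) = pb X f A" "fob p (pb X f A) = src ?C f"
          using pb[OF A f] ppb[OF A f] by (simp_all add: T_def p_def)
        fix g w assume "g \<in> arrs T" and w: "w \<in> hom ?C (fob p (src T g)) (fob p (src T (e
            (f, A))))"
          and eq: "trg T g = trg T (e (f, A)) \<and> cmp ?C (far p (e (f, A))) w = far p g"
        then obtain g' where g: "g = e (g', A)" "g' \<in> hom ?C (src ?C g') (parent X A)"
          by (auto simp: T_def arr)
        have g': "g' = cmp ?C f w" using eq far_p[OF A f] far_p[OF A g(2)] g(1) by simp
        have w': "w \<in> hom ?C (src ?C g') (src ?C f)"
          using w pb[OF A g(2)] ppb[OF A g(2)] src_h by (simp add: T_def p_def g(1))
        have ppbA: "parent X (pb X f A) = src ?C f" using ppb[OF A f] .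
        have k: "e (w, pb X f A) \<in> hom T (src T g) (src T (e (f, A)))"
          unfolding hom using pb[OF A f] w' ppbA X.pb_cmp[of A f _ w] A f g g'
          by (auto simp: T_def N_def hom_iff)
        show "\<exists>!k. k \<in> hom T (src T g) (src T (e (f, A))) \<and> far p k = w \<and> cmp
            T (e (f, A)) k = g"
        proof (intro ex1I[of _ "e (w, pb X f A)"] conjI)
          show "far p (e (w, pb X f A)) = w" using far_p[OF pb[OF A f]] w' ppbA by simp
          show "cmp T (e (f, A)) (e (w, pb X f A)) = g" using g g' by (simp add: T_def)
          show "k = e (w, pb X f A)"
            if "k \<in> hom T (src T g) (src T (e (f, A))) \<and> far p k = w \<and> cmp T (e (f,
                A)) k = g" for k
            using that far_p by (auto simp: hom src_h)
        qed (rule k)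
      qed
      then show ?thesis
        using far_p[OF A f] by (intro exI[of _ "e (f, A)"]) (simp add: V_def T_def)
    qed
    show "comp_functor (ty V) (cod_functor (ctx V)) (compr V) = proj V"
    proof -
      have "fob (comp_functor T (cod_functor ?C) c) = fob p" "far (comp_functor T (cod_functor ?C)
          c) = far p"
        using pr sqa by (auto simp: comp_functor_def compose_def cod_functor_def c_def p_def T_def
            fun_eq_iff hom_iff arr hom_def[of "arrow_cat ?C"])
      then show ?thesis by (simp add: V_def)
    qed
    show "pullback_square (ctx V) (far (compr V) h)" if "cartesian (ty V) (ctx V) (proj V) h" for h
      using that sq by (auto simp: V_def cartesian_def T_def c_def arr)
  qed
  have ext: "ext V A = A" if "A \<in> N" for A
    using pr[OF that] that by (simp add: ext_def V_def c_def hom_iff)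
  have V: "ctx V = ?C" "obs (ty V) = N" "emp V = root X" "\<And>A. A \<in> N \<Longrightarrow> fob
      (proj V) A = parent X A"
    by (simp_all add: V_def T_def p_def)
  \<comment> \<open>Iterating \<open>parent\<close> down to the root lists the types of a context;
    the finite height of \<Gamma> drives the induction.\<close>
  have ex: "\<exists>As. iterated_ext V As \<Gamma>" if "\<Gamma> \<in> obs ?C" "(parent X ^^ n)
      \<Gamma> = root X" for \<Gamma> n
    using that
  proof (induction n arbitrary: \<Gamma>)
    case 0
    then show ?case using iterated_ext.empty[of V] V(3) by auto
  next
    case (Suc n)
    show ?case
    proof (cases "\<Gamma> = root X")
      case True
      then show ?thesis using iterated_ext.empty[of V] V(3) by auto
    next
      case False
      then have \<Gamma>: "\<Gamma> \<in> N" using Suc.prems by (simp add: N_def)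
      obtain As where "iterated_ext V As (parent X \<Gamma>)"
        using Suc.IH[OF par[OF \<Gamma>]] Suc.prems(2) by (auto simp: funpow_swap1)
      then show ?thesis
        using iterated_ext.extend[of V As _ \<Gamma>] \<Gamma> V ext[OF \<Gamma>] by auto
    qed
  qed
  \<comment> \<open>The last type of an expression of \<Gamma> is \<Gamma> itself, and the remaining
    list expresses its parent. The root is not a type, so it is expressed by the empty list
    only.\<close>
  have un: "As = Bs" if "iterated_ext V As \<Gamma>" "iterated_ext V Bs \<Gamma>" for As Bs \<Gamma>
    using that
  proof (induction arbitrary: Bs rule: iterated_ext.induct)
    case empty
    then show ?case
    proof (cases rule: iterated_ext.cases)
      case (extend Bs' \<Gamma>' B)
      then have "root X \<in> N" using ext[of B] V(2,3) by simp
      then show ?thesis by (simp add: N_def)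
    qed simp
  next
    case (extend As \<Gamma> A)
    from extend.prems show ?case
    proof (cases rule: iterated_ext.cases)
      case empty
      then show ?thesis using ext[of A] extend.hyps V by (auto simp: N_def)
    next
      case (extend Bs' \<Gamma>' B)
      then have "B = A" using ext V \<open>A \<in> obs (ty V)\<close> by simp
      then show ?thesis using extend extend.IH \<open>fob (proj V) A = \<Gamma>\<close> by auto
    qed
  qed
  have V': "discrete_contextual_comp_cat V"
  proof (intro discrete_contextual_comp_cat.intro contextual_comp_cat.intro
      contextual_comp_cat_axioms.intro dcc)
    show "discrete_fibration (ty V) (ctx V) (proj V)" using fib by (simp add: V_def)
    show "terminal (ctx V) (emp V)" using X.root_terminal V by simp
    show "\<exists>!As. iterated_ext V As \<Gamma>" if "\<Gamma> \<in> obs (ctx V)" for \<Gamma>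
      using ex un X.finite_height[of \<Gamma>] that V(1) by metis
  qed
  have "presentation X V"
  proof (intro presentation.intro presentation_axioms.intro X.contextual_category_axioms V')
    fix h assume "h \<in> arrs (ty V)"
    then obtain f A where h: "h = e (f, A)" "A \<in> N" "f \<in> hom ?C (src ?C f) (parent X A)"
      by (auto simp: V_def T_def arr)
    then have "h \<in> E" by (auto simp: arr)
    then show "pb X (far (proj V) h) (ext V (trg (ty V) h)) = ext V (src (ty V) h)"
      "pb_top X (far (proj V) h) (ext V (trg (ty V) h)) = s_top (far (compr V) h)"
      using ext[OF h(2)] ext[OF pb[OF h(2,3)]] far_p[OF h(2,3)] h(1) by (simp_all add: V_def T_def
          c_def)
  qed (use V ext in \<open>simp_all add: V_def c_def\<close>)
  then show thesis using that by blast
qed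

section \<open>The category of contextual categories and its equivalence with strict maps\<close>

lemma CxlCat_simps [simp]:
  "obs CxlCat = {X. contextual_category X}"
  "idn CxlCat = (\<lambda>X. (X, id_functor (und X), X))"
  "cmp CxlCat = (\<lambda>(_, G, Z) (X, F, _). (X, comp_functor (und X) G F, Z))"
  by (simp_all add: CxlCat_def)

lemma hom_CxlCat: "m \<in> hom CxlCat X Y \<longleftrightarrow> (\<exists>F. m = (X, F, Y) \<and>
    cxl_hom X Y F)"
  by (auto simp: hom_iff CxlCat_def)

text \<open>Closure of homomorphisms under identities and composition is inherited from strict maps
  by passing to presentations and back, which keeps the context functor.\<close>

lemma category_CxlCat: "category (CxlCat :: ('u::infinite Cxl, 'u Cxl_arr) cat)"
proof -
  have id: "cxl_hom X X (id_functor (und X))" if X: "contextual_category X" for X :: "'u Cxl"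
  proof -
    obtain V :: "'u CC" where V: "presentation X V" using comp_cat_presenting[OF X] .
    then have "contextual_comp_cat V" "ctx V = und X"
      by (simp_all add: presentation_def presentation_axioms_def discrete_contextual_comp_cat_def)
    then show ?thesis
      using strict_map_cxl_hom[OF V V strict_id_map] by (simp add: id_map_def)
  qed
  have comp: "cxl_hom X Z (comp_functor (und X) G F)" if F: "cxl_hom X Y F" and G: "cxl_hom Y Z G"
    for X Y Z :: "'u Cxl" and F G
  proof -
    have "contextual_category X" "contextual_category Y" "contextual_category Z"
      using F G by (simp_all add: cxl_hom_def)
    then obtain U V W :: "'u CC" where p: "presentation X U" "presentation Y V" "presentation Z W"
      using comp_cat_presenting by metis
    obtain M where M: "cxl_strict_map U V M" "m_ctx M = F" using cxl_hom_strict_map[OF p(1,2) F] .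
    obtain N where N: "cxl_strict_map V W N" "m_ctx N = G" using cxl_hom_strict_map[OF p(2,3) G] .
    have "ctx U = und X" using p(1) by (simp add: presentation_def presentation_axioms_def)
    then show ?thesis
      using strict_map_cxl_hom[OF p(1,3) strict_comp_map[OF M(1) N(1)]] M(2) N(2)
      by (simp add: comp_map_def)
  qed
  have fct: "cat_functor (und X) (und Y) F" if "cxl_hom X Y F" for X Y :: "'u Cxl" and F
    using that by (simp add: cxl_hom_def)
  show ?thesis
  proof
    fix W X Y Z :: "'u Cxl" and f g h
    assume "f \<in> hom CxlCat W X"
    then show "cmp CxlCat (idn CxlCat X) f = f" "cmp CxlCat f (idn CxlCat W) = f"
      by (auto simp: hom_CxlCat comp_functor_id_left[OF fct] comp_functor_id_right[OF fct])
    assume "f \<in> hom CxlCat W X" "g \<in> hom CxlCat X Y"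
    then show "cmp CxlCat g f \<in> hom CxlCat W Y"
      by (auto simp: hom_CxlCat comp)
    assume "f \<in> hom CxlCat W X" "g \<in> hom CxlCat X Y" "h \<in> hom CxlCat Y Z"
    then show "cmp CxlCat h (cmp CxlCat g f) = cmp CxlCat (cmp CxlCat h g) f"
      by (auto simp: hom_CxlCat comp_functor_assoc[OF fct])
  next
    fix X :: "'u Cxl" assume "X \<in> obs CxlCat"
    then show "idn CxlCat X \<in> hom CxlCat X X" by (simp add: hom_CxlCat id)
  qed (auto simp: CxlCat_def cxl_hom_def)
qed

text \<open>\<open>p\<close> chooses a presentation of every contextual category and
  \<open>m\<close> the strict map over a homomorphism. Since strict maps are determined by their
  context functors, the arbitrary choices are functorial and bijective on homs.\<close>

lemma Cxl_equivalent_str1: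
  "locally_discrete (CxlCat :: ('u::infinite Cxl, 'u Cxl_arr) cat) \<simeq>\<^sub>2
    locally_discrete (CompCat_str1 :: ('u CC, 'u CC_arr) cat)"
proof -
  let ?C = "CxlCat :: ('u Cxl, 'u Cxl_arr) cat" and ?D = "CompCat_str1 :: ('u CC, 'u CC_arr) cat"
  interpret C: category ?C by (rule category_CxlCat)
  interpret D: category ?D by (rule category_CompCat_str1)
  obtain p :: "'u Cxl \<Rightarrow> 'u CC" where p: "\<And>X. contextual_category X
      \<Longrightarrow> presentation X (p X)"
    using comp_cat_presenting by metis
  have dp: "discrete_contextual_comp_cat (p X)" "ctx (p X) = und X" if "contextual_category X" for X
    using p[OF that] by (simp_all add: presentation_def presentation_axioms_def)
  have cx: "contextual_category X" "contextual_category Y" if "cxl_hom X Y F" for X Y :: "'u Cxl"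
      and F
    using that by (simp_all add: cxl_hom_def)
  have "\<exists>M. cxl_strict_map (p X) (p Y) M \<and> m_ctx M = F" if "cxl_hom X Y F" for X Y F
    using cxl_hom_strict_map[OF p p that] cx[OF that] by metis
  then obtain m where m: "\<And>X Y F. cxl_hom X Y F \<Longrightarrow> cxl_strict_map (p X) (p Y)
      (m X Y F)"
      "\<And>X Y F. cxl_hom X Y F \<Longrightarrow> m_ctx (m X Y F) = F"
    by metis
  define F where "F = \<lparr>fob = restrict p (obs ?C), far = (\<lambda>(X, F, Y) \<in> arrs ?C.
      (p X, m X Y F, p Y))\<rparr>"
  have Fo: "fob F X = p X" if "contextual_category X" for X
    using that by (simp add: F_def)
  have Fa: "far F (X, G, Y) = (p X, m X Y G, p Y)" if "cxl_hom X Y G" for X G Y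
    using that by (simp add: F_def CxlCat_def)
  have F: "cat_functor ?C ?D F"
  proof
    show "fob F \<in> obs ?C \<rightarrow>\<^sub>E obs ?D" using dp by (auto simp: F_def)
    show "far F \<in> arrs ?C \<rightarrow>\<^sub>E arrs ?D"
      using m(1) dp cx by (auto simp: F_def CxlCat_def CompCat_str1_def)
    fix f assume "f \<in> arrs ?C"
    then obtain X G Y where f: "f = (X, G, Y)" "cxl_hom X Y G" by (auto simp: CxlCat_def)
    then show "src ?D (far F f) = fob F (src ?C f)" "trg ?D (far F f) = fob F (trg ?C f)"
      using Fa Fo cx[OF f(2)] by (simp_all add: CxlCat_def)
  next
    fix X assume "X \<in> obs ?C"
    then have X: "contextual_category X" by simp
    have i: "cxl_hom X X (id_functor (und X))"
      using C.idn_in[of X] X by (simp add: hom_CxlCat)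
    have "contextual_comp_cat (p X)"
      using dp(1)[OF X] by (simp add: discrete_contextual_comp_cat_def)
    \<comment> \<open>Preservation of identities only has to be compared on context functors;
      composites are treated in the same way.\<close>
    then have "m X X (id_functor (und X)) = id_map (p X)"
      using dp[OF X] m[OF i] by (intro strict_map_eqI[OF dp(1)[OF X] _ strict_id_map]) (simp_all
          add: id_map_def)
    then show "far F (idn ?C X) = idn ?D (fob F X)"
      using Fa[OF i] Fo[OF X] by simp
  next
    fix f g X Y Z assume f: "f \<in> hom ?C X Y" and g: "g \<in> hom ?C Y Z"
    then obtain G H where fg: "f = (X, G, Y)" "g = (Y, H, Z)" and G: "cxl_hom X Y G" and H:
        "cxl_hom Y Z H"
      by (auto simp: hom_CxlCat)
    have HG: "cxl_hom X Z (comp_functor (und X) H G)"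
      using C.cmp_in[OF f g] fg by (simp add: hom_CxlCat)
    have "m X Z (comp_functor (und X) H G) = comp_map (p X) (p Y) (p Z) (m Y Z H) (m X Y G)"
      using m[OF HG] m[OF G] m[OF H] dp(2) cx[OF G]
      by (intro strict_map_eqI[OF dp(1) _ strict_comp_map[OF m(1)[OF G] m(1)[OF H]]] cx(2)[OF H])
        (simp_all add: comp_map_def)
    then show "far F (cmp ?C g f) = cmp ?D (far F g) (far F f)"
      using Fa[OF HG] Fa[OF G] Fa[OF H] fg by simp
  qed
  show ?thesis
  proof (rule locally_discrete_equivalent[OF F])
    fix X Y assume "X \<in> obs ?C" "Y \<in> obs ?C"
    then have X: "contextual_category X" and Y: "contextual_category Y" by simp_all
    show "bij_betw (far F) (hom ?C X Y) (hom ?D (fob F X) (fob F Y))"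
      unfolding bij_betw_def
    proof
      show "inj_on (far F) (hom ?C X Y)"
        using Fa m(2) by (intro inj_onI) (metis hom_CxlCat prod.inject)
      show "far F ` hom ?C X Y = hom ?D (fob F X) (fob F Y)"
      proof (intro set_eqI iffI)
        fix v assume "v \<in> hom ?D (fob F X) (fob F Y)"
        then obtain M where v: "v = (p X, M, p Y)" and M: "cxl_strict_map (p X) (p Y) M"
          using Fo X Y by (auto simp: hom_CompCat_str1)
        have c: "cxl_hom X Y (m_ctx M)" using strict_map_cxl_hom[OF p[OF X] p[OF Y] M] .
        have "m X Y (m_ctx M) = M"
          using strict_map_eqI[OF dp(1)[OF Y] m(1)[OF c] M m(2)[OF c]] .
        then show "v \<in> far F ` hom ?C X Y"
          using Fa[OF c] v c by (intro image_eqI[of _ _ "(X, m_ctx M, Y)"]) (simp_all add: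
              hom_CxlCat)
      next
        fix v assume "v \<in> far F ` hom ?C X Y"
        then show "v \<in> hom ?D (fob F X) (fob F Y)"
          using cat_functor.far_hom[OF F] by blast
      qed
    qed
  next
    fix V assume "V \<in> obs ?D"
    then have V: "discrete_contextual_comp_cat V" by simp
    \<comment> \<open>\<open>V\<close> and \<open>p X\<close> present the same contextual category.
      The identity homomorphism of \<open>X\<close> yields strict maps in both directions, and they
      are mutually inverse because their composites have the identity as context functor.\<close>
    obtain X where X: "presentation X V" using presentation_of_comp_cat[OF V] .
    have cX: "contextual_category X" and cV: "ctx V = und X" and V': "contextual_comp_cat V"
      using X V by (simp_all add: presentation_def presentation_axioms_def
          discrete_contextual_comp_cat_def)
    note pX = p[OF cX] dp[OF cX]
    have p': "contextual_comp_cat (p X)" using pX(2) by (simp add: discrete_contextual_comp_cat_def)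
    have i: "cxl_hom X X (id_functor (und X))"
      using C.idn_in[of X] cX by (simp add: hom_CxlCat)
    obtain M where M: "cxl_strict_map (p X) V M" "m_ctx M = id_functor (und X)"
      using cxl_hom_strict_map[OF pX(1) X i] .
    obtain N where N: "cxl_strict_map V (p X) N" "m_ctx N = id_functor (und X)"
      using cxl_hom_strict_map[OF X pX(1) i] .
    have ii: "comp_functor (und X) (id_functor (und X)) (id_functor (und X)) = id_functor (und X)"
      using i by (intro comp_functor_id_left[of _ "und X"]) (simp add: cxl_hom_def)
    have NM: "comp_map (p X) V (p X) N M = id_map (p X)"
      using M N pX(3) ii
      by (intro strict_map_eqI[OF pX(2) strict_comp_map[OF M(1) N(1)] strict_id_map[OF p']])
        (simp add: comp_map_def id_map_def)
    have MN: "comp_map V (p X) V M N = id_map V"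
      using M N cV ii
      by (intro strict_map_eqI[OF V strict_comp_map[OF N(1) M(1)] strict_id_map[OF V']])
        (simp add: comp_map_def id_map_def)
    have h: "(p X, M, V) \<in> hom ?D (p X) V" "(V, N, p X) \<in> hom ?D V (p X)"
      using M N V pX(2) by (simp_all add: hom_CompCat_str1)
    have "iso ?D (p X, M, V)"
      using D.isoI[OF h] NM MN by simp
    then have "isomorphic ?D (fob F X) V"
      unfolding isomorphic_def Fo[OF cX] using h(1) by blast
    then show "\<exists>X \<in> obs ?C. isomorphic ?D (fob F X) V"
      using cX by auto
  qed
qed

theorem corollary47:
  "locally_discrete (CxlCat :: ('u::infinite Cxl, 'u Cxl_arr) cat) \<simeq>\<^sub>2
      locally_discrete (CompCat_str1 :: ('u CC, 'u CC_arr) cat) \<and>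
    locally_discrete (CompCat_str1 :: ('u CC, 'u CC_arr) cat) \<simeq>\<^sub>2
      (CompCat_str2 :: ('u CC, 'u CC_map, 'u CC_cell) twocat) \<and>
    (CompCat_str2 :: ('u CC, 'u CC_map, 'u CC_cell) twocat) \<simeq>\<^sub>2
      (CompCat_ps :: ('u CC, 'u CC_map, 'u CC_cell) twocat)"
  using Cxl_equivalent_str1 str1_equivalent_str2 str2_equivalent_ps by blast

end
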